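(* Let $X$ be an irreducible representation of $\mathcal A$ over $C$ (an irreducible right $\mathcal A\otimes C$-module). Then it factors through $w\chi_\Theta$ for some $w\in W$ and some subset $\Theta\subset\Delta$; that is, there is a right $C[\Lambda_\Theta(1)]$-module structure on $X$ such that $xE(\lambda)=x\cdot(w\chi_\Theta)(E(\lambda))$ for all $x\in X$, $\lambda\in\Lambda(1)$.
   Context: **Group data.** $F$ is a non-archimedean local field with residue field $\kappa$ of characteristic $p$; $\mathbf G$ is a connected reductive group over $F$; $\mathbf S$ a maximal $F$-split torus; $\mathbf Z$ its centralizer; $\mathbf B=\mathbf Z\mathbf U$ a minimal parabolic subgroup with unipotent radical $\mathbf U$; $\overline{\mathbf B}=\mathbf Z\overline{\mathbf U}$ the opposite one. $K$ is the special parahoric subgroup attached to a fixed special point of the apartment of $\mathbf S$, with its canonical surjection (pro-$p$ kernel) onto the $\kappa$-points of a connected reductive $\kappa$-group; $Z_\kappa$ is the image of $\mathbf Z(F)\cap K$ (finite, commutative, of order prime to $p$), and the pro-$p$-Iwahori subgroup $I(1)\subset K$ is the inverse image of the image of $\mathbf U(F)\cap K$. With $N=N_{\mathbf G(F)}(\mathbf S(F))$ put $W=N/\mathbf Z(F)$, $\widetilde W=N/(\mathbf Z(F)\cap K)$, $\widetilde W(1)=N/(\mathbf Z(F)\cap I(1))$, $\Lambda=\mathbf Z(F)/(\mathbf Z(F)\cap K)$, $\Lambda(1)=\mathbf Z(F)/(\mathbf Z(F)\cap I(1))$; $Z_\kappa=\ker(\widetilde W(1)\to\widetilde W)$. $V=X_*(\mathbf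 S)\otimes\mathbb R$ is identified with the apartment (special point as origin); $\mathbf Z(F)$ acts on it by translations, giving $\nu\colon\Lambda(1)\to V$ with $\alpha(\nu(z))=-\mathrm{val}(\alpha(z))$ for $z\in\mathbf S(F)$, $\alpha\in X^*(\mathbf S)$. $\Sigma\subset V^*$ is the reduced root system such that the affine Weyl group $\widetilde W_{\mathrm{aff}}\subset\widetilde W$ is generated by the reflections in the hyperplanes $\alpha+k=0$ ($\alpha\in\Sigma,k\in\mathbb Z$); $\Sigma^+$ is determined by $\mathbf B$, $\Delta$ is the set of simple roots. $\Sigma_{\mathrm{aff}}=\Sigma\times\mathbb Z$, $\Sigma_{\mathrm{aff}}^+=\Sigma^+\times\mathbb Z_{\ge0}\cup\Sigma\times\mathbb Z_{>0}$, $\Sigma^-_{\mathrm{aff}}=-\Sigma^+_{\mathrm{aff}}$; $S_{\mathrm{aff}}$ is the set of simple affine reflections; $W\subset\widetilde W$ is the stabilizer of the special point ($\widetilde W=W\ltimes\Lambda$), $S=S_{\mathrm{aff}}\cap W$. $\ell(\tilde w)=\#(\Sigma_{\mathrm{aff}}^+\cap\tilde w\Sigma_{\mathrm{aff}}^-)$, also for $\tilde w\in\widetilde W(1)$ through $\widetilde W(1)\to\widetilde W$. $\lambda\in\Lambda(1)$ is dominant (anti-dominant) if $\langle\nu(\lambda),\alpha\rangle\ge0$ ($\le0$) for all $\alpha\in\Sigma^+$. For $\tilde\alpha\in\Sigma_{\mathrm{aff}}$ take a facet $\mathcal F$ of codimension one in the hyperplane $\tilde\alpha=0$ with parahoric $K_{\mathcal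 F}$; $Z_{\tilde\alpha,\kappa}\subset Z_\kappa$ is the intersection of $Z_\kappa$ with the subgroup of the finite reductive quotient of $K_{\mathcal F}$ generated by the images of $K_{\mathcal F}\cap\mathbf U(F)$ and $K_{\mathcal F}\cap\overline{\mathbf U}(F)$ (independent of $\mathcal F$). For $s=s_{\tilde\alpha}\in S_{\mathrm{aff}}$ fix a lift $n_s\in\widetilde W(1)$ coming from the group generated by $K_{\mathcal F}\cap\mathbf U(F)$ and $K_{\mathcal F}\cap\overline{\mathbf U}(F)$, such that $(n_s)_{s\in S}$ satisfy the braid relations; for $w\in W$ define $n_w$ by a reduced expression. **Algebra.** $C$ is an algebraically closed field of characteristic $p$; $q_s$ ($s\in S_{\mathrm{aff}}$) are indeterminates with $q_s=q_{s'}$ if $s,s'$ are $\widetilde W$-conjugate, $q_{\tilde w}$ is the product of the $q_s$ over a reduced expression. $\mathcal H$ is the $C[q_s^{1/2}]$-algebra with basis $T_{\tilde w}$ ($\tilde w\in\widetilde W(1)$) and relations $T_{\tilde w_1}T_{\tilde w_2}=T_{\tilde w_1\tilde w_2}$ if lengths add, and $T_{n_s}^2=q_sT_{n_s^2}+c_sT_{n_s}$ for $s=s_{\tilde\alpha}\in S_{\mathrm{aff}}$ ($\tilde\alpha$ simple affine), $c_s=-(\#Z_{\tilde\alpha,\kappa})^{-1}\sum_{t\in Z_{\tilde\alpha,\kappa}}T_t$. $C$ is a $C[q_s^{1/2}]$-algebra via $q_s^{1/2}\mapsto0$. The Bernstein basis is $E(\lambda_1\lambda_2^{-1}n_w)=q_{\lambda_1\lambda_2^{-1}n_w}^{1/2}q_{\lambda_1}^{-1/2}q_{\lambda_2}^{1/2}q_{n_w}^{-1/2}T_{\lambda_1}T_{\lambda_2}^{-1}T_{n_w}$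 ($\lambda_1,\lambda_2\in\Lambda(1)$ anti-dominant, $w\in W$). $\mathcal A=\bigoplus_{\lambda\in\Lambda(1)}C[q_s^{1/2}]E(\lambda)$ is a subalgebra of $\mathcal H$; in $\mathcal A\otimes C$ one has $E(\lambda_1)E(\lambda_2)=E(\lambda_1\lambda_2)$ if $\nu(\lambda_1),\nu(\lambda_2)$ lie in a common closed Weyl chamber and $E(\lambda_1)E(\lambda_2)=0$ otherwise. **$\chi_\Theta$.** For $\Theta\subset\Delta$, $\Lambda_\Theta(1)=\{\lambda\in\Lambda(1)\mid\langle\nu(\lambda),\alpha\rangle=0\ (\alpha\in\Theta)\}$, $\Lambda_\Theta^+(1)$ is its subset of dominant elements, $C[\Lambda_\Theta(1)]=\bigoplus C\tau_\lambda$ is the group algebra. $\chi_\Theta\colon\mathcal A\to C[\Lambda_\Theta(1)]$ is the algebra homomorphism (with $q_s^{1/2}\mapsto0$) with $\chi_\Theta(E(\lambda))=\tau_\lambda$ if $\lambda\in\Lambda^+_\Theta(1)$ and $0$ otherwise; $(w\chi_\Theta)(E(\lambda))=\chi_\Theta(E(n_w^{-1}\lambda n_w))$. *)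

theory Defs
  imports
    "HOL-Analysis.Determinants"
    "HOL-Library.Poly_Mapping"
    "HOL-Computational_Algebra.Polynomial"
    "HOL-Algebra.Solvable_Groups"
begin

section \<open>Local fields\<close>

text \<open>
  A field \<open>F\<close> is given as a subfield of an algebraically closed field \<open>'k\<close>; for the local field
  below, \<open>'k\<close> is an algebraic closure of \<open>F\<close>.
\<close>

definition is_subfield :: "'k::field set \<Rightarrow> bool" where
  "is_subfield F \<longleftrightarrow> 0 \<in> F \<and> 1 \<in> F \<and>
     (\<forall>x\<in>F. \<forall>y\<in>F. x + y \<in> F \<and> x * y \<in> F \<and> - x \<in> F \<and> inverse x \<in> F)"

text \<open>\<open>val_ge val m x\<close> means \<open>val(x) \<ge> m\<close>, with the convention \<open>val(0) = \<infinity>\<close>;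
  the value of \<open>val\<close> at \<open>0\<close> and outside \<open>F\<close> is never used.\<close>

definition val_ge :: "('k::field \<Rightarrow> int) \<Rightarrow> int \<Rightarrow> 'k \<Rightarrow> bool" where
  "val_ge val m x \<longleftrightarrow> x = 0 \<or> m \<le> val x"

definition residue_field :: "'k::field set \<Rightarrow> ('k \<Rightarrow> int) \<Rightarrow> 'k set set" where
  "residue_field F val =
     {x \<in> F. val_ge val 0 x} //
     {(x, y). x \<in> F \<and> y \<in> F \<and> val_ge val 0 x \<and> val_ge val 0 y \<and> val_ge val 1 (x - y)}"

definition nonarch_local_field :: "'k::field set \<Rightarrow> ('k \<Rightarrow> int) \<Rightarrow> bool" where
  "nonarch_local_field F val \<longleftrightarrow>
     is_subfield F \<and>
     val ` (F - {0}) = UNIV \<and>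
     (\<forall>x\<in>F - {0}. \<forall>y\<in>F - {0}. val (x * y) = val x + val y) \<and>
     (\<forall>x\<in>F - {0}. \<forall>y\<in>F - {0}. x + y \<noteq> 0 \<longrightarrow> min (val x) (val y) \<le> val (x + y)) \<and>
     finite (residue_field F val) \<and>
     (\<forall>f::nat \<Rightarrow> 'k. range f \<subseteq> F \<longrightarrow>
        (\<forall>m. \<exists>N. \<forall>i\<ge>N. \<forall>j\<ge>N. val_ge val m (f i - f j)) \<longrightarrow>
        (\<exists>l\<in>F. \<forall>m. \<exists>N. \<forall>i\<ge>N. val_ge val m (f i - l)))"

definition algebraic_closure_of :: "'k::alg_closed_field set \<Rightarrow> bool" where
  "algebraic_closure_of F \<longleftrightarrow>
     (\<forall>x::'k. \<exists>P::'k poly. P \<noteq> 0 \<and> (\<forall>i. coeff P i \<in> F) \<and> poly P x = 0)"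


section \<open>Linear algebraic groups\<close>

text \<open>
  Linear algebraic groups are Zariski closed subgroups of \<open>GL\<^sub>n\<close> over the algebraically closed
  field \<open>'k\<close>, identified with their sets of \<open>'k\<close>-points; \<open>F\<close>-structures are expressed by ideals.
\<close>

definition GL :: "('k::field^'n^'n) monoid" where
  "GL = \<lparr>carrier = {g. invertible g}, monoid.mult = (**), one = mat 1\<rparr>"

abbreviation GL_on :: "('k::field^'n^'n) set \<Rightarrow> ('k^'n^'n) monoid" where
  "GL_on H \<equiv> GL\<lparr>carrier := H\<rparr>"

definition rat_points :: "'k::field set \<Rightarrow> ('k^'n^'n) set \<Rightarrow> ('k^'n^'n) set" where
  "rat_points F X = {g \<in> X. \<forall>i j. g $ i $ j \<in> F}"

inductive_set polyfun :: "'k::field set \<Rightarrow> ('k^'n^'n \<Rightarrow> 'k) set" for F where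
  const: "c \<in> F \<Longrightarrow> (\<lambda>_. c) \<in> polyfun F"
| coord: "(\<lambda>g. g $ i $ j) \<in> polyfun F"
| add: "f \<in> polyfun F \<Longrightarrow> h \<in> polyfun F \<Longrightarrow> (\<lambda>g. f g + h g) \<in> polyfun F"
| mul: "f \<in> polyfun F \<Longrightarrow> h \<in> polyfun F \<Longrightarrow> (\<lambda>g. f g * h g) \<in> polyfun F"

definition zclosed :: "('k::field^'n^'n) set \<Rightarrow> bool" where
  "zclosed X \<longleftrightarrow> (\<exists>I \<subseteq> polyfun UNIV. X = {g. invertible g \<and> (\<forall>f\<in>I. f g = 0)})"

text \<open>\<open>X\<close> is defined over \<open>F\<close> if the ideal of \<open>X\<close> is spanned over \<open>'k\<close> by polynomials over \<open>F\<close>.\<close>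

definition defined_over :: "'k::field set \<Rightarrow> ('k^'n^'n) set \<Rightarrow> bool" where
  "defined_over F X \<longleftrightarrow> zclosed X \<and>
     (\<forall>f\<in>polyfun UNIV. (\<forall>g\<in>X. f g = 0) \<longrightarrow>
        (\<exists>(m::nat) c h. (\<forall>i<m. h i \<in> polyfun F \<and> (\<forall>g\<in>X. h i g = 0)) \<and>
           f = (\<lambda>g. \<Sum>i<m. c i * h i g)))"

definition zconnected :: "('k::field^'n^'n) set \<Rightarrow> bool" where
  "zconnected X \<longleftrightarrow>
     \<not> (\<exists>A B. zclosed A \<and> zclosed B \<and> A \<noteq> {} \<and> B \<noteq> {} \<and> A \<inter> B = {} \<and> A \<union> B = X)"

definition alg_group :: "('k::field^'n^'n) set \<Rightarrow> bool" where
  "alg_group H \<longleftrightarrow> subgroup H GL \<and> zclosed H"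

definition unipotent_elt :: "'k::field^'n^'n \<Rightarrow> bool" where
  "unipotent_elt g \<longleftrightarrow> (\<exists>m::nat. (((**) (g - mat 1)) ^^ m) (mat 1) = 0)"

definition conn_normal_unipotent :: "('k::field^'n^'n) set \<Rightarrow> ('k^'n^'n) set \<Rightarrow> bool" where
  "conn_normal_unipotent U H \<longleftrightarrow>
     alg_group U \<and> zconnected U \<and> normal U (GL_on H) \<and> (\<forall>u\<in>U. unipotent_elt u)"

definition unipotent_radical :: "('k::field^'n^'n) set \<Rightarrow> ('k^'n^'n) set \<Rightarrow> bool" where
  "unipotent_radical U H \<longleftrightarrow>
     conn_normal_unipotent U H \<and> (\<forall>V. conn_normal_unipotent V H \<longrightarrow> V \<subseteq> U)"

definition connected_reductive :: "'k::field set \<Rightarrow> ('k^'n^'n) set \<Rightarrow> bool" where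
  "connected_reductive F G \<longleftrightarrow>
     alg_group G \<and> defined_over F G \<and> zconnected G \<and> unipotent_radical {mat 1} G"

definition split_torus :: "'k::field set \<Rightarrow> ('k^'n^'n) set \<Rightarrow> bool" where
  "split_torus F S \<longleftrightarrow> alg_group S \<and> defined_over F S \<and> zconnected S \<and>
     (\<exists>P \<in> rat_points F (carrier GL).
        \<forall>s\<in>S. \<forall>i j. i \<noteq> j \<longrightarrow> (P ** s ** matrix_inv P) $ i $ j = 0)"

definition max_split_torus :: "'k::field set \<Rightarrow> ('k^'n^'n) set \<Rightarrow> ('k^'n^'n) set \<Rightarrow> bool" where
  "max_split_torus F G S \<longleftrightarrow> split_torus F S \<and> S \<subseteq> G \<and>
     (\<forall>S'. split_torus F S' \<and> S \<subseteq> S' \<and> S' \<subseteq> G \<longrightarrow> S' = S)"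

definition borel_cand :: "('k::field^'n^'n) set \<Rightarrow> ('k^'n^'n) set \<Rightarrow> bool" where
  "borel_cand G B \<longleftrightarrow> alg_group B \<and> zconnected B \<and> solvable (GL_on B) \<and> B \<subseteq> G"

definition borel_subgroup :: "('k::field^'n^'n) set \<Rightarrow> ('k^'n^'n) set \<Rightarrow> bool" where
  "borel_subgroup G B \<longleftrightarrow>
     borel_cand G B \<and> (\<forall>B'. borel_cand G B' \<and> B \<subseteq> B' \<longrightarrow> B' = B)"

definition parabolic :: "'k::field set \<Rightarrow> ('k^'n^'n) set \<Rightarrow> ('k^'n^'n) set \<Rightarrow> bool" where
  "parabolic F G P \<longleftrightarrow>
     alg_group P \<and> defined_over F P \<and> P \<subseteq> G \<and> (\<exists>B \<subseteq> P. borel_subgroup G B)"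

definition min_parabolic :: "'k::field set \<Rightarrow> ('k^'n^'n) set \<Rightarrow> ('k^'n^'n) set \<Rightarrow> bool" where
  "min_parabolic F G P \<longleftrightarrow>
     parabolic F G P \<and> (\<forall>P'. parabolic F G P' \<and> P' \<subseteq> P \<longrightarrow> P' = P)"

text \<open>
  \<open>X\<^sup>*(S)\<close> and \<open>X\<^sub>*(S)\<close> for an \<open>F\<close>-split torus \<open>S\<close> (all characters and cocharacters are then defined
  over \<open>F\<close>), as functions extended by \<open>undefined\<close>.
\<close>

definition characters :: "'k::field set \<Rightarrow> ('k^'n^'n) set \<Rightarrow> ('k^'n^'n \<Rightarrow> 'k) set" where
  "characters F S = {a \<in> extensional S.
     (\<exists>f\<in>polyfun F. \<exists>m::nat. \<forall>s\<in>S. a s * det s ^ m = f s) \<and>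
     (\<forall>s\<in>S. a s \<noteq> 0) \<and> (\<forall>s\<in>S. \<forall>t\<in>S. a (s ** t) = a s * a t)}"

definition cocharacters :: "'k::field set \<Rightarrow> ('k^'n^'n) set \<Rightarrow> ('k \<Rightarrow> 'k^'n^'n) set" where
  "cocharacters F S = {\<mu> \<in> extensional (- {0}).
     (\<exists>(P :: 'n \<Rightarrow> 'n \<Rightarrow> 'k poly) m::nat. (\<forall>i j l. coeff (P i j) l \<in> F) \<and>
        (\<forall>t. t \<noteq> 0 \<longrightarrow> (\<forall>i j. t ^ m * \<mu> t $ i $ j = poly (P i j) t))) \<and>
     (\<forall>t. t \<noteq> 0 \<longrightarrow> \<mu> t \<in> S) \<and>
     (\<forall>t u. t \<noteq> 0 \<longrightarrow> u \<noteq> 0 \<longrightarrow> \<mu> (t * u) = \<mu> t ** \<mu> u)}"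

text \<open>The Lie algebra is the Zariski tangent space at \<open>1\<close>: the differential of \<open>f\<close> at \<open>1\<close> in
  direction \<open>X\<close> is the linear coefficient of the polynomial \<open>t \<mapsto> f(1 + tX)\<close>.\<close>

definition lie_algebra :: "('k::field^'n^'n) set \<Rightarrow> ('k^'n^'n) set" where
  "lie_algebra H = {X. \<forall>f\<in>polyfun UNIV. (\<forall>g\<in>H. f g = 0) \<longrightarrow>
     (\<forall>P. (\<forall>t. f (mat 1 + (\<chi> i j. t * X $ i $ j)) = poly P t) \<longrightarrow> coeff P 1 = 0)}"

definition roots :: "'k::field set \<Rightarrow> ('k^'n^'n) set \<Rightarrow> ('k^'n^'n) set \<Rightarrow> ('k^'n^'n \<Rightarrow> 'k) set" where
  "roots F H S = {a \<in> characters F S. (\<exists>s\<in>S. a s \<noteq> 1) \<and>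
     (\<exists>X\<in>lie_algebra H. X \<noteq> 0 \<and>
        (\<forall>s\<in>S. s ** X ** matrix_inv s = (\<chi> i j. a s * X $ i $ j)))}"


section \<open>Group data\<close>

text \<open>
  The apartment is the real vector space \<open>'v\<close> with the special point as its origin.  The datum
  consists of
  \<^item> \<open>loc_field\<close>, \<open>valn\<close>, \<open>res_char\<close>: the field \<open>F\<close>, its normalized valuation, \<open>p\<close>;
  \<^item> \<open>grp\<close>, \<open>tor\<close>, \<open>par\<close>, \<open>uni\<close>, \<open>par_op\<close>, \<open>uni_op\<close>: the groups \<open>G\<close>, \<open>S\<close>, \<open>B\<close>, \<open>U\<close> and the
    opposites of \<open>B\<close>, \<open>U\<close>;
  \<^item> \<open>cov\<close>, \<open>chr\<close>: the identification of \<open>X\<^sub>*(S) \<otimes> \<real>\<close> with \<open>'v\<close> and the linear forms on \<open>'v\<close>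
    attached to the elements of \<open>X\<^sup>*(S)\<close>;
  \<^item> \<open>apt_act\<close>: the action of \<open>N\<close> on the apartment;
  \<^item> \<open>Sig\<close>, \<open>coroot\<close>: the reduced root system \<open>\<Sigma>\<close> (linear forms on \<open>'v\<close>) and its coroots;
  \<^item> \<open>parahoric\<close>, \<open>red_grp\<close>, \<open>red\<close>: for each facet \<open>\<F>\<close> of the apartment, the parahoric subgroup
    \<open>K\<^sub>\<F>\<close>, the reductive group over the residue field, and the surjection of \<open>K\<^sub>\<F>\<close> onto the
    rational points of the latter;
  \<^item> \<open>facet_of\<close>: for each affine root, the chosen facet of codimension one in its hyperplane;
  \<^item> \<open>n_lift\<close>: the lifts \<open>s \<mapsto> n\<^sub>s\<close>.
\<close>

record ('k, 'n, 'r, 'm, 'v) group_data =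
  loc_field :: "'k set"
  valn :: "'k \<Rightarrow> int"
  res_char :: nat
  grp :: "('k^'n::finite^'n) set"
  tor :: "('k^'n^'n) set"
  par :: "('k^'n^'n) set"
  uni :: "('k^'n^'n) set"
  par_op :: "('k^'n^'n) set"
  uni_op :: "('k^'n^'n) set"
  cov :: "('k \<Rightarrow> 'k^'n^'n) \<Rightarrow> 'v"
  chr :: "('k^'n^'n \<Rightarrow> 'k) \<Rightarrow> 'v \<Rightarrow> real"
  apt_act :: "'k^'n^'n \<Rightarrow> 'v \<Rightarrow> 'v"
  Sig :: "('v \<Rightarrow> real) set"
  coroot :: "('v \<Rightarrow> real) \<Rightarrow> 'v"
  parahoric :: "'v set \<Rightarrow> ('k^'n^'n) set"
  red_grp :: "'v set \<Rightarrow> ('r^'m::finite^'m) set"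
  red :: "'v set \<Rightarrow> 'k^'n^'n \<Rightarrow> 'r^'m^'m"
  facet_of :: "('v \<Rightarrow> real) \<Rightarrow> 'v set"
  n_lift :: "('k^'n^'n) set \<Rightarrow> ('k^'n^'n) set"

type_synonym ('k, 'n, 'r, 'm, 'v) gdata = "('k, 'n, 'r, 'm, 'v) group_data"

definition cen :: "('k::field,'n::finite,'r::field,'m::finite,'v::real_vector) gdata \<Rightarrow> ('k^'n^'n) set"
  where "cen D = {g \<in> grp D. \<forall>s\<in>tor D. g ** s = s ** g}"

definition G_F :: "('k::field,'n::finite,'r::field,'m::finite,'v::real_vector) gdata \<Rightarrow> ('k^'n^'n) set"
  where "G_F D = rat_points (loc_field D) (grp D)"

definition S_F :: "('k::field,'n::finite,'r::field,'m::finite,'v::real_vector) gdata \<Rightarrow> ('k^'n^'n) set"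
  where "S_F D = rat_points (loc_field D) (tor D)"

definition Z_F :: "('k::field,'n::finite,'r::field,'m::finite,'v::real_vector) gdata \<Rightarrow> ('k^'n^'n) set"
  where "Z_F D = rat_points (loc_field D) (cen D)"

definition U_F :: "('k::field,'n::finite,'r::field,'m::finite,'v::real_vector) gdata \<Rightarrow> ('k^'n^'n) set"
  where "U_F D = rat_points (loc_field D) (uni D)"

definition Uop_F :: "('k::field,'n::finite,'r::field,'m::finite,'v::real_vector) gdata \<Rightarrow> ('k^'n^'n) set"
  where "Uop_F D = rat_points (loc_field D) (uni_op D)"

definition N_F :: "('k::field,'n::finite,'r::field,'m::finite,'v::real_vector) gdata \<Rightarrow> ('k^'n^'n) set"
  where "N_F D = {n \<in> G_F D. (\<lambda>s. n ** s ** matrix_inv n) ` S_F D = S_F D}"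

text \<open>The residue field \<open>\<kappa>\<close>, realized inside the algebraically closed field \<open>'r\<close> of
  characteristic \<open>p\<close> as its unique subfield with \<open>q\<close> elements.\<close>

definition kap :: "('k::field,'n::finite,'r::field,'m::finite,'v::real_vector) gdata \<Rightarrow> 'r set"
  where "kap D = {x. x ^ card (residue_field (loc_field D) (valn D)) = x}"


subsection \<open>Affine roots, facets and parahoric subgroups\<close>

text \<open>The pair \<open>(\<alpha>, k) \<in> \<Sigma> \<times> \<int>\<close> is identified with the affine function \<open>\<alpha> + k\<close>.\<close>

definition Sig_pos :: "('k::field,'n::finite,'r::field,'m::finite,'v::real_vector) gdata \<Rightarrow> ('v \<Rightarrow> real) set"
  where "Sig_pos D = {\<alpha> \<in> Sig D. \<exists>a \<in> roots (loc_field D) (uni D) (tor D). \<exists>c>0. \<alpha> = (\<lambda>v. c * chr D a v)}"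

definition Delta :: "('k::field,'n::finite,'r::field,'m::finite,'v::real_vector) gdata \<Rightarrow> ('v \<Rightarrow> real) set"
  where "Delta D = {\<alpha> \<in> Sig_pos D. \<not> (\<exists>\<beta>\<in>Sig_pos D. \<exists>\<gamma>\<in>Sig_pos D. \<alpha> = (\<lambda>v. \<beta> v + \<gamma> v))}"

definition Sig_aff :: "('k::field,'n::finite,'r::field,'m::finite,'v::real_vector) gdata \<Rightarrow> ('v \<Rightarrow> real) set"
  where "Sig_aff D = {(\<lambda>v. \<alpha> v + of_int k) | \<alpha> (k::int). \<alpha> \<in> Sig D}"

definition Sig_aff_pos :: "('k::field,'n::finite,'r::field,'m::finite,'v::real_vector) gdata \<Rightarrow> ('v \<Rightarrow> real) set"
  where "Sig_aff_pos D = {(\<lambda>v. \<alpha> v + of_int k) | \<alpha> (k::int).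
           (\<alpha> \<in> Sig_pos D \<and> k \<ge> 0) \<or> (\<alpha> \<in> Sig D \<and> k > 0)}"

definition Sig_aff_neg :: "('k::field,'n::finite,'r::field,'m::finite,'v::real_vector) gdata \<Rightarrow> ('v \<Rightarrow> real) set"
  where "Sig_aff_neg D = {(\<lambda>v. - a v) | a. a \<in> Sig_aff_pos D}"

text \<open>The affine roots whose hyperplanes are the walls of the alcove on which all positive affine
  roots are positive.\<close>

definition simple_aff :: "('k::field,'n::finite,'r::field,'m::finite,'v::real_vector) gdata \<Rightarrow> ('v \<Rightarrow> real) set"
  where "simple_aff D = {a \<in> Sig_aff_pos D. \<exists>v. a v = 0 \<and> (\<forall>b\<in>Sig_aff_pos D. b \<noteq> a \<longrightarrow> b v > 0)}"

definition facet :: "('k::field,'n::finite,'r::field,'m::finite,'v::real_vector) gdata \<Rightarrow> 'v \<Rightarrow> 'v set"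
  where "facet D v = {v'. \<forall>a\<in>Sig_aff D. sgn (a v') = sgn (a v)}"

text \<open>The reflection in the hyperplane \<open>\<alpha> + k = 0\<close>, for \<open>a = \<alpha> + k\<close>; the gradient \<open>\<alpha>\<close> is
  recovered as \<open>a - a(0)\<close>.\<close>

definition refl_map :: "('k::field,'n::finite,'r::field,'m::finite,'v::real_vector) gdata \<Rightarrow> ('v \<Rightarrow> real) \<Rightarrow> 'v \<Rightarrow> 'v"
  where "refl_map D a = (\<lambda>v. v - a v *\<^sub>R coroot D (\<lambda>u. a u - a 0))"

definition Ksp :: "('k::field,'n::finite,'r::field,'m::finite,'v::real_vector) gdata \<Rightarrow> ('k^'n^'n) set"
  where "Ksp D = parahoric D (facet D 0)"

definition I1 :: "('k::field,'n::finite,'r::field,'m::finite,'v::real_vector) gdata \<Rightarrow> ('k^'n^'n) set"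
  where "I1 D = {g \<in> Ksp D. red D (facet D 0) g \<in> red D (facet D 0) ` (U_F D \<inter> Ksp D)}"


subsection \<open>The groups \<open>W\<close>, \<open>W~\<close>, \<open>W~(1)\<close>, \<open>\<Lambda>\<close>, \<open>\<Lambda>(1)\<close>\<close>

text \<open>\<open>Wt D\<close> and \<open>Wt1 D\<close> are \<open>W~\<close> and \<open>W~(1)\<close>; their elements are cosets in \<open>N\<close>, and \<open>\<Lambda>\<close>, \<open>\<Lambda>(1)\<close>
  are the subgroups of cosets of elements of \<open>Z(F)\<close>.\<close>

definition Wt :: "('k::field,'n::finite,'r::field,'m::finite,'v::real_vector) gdata \<Rightarrow> ('k^'n^'n) set monoid"
  where "Wt D = GL_on (N_F D) Mod (Z_F D \<inter> Ksp D)"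

definition Wt1 :: "('k::field,'n::finite,'r::field,'m::finite,'v::real_vector) gdata \<Rightarrow> ('k^'n^'n) set monoid"
  where "Wt1 D = GL_on (N_F D) Mod (Z_F D \<inter> I1 D)"

definition cls :: "('k::field,'n::finite,'r::field,'m::finite,'v::real_vector) gdata \<Rightarrow> 'k^'n^'n \<Rightarrow> ('k^'n^'n) set"
  where "cls D n = (Z_F D \<inter> Ksp D) #>\<^bsub>GL\<^esub> n"

definition cls1 :: "('k::field,'n::finite,'r::field,'m::finite,'v::real_vector) gdata \<Rightarrow> 'k^'n^'n \<Rightarrow> ('k^'n^'n) set"
  where "cls1 D n = (Z_F D \<inter> I1 D) #>\<^bsub>GL\<^esub> n"

definition proj :: "('k::field,'n::finite,'r::field,'m::finite,'v::real_vector) gdata \<Rightarrow> ('k^'n^'n) set \<Rightarrow> ('k^'n^'n) set"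
  where "proj D w = (Z_F D \<inter> Ksp D) <#>\<^bsub>GL\<^esub> w"

definition Lam :: "('k::field,'n::finite,'r::field,'m::finite,'v::real_vector) gdata \<Rightarrow> ('k^'n^'n) set set"
  where "Lam D = cls D ` Z_F D"

definition Lam1 :: "('k::field,'n::finite,'r::field,'m::finite,'v::real_vector) gdata \<Rightarrow> ('k^'n^'n) set set"
  where "Lam1 D = cls1 D ` Z_F D"

text \<open>The action on the apartment of a coset in \<open>W~\<close> or \<open>W~(1)\<close>, through a representative:
  \<open>Z(F) \<inter> K\<close> acts trivially.\<close>

definition coset_act :: "('k::field,'n::finite,'r::field,'m::finite,'v::real_vector) gdata \<Rightarrow> ('k^'n^'n) set \<Rightarrow> 'v \<Rightarrow> 'v"
  where "coset_act D w = apt_act D (SOME n. n \<in> w)"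

definition nu :: "('k::field,'n::finite,'r::field,'m::finite,'v::real_vector) gdata \<Rightarrow> ('k^'n^'n) set \<Rightarrow> 'v"
  where "nu D l = coset_act D l 0"

text \<open>\<open>W~\<^sub>a\<^sub>f\<^sub>f\<close> is the image of the intersection of \<open>N\<close> with the subgroup of \<open>G(F)\<close> generated by
  \<open>U(F)\<close> and its opposite.  It acts faithfully on the apartment, so that its elements are
  determined by their actions.  The full stabilizer of the origin in \<open>W~\<close> may in addition contain
  torsion elements of \<open>\<Lambda>\<close>; \<open>W\<close> is the stabilizer in \<open>W~\<^sub>a\<^sub>f\<^sub>f\<close>.\<close>

definition Waff :: "('k::field,'n::finite,'r::field,'m::finite,'v::real_vector) gdata \<Rightarrow> ('k^'n^'n) set set"
  where "Waff D = cls D ` (N_F D \<inter> generate GL (U_F D \<union> Uop_F D))"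

definition Wsp :: "('k::field,'n::finite,'r::field,'m::finite,'v::real_vector) gdata \<Rightarrow> ('k^'n^'n) set set"
  where "Wsp D = {w \<in> Waff D. coset_act D w 0 = 0}"

definition s_refl :: "('k::field,'n::finite,'r::field,'m::finite,'v::real_vector) gdata \<Rightarrow> ('v \<Rightarrow> real) \<Rightarrow> ('k^'n^'n) set"
  where "s_refl D a = (THE w. w \<in> Waff D \<and> coset_act D w = refl_map D a)"

definition S_aff :: "('k::field,'n::finite,'r::field,'m::finite,'v::real_vector) gdata \<Rightarrow> ('k^'n^'n) set set"
  where "S_aff D = s_refl D ` simple_aff D"

definition S_fin :: "('k::field,'n::finite,'r::field,'m::finite,'v::real_vector) gdata \<Rightarrow> ('k^'n^'n) set set"
  where "S_fin D = S_aff D \<inter> Wsp D"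

text \<open>The length, on \<open>W~\<close> as well as on \<open>W~(1)\<close>; \<open>w\<close> acts on affine roots by \<open>a \<mapsto> a \<circ> w\<inverse>\<close>.\<close>

definition len :: "('k::field,'n::finite,'r::field,'m::finite,'v::real_vector) gdata \<Rightarrow> ('k^'n^'n) set \<Rightarrow> nat"
  where "len D w = card (Sig_aff_pos D \<inter> (\<lambda>a. a \<circ> inv_into UNIV (coset_act D w)) ` Sig_aff_neg D)"

definition prod_W :: "('g, 'b) monoid_scheme \<Rightarrow> 'g list \<Rightarrow> 'g" where
  "prod_W M ss = foldr (monoid.mult M) ss (one M)"

text \<open>Reduced expressions \<open>w = s\<^sub>1 \<dots> s\<^sub>l u\<close> in \<open>W~\<close> end with a factor \<open>u\<close> of length \<open>0\<close>.\<close>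

definition reduced_expr ::
  "('k::field,'n::finite,'r::field,'m::finite,'v::real_vector) gdata \<Rightarrow> ('k^'n^'n) set \<Rightarrow> ('k^'n^'n) set list \<Rightarrow> ('k^'n^'n) set \<Rightarrow> bool"
  where "reduced_expr D w ss u \<longleftrightarrow> set ss \<subseteq> S_aff D \<and> length ss = len D w \<and>
     u \<in> carrier (Wt D) \<and> len D u = 0 \<and> w = prod_W (Wt D) ss \<otimes>\<^bsub>Wt D\<^esub> u"

definition n_w :: "('k::field,'n::finite,'r::field,'m::finite,'v::real_vector) gdata \<Rightarrow> ('k^'n^'n) set \<Rightarrow> ('k^'n^'n) set"
  where "n_w D w = prod_W (Wt1 D) (map (n_lift D)
     (SOME ss. set ss \<subseteq> S_fin D \<and> length ss = len D w \<and> w = prod_W (Wt D) ss))"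

text \<open>\<open>Z\<^sub>a\<^sub>,\<^sub>\<kappa>\<close> as a subset of \<open>W~(1)\<close>, through \<open>Z\<^sub>\<kappa> = (Z(F) \<inter> K) / (Z(F) \<inter> I(1))\<close>, with the finite
  reductive quotient of \<open>K\<^sub>\<F>\<close> realized as the image of \<open>red D \<F>\<close>.\<close>

definition UU_gen :: "('k::field,'n::finite,'r::field,'m::finite,'v::real_vector) gdata \<Rightarrow> 'v set \<Rightarrow> ('k^'n^'n) set"
  where "UU_gen D \<F> = generate GL ((parahoric D \<F> \<inter> U_F D) \<union> (parahoric D \<F> \<inter> Uop_F D))"

definition Z_aff :: "('k::field,'n::finite,'r::field,'m::finite,'v::real_vector) gdata \<Rightarrow> ('v \<Rightarrow> real) \<Rightarrow> ('k^'n^'n) set set"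
  where "Z_aff D a = {cls1 D z | z. z \<in> Z_F D \<inter> Ksp D \<and>
     red D (facet_of D a) z \<in>
       generate GL (red D (facet_of D a) ` (parahoric D (facet_of D a) \<inter> U_F D) \<union>
                    red D (facet_of D a) ` (parahoric D (facet_of D a) \<inter> Uop_F D))}"


subsection \<open>The conditions on the group data\<close>

definition field_ok :: "('k::alg_closed_field,'n::finite,'r::alg_closed_field,'m::finite,'v::real_vector) gdata \<Rightarrow> bool"
  where "field_ok D \<longleftrightarrow>
     nonarch_local_field (loc_field D) (valn D) \<and> algebraic_closure_of (loc_field D) \<and>
     prime (res_char D) \<and> val_ge (valn D) 1 (of_nat (res_char D)) \<and> CHAR('r) = res_char D"

definition reductive_ok :: "('k::alg_closed_field,'n::finite,'r::alg_closed_field,'m::finite,'v::real_vector) gdata \<Rightarrow> bool"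
  where "reductive_ok D \<longleftrightarrow>
     connected_reductive (loc_field D) (grp D) \<and>
     max_split_torus (loc_field D) (grp D) (tor D) \<and>
     min_parabolic (loc_field D) (grp D) (par D) \<and>
     unipotent_radical (uni D) (par D) \<and> par D = cen D <#>\<^bsub>GL\<^esub> uni D \<and>
     parabolic (loc_field D) (grp D) (par_op D) \<and> par D \<inter> par_op D = cen D \<and>
     unipotent_radical (uni_op D) (par_op D) \<and> par_op D = cen D <#>\<^bsub>GL\<^esub> uni_op D"

text \<open>\<open>'v\<close> is \<open>X\<^sub>*(S) \<otimes> \<real>\<close>: the existence of the linear forms extending the perfect pairing
  makes the surjection \<open>X\<^sub>*(S) \<otimes> \<real> \<rightarrow> 'v\<close> injective.  The vector part of the action of \<open>N\<close> is the one
  induced by conjugation on \<open>X\<^sub>*(S)\<close>.\<close>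

definition apartment_ok :: "('k::alg_closed_field,'n::finite,'r::alg_closed_field,'m::finite,'v::real_vector) gdata \<Rightarrow> bool"
  where "apartment_ok D \<longleftrightarrow>
     (let X = characters (loc_field D) (tor D); Y = cocharacters (loc_field D) (tor D) in
     (\<exists>B::'v set. finite B \<and> span B = UNIV) \<and>
     span (cov D ` Y) = UNIV \<and>
     (\<forall>\<mu>\<in>Y. \<forall>\<eta>\<in>Y. cov D (restrict (\<lambda>t. \<mu> t ** \<eta> t) (- {0})) = cov D \<mu> + cov D \<eta>) \<and>
     (\<forall>a\<in>X. linear (chr D a)) \<and>
     (\<forall>a\<in>X. \<forall>\<mu>\<in>Y. \<exists>m::int. chr D a (cov D \<mu>) = of_int m \<and> (\<forall>t. t \<noteq> 0 \<longrightarrow> a (\<mu> t) = t powi m)) \<and>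
     (\<forall>n\<in>N_F D. \<forall>n'\<in>N_F D. apt_act D (n ** n') = apt_act D n \<circ> apt_act D n') \<and>
     (\<forall>n\<in>N_F D. linear (\<lambda>v. apt_act D n v - apt_act D n 0)) \<and>
     (\<forall>n\<in>N_F D. \<forall>\<mu>\<in>Y. cov D (restrict (\<lambda>t. n ** \<mu> t ** matrix_inv n) (- {0})) =
                          apt_act D n (cov D \<mu>) - apt_act D n 0) \<and>
     (\<forall>z\<in>Z_F D. \<forall>v. apt_act D z v = v + apt_act D z 0) \<and>
     (\<forall>z\<in>S_F D. \<forall>a\<in>X. chr D a (apt_act D z 0) = - of_int (valn D (a z))))"

text \<open>\<open>\<Sigma>\<close> is a reduced root system (in the subspace of the dual space that it spans), its rays are the
  rays of the relative roots, \<open>\<Sigma>\<^sup>+\<close> is a system of positive roots, \<open>N\<close> permutes the affine roots, and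
  \<open>W~\<^sub>a\<^sub>f\<^sub>f\<close> is the group generated by the reflections in the hyperplanes \<open>\<alpha> + k = 0\<close>.\<close>

definition affine_roots_ok :: "('k::alg_closed_field,'n::finite,'r::alg_closed_field,'m::finite,'v::real_vector) gdata \<Rightarrow> bool"
  where "affine_roots_ok D \<longleftrightarrow>
     (let \<Phi> = roots (loc_field D) (grp D) (tor D) in
     finite (Sig D) \<and>
     (\<forall>\<alpha>\<in>Sig D. linear \<alpha> \<and> \<alpha> (coroot D \<alpha>) = 2) \<and>
     (\<forall>\<alpha>\<in>Sig D. \<forall>\<beta>\<in>Sig D. \<beta> (coroot D \<alpha>) \<in> \<int> \<and> (\<lambda>v. \<beta> v - \<beta> (coroot D \<alpha>) * \<alpha> v) \<in> Sig D) \<and>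
     (\<forall>\<alpha>\<in>Sig D. \<forall>c. (\<lambda>v. c * \<alpha> v) \<in> Sig D \<longrightarrow> c = 1 \<or> c = -1) \<and>
     (\<forall>\<alpha>\<in>Sig D. \<exists>a\<in>\<Phi>. \<exists>c>0. \<alpha> = (\<lambda>v. c * chr D a v)) \<and>
     (\<forall>a\<in>\<Phi>. \<exists>\<alpha>\<in>Sig D. \<exists>c>0. \<alpha> = (\<lambda>v. c * chr D a v)) \<and>
     (\<forall>\<alpha>\<in>Sig D. \<alpha> \<in> Sig_pos D \<or> (\<lambda>v. - \<alpha> v) \<in> Sig_pos D) \<and>
     (\<exists>v. \<forall>\<alpha>\<in>Sig_pos D. \<alpha> v > 0) \<and>
     (\<forall>n\<in>N_F D. (\<lambda>a. a \<circ> apt_act D n) ` Sig_aff D = Sig_aff D) \<and>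
     inj_on (coset_act D) (Waff D) \<and>
     coset_act D ` Waff D = {foldr (\<circ>) rs id | rs. set rs \<subseteq> refl_map D ` Sig_aff D})"

definition bounded_mats :: "('k::field \<Rightarrow> int) \<Rightarrow> ('k^'n^'n) set \<Rightarrow> bool" where
  "bounded_mats val P \<longleftrightarrow> (\<exists>m. \<forall>g\<in>P. \<forall>i j. val_ge val m (g $ i $ j))"

text \<open>\<open>H\<close> is open in \<open>P\<close> for the valuation topology (both being groups, with \<open>H \<subseteq> P\<close>).\<close>

definition open_in_grp :: "('k::field \<Rightarrow> int) \<Rightarrow> ('k^'n^'n) set \<Rightarrow> ('k^'n^'n) set \<Rightarrow> bool" where
  "open_in_grp val P H \<longleftrightarrow>
     (\<exists>m. {g \<in> P. \<forall>i j. val_ge val m ((g - mat 1) $ i $ j)} \<subseteq> H)"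

text \<open>For bounded closed (hence compact) groups \<open>P\<close> this is the usual notion; it is only applied to
  open subgroups of \<open>K\<^sub>\<F>\<close>.\<close>

definition pro_p_group :: "('k::field \<Rightarrow> int) \<Rightarrow> nat \<Rightarrow> ('k^'n^'n) set \<Rightarrow> bool" where
  "pro_p_group val p P \<longleftrightarrow> (\<forall>H. normal H (GL_on P) \<and> open_in_grp val P H \<longrightarrow>
     (\<exists>i. card (rcosets\<^bsub>GL_on P\<^esub> H) = p ^ i))"

definition red_ker :: "('k::field,'n::finite,'r::field,'m::finite,'v::real_vector) gdata \<Rightarrow> 'v set \<Rightarrow> ('k^'n^'n) set"
  where "red_ker D \<F> = {g \<in> parahoric D \<F>. red D \<F> g = mat 1}"

definition parahoric_ok :: "('k::alg_closed_field,'n::finite,'r::alg_closed_field,'m::finite,'v::real_vector) gdata \<Rightarrow> bool"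
  where "parahoric_ok D \<longleftrightarrow>
     (\<forall>\<F>\<in>range (facet D).
        subgroup (parahoric D \<F>) (GL_on (G_F D)) \<and>
        bounded_mats (valn D) (parahoric D \<F>) \<and>
        open_in_grp (valn D) (G_F D) (parahoric D \<F>) \<and>
        connected_reductive (kap D) (red_grp D \<F>) \<and>
        red D \<F> \<in> hom (GL_on (parahoric D \<F>)) GL \<and>
        red D \<F> ` parahoric D \<F> = rat_points (kap D) (red_grp D \<F>) \<and>
        open_in_grp (valn D) (parahoric D \<F>) (red_ker D \<F>) \<and>
        pro_p_group (valn D) (res_char D) (red_ker D \<F>) \<and>
        Z_F D \<inter> parahoric D \<F> = Z_F D \<inter> Ksp D \<and>
        (\<forall>n\<in>N_F D. parahoric D (apt_act D n ` \<F>) = (\<lambda>g. n ** g ** matrix_inv n) ` parahoric D \<F>) \<and>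
        (\<forall>n\<in>N_F D \<inter> parahoric D \<F>. \<forall>v\<in>\<F>. apt_act D n v = v) \<and>
        cls D ` (N_F D \<inter> parahoric D \<F>) = {w \<in> Waff D. \<forall>v\<in>\<F>. coset_act D w v = v})"

text \<open>The first three conditions say that \<open>N/Z(F)\<close>, \<open>W~\<close> and \<open>W~(1)\<close> are defined; the next two
  express \<open>W~ = W \<ltimes> \<Lambda>\<close>; the last ones say that \<open>Z\<^sub>\<kappa>\<close> is commutative and of order prime to \<open>p\<close>.\<close>

definition weyl_ok :: "('k::alg_closed_field,'n::finite,'r::alg_closed_field,'m::finite,'v::real_vector) gdata \<Rightarrow> bool"
  where "weyl_ok D \<longleftrightarrow>
     normal (Z_F D) (GL_on (N_F D)) \<and>
     normal (Z_F D \<inter> Ksp D) (GL_on (N_F D)) \<and>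
     normal (Z_F D \<inter> I1 D) (GL_on (N_F D)) \<and>
     Wsp D <#>\<^bsub>Wt D\<^esub> Lam D = carrier (Wt D) \<and>
     Wsp D \<inter> Lam D = {\<one>\<^bsub>Wt D\<^esub>} \<and>
     (\<forall>x\<in>red D (facet D 0) ` (Z_F D \<inter> Ksp D). \<forall>y\<in>red D (facet D 0) ` (Z_F D \<inter> Ksp D). x ** y = y ** x) \<and>
     finite (red D (facet D 0) ` (Z_F D \<inter> Ksp D)) \<and>
     coprime (card (red D (facet D 0) ` (Z_F D \<inter> Ksp D))) (res_char D)"

fun alt_prod :: "('g, 'b) monoid_scheme \<Rightarrow> 'g \<Rightarrow> 'g \<Rightarrow> nat \<Rightarrow> 'g" where
  "alt_prod M s t 0 = one M"
| "alt_prod M s t (Suc m) = monoid.mult M s (alt_prod M t s m)"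

definition choices_ok :: "('k::alg_closed_field,'n::finite,'r::alg_closed_field,'m::finite,'v::real_vector) gdata \<Rightarrow> bool"
  where "choices_ok D \<longleftrightarrow>
     (\<forall>a\<in>Sig_aff D. \<exists>v. a v = 0 \<and> (\<forall>b\<in>Sig_aff D. b v = 0 \<longrightarrow> b = a \<or> b = (\<lambda>u. - a u)) \<and>
        facet_of D a = facet D v) \<and>
     (\<forall>a\<in>simple_aff D. proj D (n_lift D (s_refl D a)) = s_refl D a \<and>
        n_lift D (s_refl D a) \<in> cls1 D ` (N_F D \<inter> UU_gen D (facet_of D a))) \<and>
     (\<forall>s\<in>S_fin D. \<forall>t\<in>S_fin D. s \<noteq> t \<longrightarrow>
        (let m = (LEAST m::nat. 0 < m \<and> (s \<otimes>\<^bsub>Wt D\<^esub> t) [^]\<^bsub>Wt D\<^esub> m = \<one>\<^bsub>Wt D\<^esub>) in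
         alt_prod (Wt1 D) (n_lift D s) (n_lift D t) m = alt_prod (Wt1 D) (n_lift D t) (n_lift D s) m))"

definition is_group_data :: "('k::alg_closed_field,'n::finite,'r::alg_closed_field,'m::finite,'v::real_vector) gdata \<Rightarrow> bool"
  where "is_group_data D \<longleftrightarrow>
     field_ok D \<and> reductive_ok D \<and> apartment_ok D \<and> affine_roots_ok D \<and>
     parahoric_ok D \<and> weyl_ok D \<and> choices_ok D"


section \<open>The generic pro-\<open>p\<close>-Iwahori Hecke algebra\<close>

text \<open>
  The indeterminates \<open>q\<^sub>s\<^sup>1\<^sup>/\<^sup>2\<close> are indexed by conjugacy classes in \<open>W~\<close>.  A value of type
  \<open>('w set \<Rightarrow>\<^sub>0 int) \<Rightarrow>\<^sub>0 'c\<close> is a Laurent polynomial in them; the exponents count half powers.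
\<close>

type_synonym ('w, 'c) laurent = "('w set \<Rightarrow>\<^sub>0 int) \<Rightarrow>\<^sub>0 'c"

definition q_index :: "('k::field,'n::finite,'r::field,'m::finite,'v::real_vector) gdata \<Rightarrow> ('k^'n^'n) set \<Rightarrow> ('k^'n^'n) set set"
  where "q_index D s = {t \<otimes>\<^bsub>Wt D\<^esub> s \<otimes>\<^bsub>Wt D\<^esub> inv\<^bsub>Wt D\<^esub> t | t. t \<in> carrier (Wt D)}"

text \<open>\<open>q_ring D\<close> is \<open>C[q\<^sub>s\<^sup>1\<^sup>/\<^sup>2]\<close> inside the Laurent polynomials, and \<open>q_zero\<close> is the
  \<open>C\<close>-linear map \<open>q\<^sub>s\<^sup>1\<^sup>/\<^sup>2 \<mapsto> 0\<close> on it.\<close>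

definition q_ring :: "('k::field,'n::finite,'r::field,'m::finite,'v::real_vector) gdata \<Rightarrow> (('k^'n^'n) set, 'c::field) laurent set"
  where "q_ring D = {f. \<forall>m \<in> Poly_Mapping.keys f. Poly_Mapping.keys m \<subseteq> q_index D ` S_aff D \<and>
           (\<forall>i. 0 \<le> Poly_Mapping.lookup m i)}"

definition q_zero :: "('w, 'c::field) laurent \<Rightarrow> 'c" where
  "q_zero f = Poly_Mapping.lookup f 0"

text \<open>\<open>half_exp D w\<close> is the exponent of \<open>q\<^sub>w\<^sup>1\<^sup>/\<^sup>2\<close>, and \<open>q_half D w\<close>, \<open>q_half_inv D w\<close> are
  \<open>q\<^sub>w\<^sup>1\<^sup>/\<^sup>2\<close>, \<open>q\<^sub>w\<^sup>-\<^sup>1\<^sup>/\<^sup>2\<close>, for \<open>w \<in> W~(1)\<close>.\<close>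

definition half_exp :: "('k::field,'n::finite,'r::field,'m::finite,'v::real_vector) gdata \<Rightarrow> ('k^'n^'n) set \<Rightarrow> ('k^'n^'n) set set \<Rightarrow>\<^sub>0 int"
  where "half_exp D w = (\<Sum>s \<leftarrow> (SOME ss. \<exists>u. reduced_expr D (proj D w) ss u).
           Poly_Mapping.single (q_index D s) 1)"

definition q_half :: "('k::field,'n::finite,'r::field,'m::finite,'v::real_vector) gdata \<Rightarrow> ('k^'n^'n) set \<Rightarrow> (('k^'n^'n) set, 'c::field) laurent"
  where "q_half D w = Poly_Mapping.single (half_exp D w) 1"

definition q_half_inv :: "('k::field,'n::finite,'r::field,'m::finite,'v::real_vector) gdata \<Rightarrow> ('k^'n^'n) set \<Rightarrow> (('k^'n^'n) set, 'c::field) laurent"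
  where "q_half_inv D w = Poly_Mapping.single (- half_exp D w) 1"

definition q_s :: "('k::field,'n::finite,'r::field,'m::finite,'v::real_vector) gdata \<Rightarrow> ('k^'n^'n) set \<Rightarrow> (('k^'n^'n) set, 'c::field) laurent"
  where "q_s D s = (Poly_Mapping.single (Poly_Mapping.single (q_index D s) 1) 1) ^ 2"

definition c_s :: "('k::field,'n::finite,'r::field,'m::finite,'v::real_vector) gdata \<Rightarrow>
    ((('k^'n^'n) set, 'c::field) laurent \<Rightarrow> 'h::ring_1 \<Rightarrow> 'h) \<Rightarrow> (('k^'n^'n) set \<Rightarrow> 'h) \<Rightarrow> ('v \<Rightarrow> real) \<Rightarrow> 'h"
  where "c_s D sc T a = sc (Poly_Mapping.single 0 (- inverse (of_nat (card (Z_aff D a))))) (\<Sum>t\<in>Z_aff D a. T t)"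

text \<open>
  The Bernstein elements involve \<open>q\<^sub>\<lambda>\<^sup>-\<^sup>1\<^sup>/\<^sup>2\<close> and \<open>T\<^sub>\<lambda>\<inverse>\<close>, so the ambient ring \<open>'h\<close> is the scalar
  extension of \<open>\<H>\<close> to Laurent polynomials: the algebra over them with the same basis \<open>T\<^sub>w\<close>
  and the same relations.  As \<open>\<H>\<close> is free over \<open>C[q\<^sub>s\<^sup>1\<^sup>/\<^sup>2]\<close>, it is the \<open>q_ring D\<close>-span of the
  \<open>T\<^sub>w\<close> in it.  (Laurent variables that are not indexed by classes of simple affine reflections
  are harmless further scalars; they occur neither in \<open>\<H>\<close> nor in \<open>\<A>\<close>.)
\<close>

definition is_hecke_algebra :: "('k::field,'n::finite,'r::field,'m::finite,'v::real_vector) gdata \<Rightarrow>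
    ((('k^'n^'n) set, 'c::field) laurent \<Rightarrow> 'h::ring_1 \<Rightarrow> 'h) \<Rightarrow> (('k^'n^'n) set \<Rightarrow> 'h) \<Rightarrow> bool"
  where "is_hecke_algebra D sc T \<longleftrightarrow>
     module sc \<and>
     (\<forall>r x y. sc r (x * y) = sc r x * y \<and> sc r (x * y) = x * sc r y) \<and>
     inj_on T (carrier (Wt1 D)) \<and>
     \<not> module.dependent sc (T ` carrier (Wt1 D)) \<and>
     module.span sc (T ` carrier (Wt1 D)) = UNIV \<and>
     (\<forall>w\<in>carrier (Wt1 D). \<forall>w'\<in>carrier (Wt1 D).
        len D (w \<otimes>\<^bsub>Wt1 D\<^esub> w') = len D w + len D w' \<longrightarrow> T w * T w' = T (w \<otimes>\<^bsub>Wt1 D\<^esub> w')) \<and>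
     (\<forall>a\<in>simple_aff D. let s = s_refl D a; n = n_lift D s in
        T n * T n = sc (q_s D s) (T (n \<otimes>\<^bsub>Wt1 D\<^esub> n)) + c_s D sc T a * T n)"

definition ring_inverse :: "'h::ring_1 \<Rightarrow> 'h" where
  "ring_inverse x = (THE y. x * y = 1 \<and> y * x = 1)"

definition dominant :: "('k::field,'n::finite,'r::field,'m::finite,'v::real_vector) gdata \<Rightarrow> ('k^'n^'n) set \<Rightarrow> bool"
  where "dominant D l \<longleftrightarrow> (\<forall>\<alpha>\<in>Sig_pos D. 0 \<le> \<alpha> (nu D l))"

definition antidominant :: "('k::field,'n::finite,'r::field,'m::finite,'v::real_vector) gdata \<Rightarrow> ('k^'n^'n) set \<Rightarrow> bool"
  where "antidominant D l \<longleftrightarrow> (\<forall>\<alpha>\<in>Sig_pos D. \<alpha> (nu D l) \<le> 0)"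

text \<open>The value does not depend on the choice of \<open>\<lambda>\<^sub>1\<close>, \<open>\<lambda>\<^sub>2\<close>.\<close>

definition bernstein :: "('k::field,'n::finite,'r::field,'m::finite,'v::real_vector) gdata \<Rightarrow>
    ((('k^'n^'n) set, 'c::field) laurent \<Rightarrow> 'h::ring_1 \<Rightarrow> 'h) \<Rightarrow> (('k^'n^'n) set \<Rightarrow> 'h) \<Rightarrow> ('k^'n^'n) set \<Rightarrow> 'h"
  where "bernstein D sc T x = (SOME e. \<exists>l1\<in>Lam1 D. \<exists>l2\<in>Lam1 D. \<exists>w\<in>Wsp D.
     antidominant D l1 \<and> antidominant D l2 \<and>
     x = l1 \<otimes>\<^bsub>Wt1 D\<^esub> inv\<^bsub>Wt1 D\<^esub> l2 \<otimes>\<^bsub>Wt1 D\<^esub> n_w D w \<and>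
     e = sc (q_half D x * q_half_inv D l1 * q_half D l2 * q_half_inv D (n_w D w))
            (T l1 * ring_inverse (T l2) * T (n_w D w)))"

definition bernstein_subalgebra :: "('k::field,'n::finite,'r::field,'m::finite,'v::real_vector) gdata \<Rightarrow>
    ((('k^'n^'n) set, 'c::field) laurent \<Rightarrow> 'h::ring_1 \<Rightarrow> 'h) \<Rightarrow> (('k^'n^'n) set \<Rightarrow> 'h) \<Rightarrow> 'h set"
  where "bernstein_subalgebra D sc T =
     {(\<Sum>l\<in>L. sc (r l) (bernstein D sc T l)) | L r. finite L \<and> L \<subseteq> Lam1 D \<and> r ` L \<subseteq> q_ring D}"


section \<open>Right modules\<close>

text \<open>
  \<open>right_module smul \<epsilon> R sc B mul u \<rho>\<close>: the additive group \<open>'x\<close> is a vector space over \<open>C = 'c\<close> and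
  \<open>\<rho>\<close> makes it a right module over \<open>B \<otimes>\<^sub>R C\<close>, where \<open>B\<close> is an \<open>R\<close>-algebra (with scalar multiplication
  \<open>sc\<close>, multiplication \<open>mul\<close> and unit \<open>u\<close>) and \<open>C\<close> is an \<open>R\<close>-algebra through \<open>\<epsilon>\<close>.
\<close>

definition right_module ::
  "('c::field \<Rightarrow> 'x::ab_group_add \<Rightarrow> 'x) \<Rightarrow> ('r \<Rightarrow> 'c) \<Rightarrow> 'r set \<Rightarrow> ('r \<Rightarrow> 'b \<Rightarrow> 'b) \<Rightarrow>
   'b::ab_group_add set \<Rightarrow> ('b \<Rightarrow> 'b \<Rightarrow> 'b) \<Rightarrow> 'b \<Rightarrow> ('x \<Rightarrow> 'b \<Rightarrow> 'x) \<Rightarrow> bool"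
  where "right_module smul \<epsilon> R sc B mul u \<rho> \<longleftrightarrow>
     vector_space smul \<and>
     (\<forall>x y. \<forall>b\<in>B. \<rho> (x + y) b = \<rho> x b + \<rho> y b) \<and>
     (\<forall>c x. \<forall>b\<in>B. \<rho> (smul c x) b = smul c (\<rho> x b)) \<and>
     (\<forall>x. \<forall>b\<in>B. \<forall>b'\<in>B. \<rho> x (b + b') = \<rho> x b + \<rho> x b') \<and>
     (\<forall>x. \<forall>b\<in>B. \<forall>b'\<in>B. \<rho> x (mul b b') = \<rho> (\<rho> x b) b') \<and>
     (\<forall>x. \<rho> x u = x) \<and>
     (\<forall>x. \<forall>r\<in>R. \<forall>b\<in>B. \<rho> x (sc r b) = smul (\<epsilon> r) (\<rho> x b))"

definition irreducible_right_module ::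
  "('c::field \<Rightarrow> 'x::ab_group_add \<Rightarrow> 'x) \<Rightarrow> ('r \<Rightarrow> 'c) \<Rightarrow> 'r set \<Rightarrow> ('r \<Rightarrow> 'b \<Rightarrow> 'b) \<Rightarrow>
   'b::ab_group_add set \<Rightarrow> ('b \<Rightarrow> 'b \<Rightarrow> 'b) \<Rightarrow> 'b \<Rightarrow> ('x \<Rightarrow> 'b \<Rightarrow> 'x) \<Rightarrow> bool"
  where "irreducible_right_module smul \<epsilon> R sc B mul u \<rho> \<longleftrightarrow>
     right_module smul \<epsilon> R sc B mul u \<rho> \<and> (\<exists>x::'x. x \<noteq> 0) \<and>
     (\<forall>Y. module.subspace smul Y \<and> (\<forall>y\<in>Y. \<forall>b\<in>B. \<rho> y b \<in> Y) \<longrightarrow> Y = {0} \<or> Y = UNIV)"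

text \<open>An irreducible right \<open>\<A> \<otimes> C\<close>-module, where \<open>C\<close> is a \<open>C[q\<^sub>s\<^sup>1\<^sup>/\<^sup>2]\<close>-algebra through
  \<open>q\<^sub>s\<^sup>1\<^sup>/\<^sup>2 \<mapsto> 0\<close>.\<close>

definition irreducible_A_module :: "('k::field,'n::finite,'r::field,'m::finite,'v::real_vector) gdata \<Rightarrow>
    ((('k^'n^'n) set, 'c::field) laurent \<Rightarrow> 'h::ring_1 \<Rightarrow> 'h) \<Rightarrow> (('k^'n^'n) set \<Rightarrow> 'h) \<Rightarrow>
    ('c \<Rightarrow> 'x::ab_group_add \<Rightarrow> 'x) \<Rightarrow> ('x \<Rightarrow> 'h \<Rightarrow> 'x) \<Rightarrow> bool"
  where "irreducible_A_module D sc T smul \<rho> \<longleftrightarrow>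
     irreducible_right_module smul q_zero (q_ring D) sc (bernstein_subalgebra D sc T) (*) 1 \<rho>"


section \<open>The homomorphisms \<open>\<chi>\<^sub>\<Theta>\<close>\<close>

definition Lam_Theta :: "('k::field,'n::finite,'r::field,'m::finite,'v::real_vector) gdata \<Rightarrow> ('v \<Rightarrow> real) set \<Rightarrow> ('k^'n^'n) set set"
  where "Lam_Theta D \<Theta> = {l \<in> Lam1 D. \<forall>\<alpha>\<in>\<Theta>. \<alpha> (nu D l) = 0}"

definition Lam_Theta_plus :: "('k::field,'n::finite,'r::field,'m::finite,'v::real_vector) gdata \<Rightarrow> ('v \<Rightarrow> real) set \<Rightarrow> ('k^'n^'n) set set"
  where "Lam_Theta_plus D \<Theta> = {l \<in> Lam_Theta D \<Theta>. dominant D l}"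

text \<open>The group algebra \<open>C[\<Lambda>\<^sub>\<Theta>(1)]\<close> consists of the finitely supported functions on \<open>\<Lambda>\<^sub>\<Theta>(1)\<close>, with
  \<open>\<tau>\<^sub>\<lambda> = single \<lambda> 1\<close>.\<close>

definition group_algebra :: "('k::field,'n::finite,'r::field,'m::finite,'v::real_vector) gdata \<Rightarrow> ('v \<Rightarrow> real) set \<Rightarrow> (('k^'n^'n) set \<Rightarrow>\<^sub>0 'c::field) set"
  where "group_algebra D \<Theta> = {f. Poly_Mapping.keys f \<subseteq> Lam_Theta D \<Theta>}"

definition tau :: "'w \<Rightarrow> ('w \<Rightarrow>\<^sub>0 'c::field)" where
  "tau l = Poly_Mapping.single l 1"

definition ga_scale :: "'c::field \<Rightarrow> ('w \<Rightarrow>\<^sub>0 'c) \<Rightarrow> ('w \<Rightarrow>\<^sub>0 'c)" where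
  "ga_scale c f = Poly_Mapping.map ((*) c) f"

definition ga_mult :: "('k::field,'n::finite,'r::field,'m::finite,'v::real_vector) gdata \<Rightarrow>
    (('k^'n^'n) set \<Rightarrow>\<^sub>0 'c::field) \<Rightarrow> (('k^'n^'n) set \<Rightarrow>\<^sub>0 'c) \<Rightarrow> (('k^'n^'n) set \<Rightarrow>\<^sub>0 'c)"
  where "ga_mult D f g = (\<Sum>l\<in>Poly_Mapping.keys f. \<Sum>m\<in>Poly_Mapping.keys g.
     Poly_Mapping.single (l \<otimes>\<^bsub>Wt1 D\<^esub> m) (Poly_Mapping.lookup f l * Poly_Mapping.lookup g m))"

text \<open>The semilinear map \<open>\<A> \<rightarrow> C[\<Lambda>(1)]\<close>, over \<open>q\<^sub>s\<^sup>1\<^sup>/\<^sup>2 \<mapsto> 0\<close>, with given values \<open>\<phi>(\<lambda>)\<close> at the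
  basis elements \<open>E(\<lambda>)\<close>.\<close>

definition extend_from_E :: "('k::field,'n::finite,'r::field,'m::finite,'v::real_vector) gdata \<Rightarrow>
    ((('k^'n^'n) set, 'c::field) laurent \<Rightarrow> 'h::ring_1 \<Rightarrow> 'h) \<Rightarrow> (('k^'n^'n) set \<Rightarrow> 'h) \<Rightarrow>
    (('k^'n^'n) set \<Rightarrow> (('k^'n^'n) set \<Rightarrow>\<^sub>0 'c)) \<Rightarrow> 'h \<Rightarrow> (('k^'n^'n) set \<Rightarrow>\<^sub>0 'c)"
  where "extend_from_E D sc T \<phi> a =
     (let cf = (\<lambda>l. module.representation sc (bernstein D sc T ` Lam1 D) a (bernstein D sc T l))
      in \<Sum>l | l \<in> Lam1 D \<and> cf l \<noteq> 0. ga_scale (q_zero (cf l)) (\<phi> l))"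

definition chi_Theta :: "('k::field,'n::finite,'r::field,'m::finite,'v::real_vector) gdata \<Rightarrow>
    ((('k^'n^'n) set, 'c::field) laurent \<Rightarrow> 'h::ring_1 \<Rightarrow> 'h) \<Rightarrow> (('k^'n^'n) set \<Rightarrow> 'h) \<Rightarrow>
    ('v \<Rightarrow> real) set \<Rightarrow> 'h \<Rightarrow> (('k^'n^'n) set \<Rightarrow>\<^sub>0 'c)"
  where "chi_Theta D sc T \<Theta> =
     extend_from_E D sc T (\<lambda>l. if l \<in> Lam_Theta_plus D \<Theta> then tau l else 0)"

definition w_chi_Theta :: "('k::field,'n::finite,'r::field,'m::finite,'v::real_vector) gdata \<Rightarrow>
    ((('k^'n^'n) set, 'c::field) laurent \<Rightarrow> 'h::ring_1 \<Rightarrow> 'h) \<Rightarrow> (('k^'n^'n) set \<Rightarrow> 'h) \<Rightarrow>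
    ('k^'n^'n) set \<Rightarrow> ('v \<Rightarrow> real) set \<Rightarrow> 'h \<Rightarrow> (('k^'n^'n) set \<Rightarrow>\<^sub>0 'c)"
  where "w_chi_Theta D sc T w \<Theta> =
     extend_from_E D sc T (\<lambda>l. chi_Theta D sc T \<Theta>
       (bernstein D sc T (inv\<^bsub>Wt1 D\<^esub> (n_w D w) \<otimes>\<^bsub>Wt1 D\<^esub> l \<otimes>\<^bsub>Wt1 D\<^esub> n_w D w)))"

end

theory Submission
  imports Defs
begin

text \<open>
  On an irreducible module each \<open>E(\<lambda>)\<close> acts by zero or bijectively: conjugation by \<open>\<Lambda>(1)\<close> preserves
  \<open>\<nu>\<close>, so the image and the kernel of \<open>E(\<lambda>)\<close> are submodules.  The \<open>\<lambda>\<close> acting bijectively lie pairwise,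
  hence all together, in a closed Weyl chamber \<open>w C\<close>, where \<open>C\<close> is the dominant one; they are the
  elements of \<open>w C\<close> on the face cut out by \<open>\<Theta>\<close>, and their action extends to the group of fractions.

  The product rule \<open>E(\<lambda>) E(\<mu>) = E(\<lambda>\<mu>)\<close> or \<open>0\<close> (at \<open>q = 0\<close>) holds because \<open>q\<^sub>\<lambda> q\<^sub>\<mu> / q\<^sub>\<lambda>\<^sub>\<mu>\<close> is a product of
  \<open>q\<^sub>s\<^sup>2\<close> over the hyperplanes that a gallery from the alcove through its \<open>\<lambda>\<close>-translate to its
  \<open>\<lambda>\<mu>\<close>-translate crosses twice; there are none exactly if \<open>\<nu>(\<lambda>)\<close> and \<open>\<nu>(\<mu>)\<close> share a closed chamber.
\<close>

section \<open>Groups of cosets\<close>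

text \<open>Three obstacles shape the part before the modules. The values of roots fix a coroot only
  up to a vector killed by all roots, so even the rule that conjugating a reflection gives the
  reflection in the transported root needs an argument. It comes from the torus: N permutes the
  finitely many weights of the torus on the standard representation, so linear parts have finite
  order and a nontrivial shear cannot occur. Second, \<open>s_refl\<close>, \<open>half_exp\<close>
  and \<open>bernstein\<close> are defined by description or choice, so their values must be shown
  not to depend on it; for \<open>half_exp\<close> this is done by counting hyperplanes instead of
  letters. Third, E(\<lambda>) contains an inverse of T, which comes from T(n_s) (T(n_s) - c_s) =
  q_s T(n_s^2): q_s is invertible in the Laurent scalars, and c_s commutes with T(n_s) because n_s
  normalizes \<open>Z_aff\<close>. Relations between the E(\<lambda>) are then obtained by moving
  into the antidominant cone, where T is multiplicative; values of cocharacters at a uniformizer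
  supply enough elements there.\<close>

lemma GL_simps [simp]:
  "carrier (GL :: ('a::field^'n::finite^'n) monoid) = {g. invertible g}"
  "monoid.mult (GL :: ('a^'n^'n) monoid) = (**)"
  "monoid.one (GL :: ('a^'n^'n) monoid) = mat 1"
  by (simp_all add: GL_def)

lemma invertible_mat_one: "invertible (mat 1 :: 'a::field^'n^'n)"
  unfolding invertible_def by (intro exI[of _ "mat 1"]) simp

lemma matrix_inv_right_left:
  assumes "invertible (A :: 'a::field^'n^'n)"
  shows "A ** matrix_inv A = mat 1" "matrix_inv A ** A = mat 1"
proof -
  have "A ** matrix_inv A = mat 1 \<and> matrix_inv A ** A = mat 1"
    unfolding matrix_inv_def by (rule someI_ex) (use assms in \<open>simp add: invertible_def\<close>)
  then show "A ** matrix_inv A = mat 1" "matrix_inv A ** A = mat 1" by auto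
qed

lemma invertible_matrix_mult:
  assumes "invertible (A :: 'a::field^'n^'n)" "invertible B"
  shows "invertible (A ** B)"
proof -
  obtain A' B' where A: "A ** A' = mat 1" "A' ** A = mat 1" and B: "B ** B' = mat 1" "B' ** B = mat 1"
    using assms by (auto simp: invertible_def)
  have "(A ** B) ** (B' ** A') = A ** (B ** B') ** A'" by (simp only: matrix_mul_assoc)
  moreover have "(B' ** A') ** (A ** B) = B' ** (A' ** A) ** B" by (simp only: matrix_mul_assoc)
  ultimately show ?thesis unfolding invertible_def
    by (intro exI[of _ "B' ** A'"]) (simp add: A B)
qed

lemma invertible_matrix_inv: "invertible (A :: 'a::field^'n^'n) \<Longrightarrow> invertible (matrix_inv A)"
  using matrix_inv_right_left unfolding invertible_def by blast

lemma group_GL: "group (GL :: ('a::field^'n::finite^'n) monoid)"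
proof (rule groupI)
  fix x :: "'a^'n^'n" assume "x \<in> carrier GL"
  then show "\<exists>y\<in>carrier GL. y \<otimes>\<^bsub>GL\<^esub> x = \<one>\<^bsub>GL\<^esub>"
    by (intro bexI[of _ "matrix_inv x"]) (auto simp: matrix_inv_right_left invertible_matrix_inv)
qed (auto simp: invertible_mat_one invertible_matrix_mult matrix_mul_assoc)

lemma inv_GL: "invertible (A :: 'a::field^'n^'n) \<Longrightarrow> inv\<^bsub>GL\<^esub> A = matrix_inv A"
  by (rule group.inv_equality[OF group_GL]) (auto simp: matrix_inv_right_left invertible_matrix_inv)

lemma r_coset_GL_on: "H #>\<^bsub>GL_on N\<^esub> a = H #>\<^bsub>GL\<^esub> a"
  by (simp add: r_coset_def)

lemma set_mult_GL_on: "H <#>\<^bsub>GL_on N\<^esub> K = H <#>\<^bsub>GL\<^esub> K"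
  by (simp add: set_mult_def)

locale grp_data =
  fixes D :: "('k::alg_closed_field, 'n::finite, 'r::alg_closed_field, 'm::finite, 'v::real_vector) group_data"
  assumes group_data: "is_group_data D"
begin

abbreviation GN where "GN \<equiv> GL_on (N_F D)"
abbreviation H0 where "H0 \<equiv> Z_F D \<inter> Ksp D"
abbreviation H1 where "H1 \<equiv> Z_F D \<inter> I1 D"

lemma oks: "field_ok D" "reductive_ok D" "apartment_ok D" "affine_roots_ok D" "parahoric_ok D" "weyl_ok D"
    "choices_ok D"
  using group_data by (auto simp: is_group_data_def)

lemma normal_Z: "normal (Z_F D) GN" and normal_H0: "normal H0 GN" and normal_H1: "normal H1 GN"
  using oks(6) by (auto simp: weyl_ok_def)

sublocale GN: group GN
  using normal_Z by (simp add: normal_def)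

lemma Z_in_N: "z \<in> Z_F D \<Longrightarrow> z \<in> N_F D"
  using subgroup.subset[OF normal_imp_subgroup[OF normal_Z]] by auto

lemma one_in_N: "mat 1 \<in> N_F D"
  using GN.one_closed by simp

lemma mult_in_N: "n \<in> N_F D \<Longrightarrow> n' \<in> N_F D \<Longrightarrow> n ** n' \<in> N_F D"
  using GN.m_closed by simp

lemma N_invertible: "n \<in> N_F D \<Longrightarrow> invertible n"
  using GN.r_inv[of n] GN.l_inv[of n] unfolding invertible_def by auto

lemma inv_GN: assumes "n \<in> N_F D" shows "inv\<^bsub>GN\<^esub> n = matrix_inv n" and inv_in_N: "matrix_inv n \<in> N_F D"
proof -
  have "inv\<^bsub>GN\<^esub> n ** n = mat 1" using GN.l_inv[of n] assms by simp
  then have "inv\<^bsub>GN\<^esub> n ** (n ** matrix_inv n) = matrix_inv n"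
    by (simp add: matrix_mul_assoc)
  then show e: "inv\<^bsub>GN\<^esub> n = matrix_inv n"
    by (simp add: matrix_inv_right_left N_invertible assms)
  show "matrix_inv n \<in> N_F D" using GN.inv_closed[of n] assms e by simp
qed

lemma I1_subset_Ksp: "I1 D \<subseteq> Ksp D"
  by (auto simp: I1_def)

lemma H1_subset_H0: "H1 \<subseteq> H0"
  using I1_subset_Ksp by auto

lemma facet_self: "v \<in> facet D v"
  by (simp add: facet_def)

section \<open>The action of N on the apartment\<close>

lemma apt_mult: "n \<in> N_F D \<Longrightarrow> n' \<in> N_F D \<Longrightarrow> apt_act D (n ** n') = apt_act D n \<circ> apt_act D n'"
  using oks(3) unfolding apartment_ok_def Let_def by blast

lemma apt_lin: "n \<in> N_F D \<Longrightarrow> linear (\<lambda>v. apt_act D n v - apt_act D n 0)"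
  using oks(3) unfolding apartment_ok_def Let_def by blast

lemma apt_Z: "z \<in> Z_F D \<Longrightarrow> apt_act D z v = v + apt_act D z 0"
  using oks(3) unfolding apartment_ok_def Let_def by blast

lemma one_in_Z: "mat 1 \<in> Z_F D"
  using subgroup.one_closed[OF normal_imp_subgroup[OF normal_Z]] by simp

text \<open>The composition law makes the map of \<open>mat 1\<close> idempotent, and as
  \<open>mat 1\<close> lies in Z(F) this map is a translation; an idempotent translation is the
  identity.\<close>

lemma apt_one: "apt_act D (mat 1) = id"
proof
  fix v
  have "apt_act D (mat 1) 0 = apt_act D (mat 1) (apt_act D (mat 1) 0)"
    using fun_cong[OF apt_mult[OF one_in_N one_in_N], of 0] by simp
  also have "\<dots> = apt_act D (mat 1) 0 + apt_act D (mat 1) 0"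
    by (rule apt_Z[OF one_in_Z])
  finally show "apt_act D (mat 1) v = id v"
    using apt_Z[OF one_in_Z, of v] by simp
qed

lemma apt_inv: assumes "n \<in> N_F D"
  shows "apt_act D n \<circ> apt_act D (matrix_inv n) = id" "apt_act D (matrix_inv n) \<circ> apt_act D n = id"
  by (simp_all add: apt_mult[symmetric] assms inv_in_N matrix_inv_right_left N_invertible apt_one)

lemma apt_bij: "n \<in> N_F D \<Longrightarrow> bij (apt_act D n)"
  using apt_inv[of n] o_bij by blast

lemma apt_H0: assumes "z \<in> H0" shows "apt_act D z = id"
proof -
  have "z \<in> N_F D \<inter> parahoric D (facet D 0)" using assms Z_in_N by (auto simp: Ksp_def)
  then have "apt_act D z 0 = 0"
    using oks(5) facet_self[of 0] unfolding parahoric_ok_def by blast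
  then show ?thesis using apt_Z[of z] assms by (auto simp: fun_eq_iff)
qed

lemma coset_eq:
  assumes "normal H GN" "n \<in> N_F D"
  shows "n \<in> H #>\<^bsub>GL\<^esub> n" and "m \<in> H #>\<^bsub>GL\<^esub> n \<Longrightarrow> \<exists>h\<in>H. m = h ** n"
proof -
  have "mat 1 \<in> H" using subgroup.one_closed[OF normal_imp_subgroup[OF assms(1)]] by simp
  then show "n \<in> H #>\<^bsub>GL\<^esub> n" by (force simp: r_coset_def)
qed (auto simp: r_coset_def)

text \<open>The representative picked by \<open>SOME\<close> differs from \<open>n\<close> by an
  element of \<open>H0\<close>, which acts trivially: it is a translation that fixes the special
  point.\<close>

lemma coset_act_coset:
  assumes "normal H GN" "H \<subseteq> H0" "n \<in> N_F D"
  shows "coset_act D (H #>\<^bsub>GL\<^esub> n) = apt_act D n"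
proof -
  have "(SOME m. m \<in> H #>\<^bsub>GL\<^esub> n) \<in> H #>\<^bsub>GL\<^esub> n"
    by (rule someI[of _ n]) (rule coset_eq[OF assms(1,3)])
  then obtain h where "h \<in> H" "(SOME m. m \<in> H #>\<^bsub>GL\<^esub> n) = h ** n"
    using coset_eq[OF assms(1,3)] by blast
  moreover have "h \<in> N_F D" using \<open>h \<in> H\<close> assms(2) Z_in_N by auto
  ultimately show ?thesis using assms
    by (simp add: coset_act_def apt_mult apt_H0 subset_eq)
qed

lemma coset_act_cls: "n \<in> N_F D \<Longrightarrow> coset_act D (cls D n) = apt_act D n"
  and coset_act_cls1: "n \<in> N_F D \<Longrightarrow> coset_act D (cls1 D n) = apt_act D n"
  unfolding cls_def cls1_def using coset_act_coset normal_H0 normal_H1 H1_subset_H0 by auto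

section \<open>The groups W~ and W~(1) acting on the apartment\<close>

lemma carrier_Wt: "carrier (Wt D) = cls D ` N_F D"
  and carrier_Wt1: "carrier (Wt1 D) = cls1 D ` N_F D"
  by (auto simp: Wt_def Wt1_def carrier_FactGroup cls_def cls1_def r_coset_GL_on)

sublocale Wt: group "Wt D"
  unfolding Wt_def by (rule normal.factorgroup_is_group[OF normal_H0])

sublocale W1: group "Wt1 D"
  unfolding Wt1_def by (rule normal.factorgroup_is_group[OF normal_H1])

abbreviation mult1 (infixl \<open>\<cdot>\<close> 70) where "x \<cdot> y \<equiv> x \<otimes>\<^bsub>Wt1 D\<^esub> y"
abbreviation inv1 (\<open>inv1 _\<close> [81] 80) where "inv1 x \<equiv> inv\<^bsub>Wt1 D\<^esub> x"
abbreviation mult0 (infixl \<open>\<star>\<close> 70) where "x \<star> y \<equiv> x \<otimes>\<^bsub>Wt D\<^esub> y"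
abbreviation inv0 (\<open>inv0 _\<close> [81] 80) where "inv0 x \<equiv> inv\<^bsub>Wt D\<^esub> x"

lemma cls_mult: "n \<in> N_F D \<Longrightarrow> n' \<in> N_F D \<Longrightarrow> cls D n \<star> cls D n' = cls D (n ** n')"
  and cls1_mult: "n \<in> N_F D \<Longrightarrow> n' \<in> N_F D \<Longrightarrow> cls1 D n \<cdot> cls1 D n' = cls1 D (n ** n')"
  using normal.rcos_sum[OF normal_H0, of n n'] normal.rcos_sum[OF normal_H1, of n n']
  by (simp_all add: Wt_def Wt1_def cls_def cls1_def r_coset_GL_on set_mult_GL_on)

lemma r_coset_one: "H #>\<^bsub>GL\<^esub> mat 1 = H"
  by (auto simp: r_coset_def)

lemma cls_one: "\<one>\<^bsub>Wt D\<^esub> = cls D (mat 1)" and cls1_one: "\<one>\<^bsub>Wt1 D\<^esub> = cls1 D (mat 1)"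
  by (simp_all add: Wt_def Wt1_def cls_def cls1_def r_coset_one)

lemma cls_inv: assumes "n \<in> N_F D" shows "inv0 (cls D n) = cls D (matrix_inv n)"
  by (rule Wt.inv_equality)
    (use assms in \<open>auto simp: cls_mult carrier_Wt inv_in_N matrix_inv_right_left N_invertible cls_one\<close>)

lemma cls1_inv: assumes "n \<in> N_F D" shows "inv1 (cls1 D n) = cls1 D (matrix_inv n)"
  by (rule W1.inv_equality)
    (use assms in \<open>auto simp: cls1_mult carrier_Wt1 inv_in_N matrix_inv_right_left N_invertible cls1_one\<close>)

lemma proj_cls1: assumes "n \<in> N_F D" shows "proj D (cls1 D n) = cls D n"
proof -
  have "H0 <#>\<^bsub>GL\<^esub> H1 = H0"
  proof
    have "subgroup H0 GN" by (rule normal_imp_subgroup[OF normal_H0])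
    then show "H0 <#>\<^bsub>GL\<^esub> H1 \<subseteq> H0"
      using H1_subset_H0 subgroup.m_closed[of H0 GN] by (auto simp: set_mult_def)
    have "mat 1 \<in> H1" using subgroup.one_closed[OF normal_imp_subgroup[OF normal_H1]] by simp
    then show "H0 \<subseteq> H0 <#>\<^bsub>GL\<^esub> H1" by (force simp: set_mult_def)
  qed
  moreover have "H0 <#>\<^bsub>GL\<^esub> (H1 #>\<^bsub>GL\<^esub> n) = (H0 <#>\<^bsub>GL\<^esub> H1) #>\<^bsub>GL\<^esub> n"
    by (auto simp: set_mult_def r_coset_def matrix_mul_assoc)
  ultimately show ?thesis by (simp add: proj_def cls_def cls1_def)
qed

lemma proj_closed: "w \<in> carrier (Wt1 D) \<Longrightarrow> proj D w \<in> carrier (Wt D)"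
  by (auto simp: carrier_Wt1 carrier_Wt proj_cls1)

lemma proj_mult: "w \<in> carrier (Wt1 D) \<Longrightarrow> w' \<in> carrier (Wt1 D) \<Longrightarrow>
    proj D (w \<cdot> w') = proj D w \<star> proj D w'"
  by (auto simp: carrier_Wt1 proj_cls1 cls1_mult cls_mult mult_in_N)

lemma proj_one: "proj D \<one>\<^bsub>Wt1 D\<^esub> = \<one>\<^bsub>Wt D\<^esub>"
  by (simp add: cls1_one cls_one proj_cls1 one_in_N)

lemma proj_inv: "w \<in> carrier (Wt1 D) \<Longrightarrow> proj D (inv1 w) = inv0 (proj D w)"
  by (auto simp: carrier_Wt1 proj_cls1 cls1_inv cls_inv inv_in_N)

lemma coset_act_proj: "w \<in> carrier (Wt1 D) \<Longrightarrow> coset_act D (proj D w) = coset_act D w"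
  by (auto simp: carrier_Wt1 proj_cls1 coset_act_cls coset_act_cls1)

lemma act_mult: "w \<in> carrier (Wt D) \<Longrightarrow> w' \<in> carrier (Wt D) \<Longrightarrow>
    coset_act D (w \<star> w') = coset_act D w \<circ> coset_act D w'"
  by (auto simp: carrier_Wt cls_mult coset_act_cls mult_in_N apt_mult)

lemma act1_mult: "w \<in> carrier (Wt1 D) \<Longrightarrow> w' \<in> carrier (Wt1 D) \<Longrightarrow>
    coset_act D (w \<cdot> w') = coset_act D w \<circ> coset_act D w'"
  by (auto simp: carrier_Wt1 cls1_mult coset_act_cls1 mult_in_N apt_mult)

lemma act_one: "coset_act D \<one>\<^bsub>Wt D\<^esub> = id" and act1_one: "coset_act D \<one>\<^bsub>Wt1 D\<^esub> = id"
  by (simp_all add: cls_one cls1_one coset_act_cls coset_act_cls1 one_in_N apt_one)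

lemma act_inv: assumes "w \<in> carrier (Wt D)"
  shows "coset_act D w \<circ> coset_act D (inv0 w) = id"
    and "coset_act D (inv0 w) \<circ> coset_act D w = id"
  using assms by (simp_all flip: act_mult add: act_one)

lemma act1_inv: assumes "w \<in> carrier (Wt1 D)"
  shows "coset_act D w \<circ> coset_act D (inv1 w) = id"
    and "coset_act D (inv1 w) \<circ> coset_act D w = id"
  using assms by (simp_all flip: act1_mult add: act1_one)

text \<open>W~ and W~(1) induce the same transformations of the apartment. Inversions and lengths
  are treated for these maps, so that the results serve both groups.\<close>

definition apt_maps :: "('v \<Rightarrow> 'v) set" where
  "apt_maps = apt_act D ` N_F D"

lemma act_in_maps: "w \<in> carrier (Wt D) \<Longrightarrow> coset_act D w \<in> apt_maps"
  and act1_in_maps: "w \<in> carrier (Wt1 D) \<Longrightarrow> coset_act D w \<in> apt_maps"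
  by (auto simp: apt_maps_def carrier_Wt carrier_Wt1 coset_act_cls coset_act_cls1)

lemma maps_comp: "g \<in> apt_maps \<Longrightarrow> h \<in> apt_maps \<Longrightarrow> g \<circ> h \<in> apt_maps"
  unfolding apt_maps_def by (auto simp flip: apt_mult intro!: imageI mult_in_N)

lemma maps_id: "id \<in> apt_maps"
  unfolding apt_maps_def using apt_one one_in_N by force

lemma maps_inv: assumes "g \<in> apt_maps" obtains h where "h \<in> apt_maps" "g \<circ> h = id" "h \<circ> g = id"
  using assms apt_inv inv_in_N unfolding apt_maps_def by blast

lemma maps_bij: "g \<in> apt_maps \<Longrightarrow> bij g"
  using apt_bij by (auto simp: apt_maps_def)

lemma maps_lin: "g \<in> apt_maps \<Longrightarrow> linear (\<lambda>v. g v - g 0)"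
  using apt_lin by (auto simp: apt_maps_def)

section \<open>The subgroup \<Lambda>(1) and its translation vectors\<close>

lemma Lam1_closed: "l \<in> Lam1 D \<Longrightarrow> l \<in> carrier (Wt1 D)"
  by (auto simp: Lam1_def carrier_Wt1 Z_in_N)

lemma subgroup_Lam1: "subgroup (Lam1 D) (Wt1 D)"
proof -
  have s: "subgroup (Z_F D) GN" by (rule normal_imp_subgroup[OF normal_Z])
  show ?thesis
  proof (rule W1.subgroupI)
    show "Lam1 D \<subseteq> carrier (Wt1 D)" using Lam1_closed by auto
    show "Lam1 D \<noteq> {}" using one_in_Z by (auto simp: Lam1_def)
  next
    fix a assume "a \<in> Lam1 D"
    then show "inv1 a \<in> Lam1 D"
      using subgroup.m_inv_closed[OF s] by (auto simp: Lam1_def cls1_inv Z_in_N inv_GN)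
  next
    fix a b assume "a \<in> Lam1 D" "b \<in> Lam1 D"
    then show "a \<cdot> b \<in> Lam1 D"
      using subgroup.m_closed[OF s] by (auto simp: Lam1_def cls1_mult Z_in_N)
  qed
qed

lemma Lam1_conj:
  assumes "l \<in> Lam1 D" "x \<in> carrier (Wt1 D)"
  shows "x \<cdot> l \<cdot> inv1 x \<in> Lam1 D"
proof -
  obtain z where z: "z \<in> Z_F D" "l = cls1 D z" using assms(1) by (auto simp: Lam1_def)
  obtain n where n: "n \<in> N_F D" "x = cls1 D n" using assms(2) by (auto simp: carrier_Wt1)
  have "n ** z ** matrix_inv n \<in> Z_F D"
    using normal.inv_op_closed2[OF normal_Z, of n z] n z by (simp add: inv_GN)
  then show ?thesis using n z
    by (simp add: cls1_mult cls1_inv inv_in_N Z_in_N mult_in_N Lam1_def)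
qed

lemma Lam1_conj':
  assumes "l \<in> Lam1 D" "x \<in> carrier (Wt1 D)"
  shows "inv1 x \<cdot> l \<cdot> x \<in> Lam1 D"
  using Lam1_conj[OF assms(1), of "inv1 x"] assms(2) by simp

lemma act_Lam1: assumes "l \<in> Lam1 D" shows "coset_act D l v = v + nu D l"
proof -
  obtain z where z: "z \<in> Z_F D" "l = cls1 D z" using assms by (auto simp: Lam1_def)
  then show ?thesis using apt_Z[OF z(1), of v] by (simp only: nu_def coset_act_cls1 Z_in_N)
qed

lemma nu_mult: "l \<in> Lam1 D \<Longrightarrow> m \<in> Lam1 D \<Longrightarrow> nu D (l \<cdot> m) = nu D l + nu D m"
  using act_Lam1[of l "nu D m"] by (simp add: nu_def act1_mult Lam1_closed)

lemma nu_one: "nu D \<one>\<^bsub>Wt1 D\<^esub> = 0"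
  by (simp add: nu_def act1_one)

lemma nu_inv: assumes "l \<in> Lam1 D" shows "nu D (inv1 l) = - nu D l"
proof -
  have "nu D l + nu D (inv1 l) = 0"
    using assms nu_mult[OF assms subgroup.m_inv_closed[OF subgroup_Lam1 assms]] by (simp add: nu_one Lam1_closed)
  then show ?thesis by (simp add: eq_neg_iff_add_eq_0 add.commute)
qed

lemma nu_conj:
  assumes "l \<in> Lam1 D" "x \<in> carrier (Wt1 D)"
  shows "nu D (x \<cdot> l \<cdot> inv1 x) = coset_act D x (nu D l) - coset_act D x 0"
proof -
  \<comment> \<open>The conjugate moves the origin to u, then by \<open>nu D l\<close>, then applies
    x; as x takes u to 0, only its linear part remains.\<close>
  define u where "u = coset_act D (inv1 x) 0"
  have xu: "coset_act D x u = 0"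
    using fun_cong[OF act1_inv(1)[OF assms(2)], of 0] by (simp add: u_def)
  have "linear (\<lambda>v. coset_act D x v - coset_act D x 0)"
    using maps_lin act1_in_maps assms(2) by blast
  from linear_add[OF this, of u "nu D l"] xu
  have "coset_act D x (u + nu D l) = coset_act D x (nu D l) - coset_act D x 0" by simp
  moreover have "nu D (x \<cdot> l \<cdot> inv1 x) = coset_act D x (coset_act D l u)"
    using assms Lam1_closed[OF assms(1)] by (simp add: nu_def[of D "_ \<otimes>\<^bsub>_\<^esub> _"] act1_mult u_def)
  ultimately show ?thesis by (simp only: act_Lam1[OF assms(1)])
qed

lemma nu_conj_Lam1:
  assumes "l \<in> Lam1 D" "m \<in> Lam1 D"
  shows "nu D (m \<cdot> l \<cdot> inv1 m) = nu D l"
  using nu_conj[OF assms(1) Lam1_closed[OF assms(2)]] act_Lam1[OF assms(2)] by simp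

lemma nu_pow: "l \<in> Lam1 D \<Longrightarrow> l [^]\<^bsub>Wt1 D\<^esub> (N::nat) \<in> Lam1 D \<and> nu D (l [^]\<^bsub>Wt1 D\<^esub> N) = real N *\<^sub>R nu D l"
  by (induction N) (auto simp: nu_one nu_mult subgroup.one_closed[OF subgroup_Lam1]
      subgroup.m_closed[OF subgroup_Lam1] algebra_simps)

end

section \<open>Affine functions\<close>

definition affine_fun :: "('v::real_vector \<Rightarrow> real) \<Rightarrow> bool" where
  "affine_fun f \<longleftrightarrow> linear (\<lambda>v. f v - f 0)"

lemma affine_fun_line:
  assumes "affine_fun f"
  shows "f (u + t *\<^sub>R (w - u)) = f u + t * (f w - f u)"
proof -
  have l: "linear (\<lambda>v. f v - f 0)" using assms by (simp add: affine_fun_def)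
  show ?thesis
    using linear_add[OF l, of u "t *\<^sub>R (w - u)"] linear_scale[OF l, of t "w - u"] linear_diff[OF l, of w u]
    by (simp add: algebra_simps)
qed

lemma affine_fun_eventually_pos:
  assumes "affine_fun f" "f u > 0"
  shows "\<forall>\<^sub>F t in at_right 0. f (u + t *\<^sub>R (w - u)) > 0"
proof -
  have "((\<lambda>t. f u + t * (f w - f u)) \<longlongrightarrow> f u + 0 * (f w - f u)) (at_right 0)"
    by (intro tendsto_intros)
  then show ?thesis using assms
    by (simp add: affine_fun_line order_tendstoD)
qed

lemma affine_fun_minus: "affine_fun f \<Longrightarrow> affine_fun (\<lambda>v. - f v)"
  using linear_compose_neg[of "\<lambda>v. f v - f 0"] by (simp add: affine_fun_def algebra_simps)

lemma affine_fun_lincomb: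
  assumes "affine_fun f" "affine_fun g"
  shows "affine_fun (\<lambda>v. f v * r - g v * s)"
proof -
  have "linear (\<lambda>v. r *\<^sub>R (f v - f 0) - s *\<^sub>R (g v - g 0))"
    using assms unfolding affine_fun_def
    by (intro linear_compose_sub[of "\<lambda>v. _ *\<^sub>R (f v - f 0)"] linear_compose_scale_right)
  then show ?thesis by (simp add: affine_fun_def algebra_simps)
qed

text \<open>On the segment the function is affine in the parameter: if it vanishes at u, it is a
  nonzero multiple of t, and otherwise its sign at u persists.\<close>

lemma affine_fun_eventually_nonzero:
  assumes "affine_fun f" "f u \<noteq> 0 \<or> f w \<noteq> 0"
  shows "\<forall>\<^sub>F t in at_right 0. f (u + t *\<^sub>R (w - u)) \<noteq> 0"
proof (cases "f u = 0")
  case True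
  then have "f (u + t *\<^sub>R (w - u)) \<noteq> 0" if "t > 0" for t
    using affine_fun_line[OF assms(1)] that assms(2) by auto
  then show ?thesis by (auto simp: eventually_at_filter)
next
  case False
  then consider "f u > 0" | "f u < 0" by linarith
  then show ?thesis
  proof cases
    case 1
    from affine_fun_eventually_pos[OF assms(1) this, of w] show ?thesis by (rule eventually_mono) auto
  next
    case 2
    then have "- f u > 0" by simp
    from affine_fun_eventually_pos[OF affine_fun_minus[OF assms(1)] this, of w]
    show ?thesis by (rule eventually_mono) auto
  qed
qed

text \<open>Induction over F: a point good for the earlier functions is moved slightly towards a
  point where the new one is nonzero. One-sided limits along segments stand in for a topology on
  \<open>'v\<close>.\<close>

lemma affine_generic_point:
  fixes F :: "('v::real_vector \<Rightarrow> real) set"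
  assumes "finite F" "\<And>f. f \<in> F \<Longrightarrow> affine_fun f \<and> f \<noteq> (\<lambda>_. 0)"
  shows "\<exists>u. \<forall>f\<in>F. f u \<noteq> 0"
  using assms
proof (induction F rule: finite_induct)
  case (insert f F)
  then obtain u where u: "\<forall>g\<in>F. g u \<noteq> 0" by auto
  obtain w where w: "f w \<noteq> 0" using insert.prems by fastforce
  have "\<forall>\<^sub>F t in at_right 0. \<forall>g\<in>insert f F. g (u + t *\<^sub>R (w - u)) \<noteq> 0"
    using insert.hyps insert.prems u w
    by (intro eventually_ball_finite ballI affine_fun_eventually_nonzero) auto
  then show ?case using eventually_happens' trivial_limit_at_right_real by blast
qed auto

section \<open>Affine roots\<close>

context grp_data
begin

lemma affine_roots_conds:
  "finite (Sig D)"
  "\<forall>\<alpha>\<in>Sig D. linear \<alpha> \<and> \<alpha> (coroot D \<alpha>) = 2"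
  "\<forall>\<alpha>\<in>Sig D. \<forall>\<beta>\<in>Sig D. \<beta> (coroot D \<alpha>) \<in> \<int> \<and> (\<lambda>v. \<beta> v - \<beta> (coroot D \<alpha>) * \<alpha> v) \<in> Sig D"
  "\<forall>\<alpha>\<in>Sig D. \<forall>c. (\<lambda>v. c * \<alpha> v) \<in> Sig D \<longrightarrow> c = 1 \<or> c = -1"
  "\<forall>\<alpha>\<in>Sig D. \<exists>a\<in>roots (loc_field D) (grp D) (tor D). \<exists>c>0. \<alpha> = (\<lambda>v. c * chr D a v)"
  "\<forall>\<alpha>\<in>Sig D. \<alpha> \<in> Sig_pos D \<or> (\<lambda>v. - \<alpha> v) \<in> Sig_pos D"
  "\<exists>v. \<forall>\<alpha>\<in>Sig_pos D. \<alpha> v > 0"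
  "\<forall>n\<in>N_F D. (\<lambda>a. a \<circ> apt_act D n) ` Sig_aff D = Sig_aff D"
  "inj_on (coset_act D) (Waff D)"
  "coset_act D ` Waff D = {foldr (\<circ>) rs id | rs. set rs \<subseteq> refl_map D ` Sig_aff D}"
  using oks(4) unfolding affine_roots_ok_def Let_def by - (elim conjE, assumption)+

lemmas finite_Sig = affine_roots_conds(1)
  and Sig_linear = affine_roots_conds(2)[rule_format, THEN conjunct1]
  and coroot_two = affine_roots_conds(2)[rule_format, THEN conjunct2]
  and Sig_refl = affine_roots_conds(3)[rule_format, THEN conjunct2]
  and Sig_reduced = affine_roots_conds(4)[rule_format]
  and Sig_char = affine_roots_conds(5)[rule_format]
  and Sig_split = affine_roots_conds(6)[rule_format]
  and Sig_chamber = affine_roots_conds(7)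
  and N_perm = affine_roots_conds(8)[rule_format]
  and Waff_inj = affine_roots_conds(9)
  and Waff_image = affine_roots_conds(10)

lemma Sig_neg: "\<alpha> \<in> Sig D \<Longrightarrow> (\<lambda>v. - \<alpha> v) \<in> Sig D"
  using Sig_refl[of \<alpha> \<alpha>] coroot_two[of \<alpha>] by simp

lemma Sig_pos_subset: "\<alpha> \<in> Sig_pos D \<Longrightarrow> \<alpha> \<in> Sig D"
  by (simp add: Sig_pos_def)

lemma Sig_pos_asym: "\<alpha> \<in> Sig_pos D \<Longrightarrow> (\<lambda>v. - \<alpha> v) \<notin> Sig_pos D"
proof
  assume a: "\<alpha> \<in> Sig_pos D" "(\<lambda>v. - \<alpha> v) \<in> Sig_pos D"
  obtain v where v: "\<forall>\<alpha>\<in>Sig_pos D. \<alpha> v > 0" using Sig_chamber by auto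
  show False using bspec[OF v a(1)] bspec[OF v a(2)] by simp
qed

lemma Sig_zero: "\<alpha> \<in> Sig D \<Longrightarrow> \<alpha> 0 = 0"
  using Sig_linear linear_0 by blast

text \<open>An affine root is stored as a bare function; \<open>grad a\<close> and
  \<open>a 0\<close> recover the pair in \<Sigma> x Z.\<close>

definition grad :: "('v \<Rightarrow> real) \<Rightarrow> 'v \<Rightarrow> real" where
  "grad a = (\<lambda>v. a v - a 0)"

lemma grad_add: "\<alpha> \<in> Sig D \<Longrightarrow> grad (\<lambda>v. \<alpha> v + k) = \<alpha>"
  by (simp add: grad_def Sig_zero)

lemma Sig_aff_iff: "a \<in> Sig_aff D \<longleftrightarrow> grad a \<in> Sig D \<and> a 0 \<in> \<int>"
proof
  assume "a \<in> Sig_aff D"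
  then show "grad a \<in> Sig D \<and> a 0 \<in> \<int>"
    by (auto simp: Sig_aff_def grad_add Sig_zero)
next
  assume a: "grad a \<in> Sig D \<and> a 0 \<in> \<int>"
  then obtain k :: int where "a 0 = of_int k" by (auto simp: Ints_def)
  then have "a = (\<lambda>v. grad a v + of_int k)" by (simp add: grad_def)
  then show "a \<in> Sig_aff D" using a unfolding Sig_aff_def by blast
qed

lemma Sig_aff_pos_iff:
  "a \<in> Sig_aff_pos D \<longleftrightarrow> a \<in> Sig_aff D \<and> (a 0 > 0 \<or> a 0 = 0 \<and> grad a \<in> Sig_pos D)"
proof
  assume "a \<in> Sig_aff_pos D"
  then obtain \<alpha> k where k: "a = (\<lambda>v. \<alpha> v + of_int k)" "\<alpha> \<in> Sig_pos D \<and> k \<ge> 0 \<or> \<alpha> \<in> Sig D \<and> k > 0"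
    by (auto simp: Sig_aff_pos_def)
  then have "\<alpha> \<in> Sig D" by (auto simp: Sig_pos_subset)
  then show "a \<in> Sig_aff D \<and> (a 0 > 0 \<or> a 0 = 0 \<and> grad a \<in> Sig_pos D)"
    using k by (auto simp: Sig_aff_iff grad_add Sig_zero)
next
  assume a: "a \<in> Sig_aff D \<and> (a 0 > 0 \<or> a 0 = 0 \<and> grad a \<in> Sig_pos D)"
  then obtain k :: int where k: "a 0 = of_int k" by (auto simp: Sig_aff_iff Ints_def)
  then have "a = (\<lambda>v. grad a v + of_int k)" by (simp add: grad_def)
  moreover have "grad a \<in> Sig_pos D \<and> k \<ge> 0 \<or> grad a \<in> Sig D \<and> k > 0"
    using a k by (auto simp: Sig_aff_iff)
  ultimately show "a \<in> Sig_aff_pos D" unfolding Sig_aff_pos_def by blast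
qed

lemma grad_minus: "grad (\<lambda>v. - a v) = (\<lambda>v. - grad a v)"
  by (simp add: grad_def)

lemma Sig_aff_neg_iff: "a \<in> Sig_aff_neg D \<longleftrightarrow> (\<lambda>v. - a v) \<in> Sig_aff_pos D"
  by (force simp: Sig_aff_neg_def)

lemma Sig_aff_minus: "a \<in> Sig_aff D \<Longrightarrow> (\<lambda>v. - a v) \<in> Sig_aff D"
  by (auto simp: Sig_aff_iff grad_minus Sig_neg)

lemma pos_subset: "a \<in> Sig_aff_pos D \<Longrightarrow> a \<in> Sig_aff D"
  by (simp add: Sig_aff_pos_iff)

lemma pos_or_neg: "a \<in> Sig_aff D \<Longrightarrow> a \<in> Sig_aff_pos D \<or> a \<in> Sig_aff_neg D"
  using Sig_split[of "grad a"] Sig_aff_minus[of a]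
  unfolding Sig_aff_neg_iff Sig_aff_pos_iff grad_minus Sig_aff_iff by linarith

lemma not_pos_neg: "a \<in> Sig_aff_pos D \<Longrightarrow> a \<notin> Sig_aff_neg D"
  using Sig_pos_asym[of "grad a"] unfolding Sig_aff_neg_iff Sig_aff_pos_iff grad_minus by linarith

lemma neg_subset: "a \<in> Sig_aff_neg D \<Longrightarrow> a \<in> Sig_aff D"
  using Sig_aff_minus[of "\<lambda>v. - a v"] by (simp add: Sig_aff_neg_iff pos_subset)

lemma neg_minus: "(\<lambda>v. - a v) \<in> Sig_aff_neg D \<longleftrightarrow> a \<in> Sig_aff_pos D"
  by (simp add: Sig_aff_neg_iff)

lemma Sig_aff_affine: "a \<in> Sig_aff D \<Longrightarrow> affine_fun a"
  using Sig_linear by (auto simp: affine_fun_def Sig_aff_iff grad_def)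

lemma maps_Sig_aff: "g \<in> apt_maps \<Longrightarrow> a \<in> Sig_aff D \<Longrightarrow> a \<circ> g \<in> Sig_aff D"
  using N_perm by (auto simp: apt_maps_def)

lemma Sig_bounded_chamber: "\<exists>c. \<forall>\<alpha>\<in>Sig D. \<bar>\<alpha> c\<bar> < 1 \<and> (\<alpha> \<in> Sig_pos D \<longrightarrow> \<alpha> c > 0)"
proof -
  obtain v where v: "\<forall>\<alpha>\<in>Sig_pos D. \<alpha> v > 0" using Sig_chamber by blast
  \<comment> \<open>Dividing by M brings every root below 1 in absolute value; the summand 1 makes
    the bounds strict and keeps M positive even if there are no roots.\<close>
  define M where "M = (\<Sum>\<alpha>\<in>Sig D. \<bar>\<alpha> v\<bar>) + 1"
  have M: "\<bar>\<alpha> v\<bar> < M" if "\<alpha> \<in> Sig D" for \<alpha>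
    using member_le_sum[OF that, of "\<lambda>\<alpha>. \<bar>\<alpha> v\<bar>"] finite_Sig by (simp add: M_def)
  have "M > 0" unfolding M_def by (smt (verit) sum_nonneg abs_ge_zero)
  then have "\<bar>\<alpha> ((1/M) *\<^sub>R v)\<bar> < 1 \<and> (\<alpha> \<in> Sig_pos D \<longrightarrow> \<alpha> ((1/M) *\<^sub>R v) > 0)" if "\<alpha> \<in> Sig D" for \<alpha>
    using M[OF that] v linear_scale[OF Sig_linear[OF that]] by (simp add: abs_mult)
  then show ?thesis by blast
qed

text \<open>Near the origin in the dominant chamber a constant k \<ge> 1 outweighs the gradient, and
  for k = 0 the gradient itself is positive.\<close>

lemma alcove_point: "\<exists>c. \<forall>a\<in>Sig_aff_pos D. a c > 0"
proof -
  obtain c where c: "\<forall>\<alpha>\<in>Sig D. \<bar>\<alpha> c\<bar> < 1 \<and> (\<alpha> \<in> Sig_pos D \<longrightarrow> \<alpha> c > 0)"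
    using Sig_bounded_chamber by blast
  have "a c > 0" if a: "a \<in> Sig_aff_pos D" for a
  proof -
    have "a c = grad a c + a 0" by (simp add: grad_def)
    moreover have "a 0 > 0 \<Longrightarrow> a 0 \<ge> 1" using a by (auto simp: Sig_aff_pos_iff Sig_aff_iff Ints_def)
    moreover have "\<bar>grad a c\<bar> < 1" using c a by (auto simp: Sig_aff_pos_iff Sig_aff_iff)
    moreover have "grad a \<in> Sig_pos D \<Longrightarrow> grad a c > 0" using c Sig_pos_subset by blast
    ultimately show ?thesis using a by (auto simp: Sig_aff_pos_iff)
  qed
  then show ?thesis by blast
qed

section \<open>The base alcove and the hyperplanes separating a point from it\<close>

definition alcove :: "'v set" where
  "alcove = {c. \<forall>a\<in>Sig_aff_pos D. a c > 0}"

lemma alcove_pos_iff: "c \<in> alcove \<Longrightarrow> a \<in> Sig_aff D \<Longrightarrow> a \<in> Sig_aff_pos D \<longleftrightarrow> a c > 0"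
  using pos_or_neg[of a] by (force simp: alcove_def Sig_aff_neg_iff)

lemma alcove_neg_iff: "c \<in> alcove \<Longrightarrow> a \<in> Sig_aff D \<Longrightarrow> a \<in> Sig_aff_neg D \<longleftrightarrow> a c < 0"
  using pos_or_neg[of a] by (force simp: alcove_def Sig_aff_neg_iff)

text \<open>Only finitely many affine roots are small and non-zero at a given point, so near the start of a
  segment no root changes its sign.\<close>

lemma Sig_aff_eventually_sgn:
  "\<forall>\<^sub>F t in at_right 0. \<forall>a\<in>Sig_aff D. a u > 0 \<longrightarrow> a (u + t *\<^sub>R (w - u)) > 0"
proof -
  have "\<forall>\<^sub>F t in at_right 0. \<forall>\<alpha>\<in>Sig D. \<alpha> (u + t *\<^sub>R (w - u)) - \<alpha> u + (of_int \<lfloor>- \<alpha> u\<rfloor> + 1 + \<alpha> u) > 0"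
  proof (intro eventually_ball_finite ballI finite_Sig)
    fix \<alpha> assume a: "\<alpha> \<in> Sig D"
    \<comment> \<open>In fact f is \<alpha> + k for the least integer k with \<alpha>(u) + k > 0.
      While it stays positive, so does every affine root with gradient \<alpha> that is positive at
      u.\<close>
    define f where "f v = \<alpha> v - \<alpha> u + (of_int \<lfloor>- \<alpha> u\<rfloor> + 1 + \<alpha> u)" for v
    have "affine_fun f" using Sig_linear[OF a] by (simp add: affine_fun_def f_def Sig_zero a)
    moreover have "f u > 0" unfolding f_def by linarith
    ultimately have "\<forall>\<^sub>F t in at_right 0. f (u + t *\<^sub>R (w - u)) > 0"
      by (rule affine_fun_eventually_pos)
    then show "\<forall>\<^sub>F t in at_right 0. \<alpha> (u + t *\<^sub>R (w - u)) - \<alpha> u + (of_int \<lfloor>- \<alpha> u\<rfloor> + 1 + \<alpha> u) > 0"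
      by (simp add: f_def)
  qed
  then show ?thesis
  proof (rule eventually_mono, intro ballI impI)
    fix t a assume t: "\<forall>\<alpha>\<in>Sig D. \<alpha> (u + t *\<^sub>R (w - u)) - \<alpha> u + (of_int \<lfloor>- \<alpha> u\<rfloor> + 1 + \<alpha> u) > 0"
      and a: "a \<in> Sig_aff D" "a u > 0"
    obtain k :: int where k: "a 0 = of_int k" using a(1) by (auto simp: Sig_aff_iff Ints_def)
    have e: "a v = grad a v + of_int k" for v by (simp add: grad_def k)
    have "- grad a u < of_int k" using a(2) e[of u] by simp
    then have "\<lfloor>- grad a u\<rfloor> < k" by (simp add: floor_less_iff)
    then have "of_int \<lfloor>- grad a u\<rfloor> + 1 \<le> (of_int k :: real)" by simp
    moreover have "grad a (u + t *\<^sub>R (w - u)) - grad a u + (of_int \<lfloor>- grad a u\<rfloor> + 1 + grad a u) > 0"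
      using t a(1) by (auto simp: Sig_aff_iff)
    ultimately show "a (u + t *\<^sub>R (w - u)) > 0" using e[of "u + t *\<^sub>R (w - u)"] by simp
  qed
qed

lemma alcove_generic_point:
  assumes "finite F" "\<And>f. f \<in> F \<Longrightarrow> affine_fun f \<and> f \<noteq> (\<lambda>_. 0)"
  shows "\<exists>c\<in>alcove. \<forall>f\<in>F. f c \<noteq> 0"
proof -
  obtain u where u: "\<forall>f\<in>F. f u \<noteq> 0" using affine_generic_point[OF assms] by blast
  obtain c where c: "c \<in> alcove" using alcove_point by (auto simp: alcove_def)
  have "\<forall>\<^sub>F t in at_right 0. (\<forall>f\<in>F. f (c + t *\<^sub>R (u - c)) \<noteq> 0) \<and>
      (\<forall>a\<in>Sig_aff D. a c > 0 \<longrightarrow> a (c + t *\<^sub>R (u - c)) > 0)"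
    using assms u by (intro eventually_conj Sig_aff_eventually_sgn eventually_ball_finite ballI
        affine_fun_eventually_nonzero) auto
  then obtain t where "\<forall>f\<in>F. f (c + t *\<^sub>R (u - c)) \<noteq> 0"
      "\<forall>a\<in>Sig_aff D. a c > 0 \<longrightarrow> a (c + t *\<^sub>R (u - c)) > 0"
    using eventually_happens' trivial_limit_at_right_real by blast
  then show ?thesis using c pos_subset
    by (intro bexI[of _ "c + t *\<^sub>R (u - c)"]) (auto simp: alcove_def)
qed

definition regular :: "'v \<Rightarrow> bool" where
  "regular p \<longleftrightarrow> (\<forall>a\<in>Sig_aff D. a p \<noteq> 0)"

text \<open>The hyperplanes separating p from the base alcove, each represented by its positive
  affine root.\<close>

definition neg_at :: "'v \<Rightarrow> ('v \<Rightarrow> real) set" where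
  "neg_at p = {a \<in> Sig_aff_pos D. a p < 0}"

lemma finite_neg_at: "finite (neg_at p)"
proof -
  have "neg_at p \<subseteq> (\<Union>\<alpha>\<in>Sig D. (\<lambda>k::int. (\<lambda>v. \<alpha> v + of_int k)) ` {0..\<lceil>- \<alpha> p\<rceil>})"
  proof
    fix a assume "a \<in> neg_at p"
    then have a: "a \<in> Sig_aff D" "a p < 0" "a 0 \<ge> 0" by (auto simp: neg_at_def Sig_aff_pos_iff)
    obtain k :: int where k: "a 0 = of_int k" using a(1) by (auto simp: Sig_aff_iff Ints_def)
    have e: "a = (\<lambda>v. grad a v + of_int k)" by (simp add: grad_def k[symmetric])
    have "grad a p + of_int k < 0" using a(2) e by metis
    then have "k \<in> {0..\<lceil>- grad a p\<rceil>}" using a(3) k by (simp; linarith)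
    then show "a \<in> (\<Union>\<alpha>\<in>Sig D. (\<lambda>k::int. (\<lambda>v. \<alpha> v + of_int k)) ` {0..\<lceil>- \<alpha> p\<rceil>})"
      using a(1) by (intro UN_I[of "grad a"] image_eqI[where x = k]) (auto simp: Sig_aff_iff e[symmetric])
  qed
  then show ?thesis by (rule finite_subset) (use finite_Sig in auto)
qed

text \<open>Since \<Sigma> is reduced, the factor is 1 or -1, and -1 would make one of the two roots
  negative.\<close>

lemma pos_proportional:
  assumes "a \<in> Sig_aff_pos D" "b \<in> Sig_aff_pos D" "s \<noteq> 0" "\<And>v. a v * r = b v * s"
  shows "a = b"
proof -
  define t where "t = r / s"
  have b: "b v = t * a v" for v using assms(3) assms(4)[of v] by (simp add: t_def field_simps)
  then have "grad b = (\<lambda>v. t * grad a v)" by (simp add: grad_def algebra_simps)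
  then have "t = 1 \<or> t = -1"
    using Sig_reduced[of "grad a" t] assms(1,2) by (auto simp: Sig_aff_pos_iff Sig_aff_iff)
  then show ?thesis
  proof
    assume "t = -1"
    then have "b = (\<lambda>v. - a v)" using b by auto
    then show ?thesis using assms not_pos_neg[of b] by (simp add: neg_minus)
  qed (use b in auto)
qed

text \<open>The first wall met on a generic segment from the alcove to \<open>p\<close> is the hyperplane of a simple
  affine root.\<close>

lemma simple_neg_at:
  assumes "regular p" "neg_at p \<noteq> {}"
  shows "\<exists>a\<in>simple_aff D. a p < 0"
proof -
  let ?N = "neg_at p"
  \<comment> \<open>Such a function vanishes at c exactly when the walls of the two roots meet the
    segment from c to p at the same parameter. A point c avoiding this makes the first wall
    unique.\<close>
  define F where "F = (\<lambda>x v. fst x v * snd x p - snd x v * fst x p) ` {x \<in> ?N \<times> ?N. fst x \<noteq> snd x}"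
  have "finite (?N \<times> ?N)" using finite_neg_at by simp
  then have "finite F" unfolding F_def
    by (intro finite_imageI) (rule finite_subset[of _ "?N \<times> ?N"]; blast)
  moreover have "affine_fun f \<and> f \<noteq> (\<lambda>_. 0)" if fF: "f \<in> F" for f
  proof -
    obtain x where x: "f = (\<lambda>v. fst x v * snd x p - snd x v * fst x p)"
        "x \<in> {x \<in> ?N \<times> ?N. fst x \<noteq> snd x}"
      using fF unfolding F_def by (rule imageE)
    define a b where "a = fst x" and "b = snd x"
    have ab: "a \<in> ?N" "b \<in> ?N" "a \<noteq> b" "f = (\<lambda>v. a v * b p - b v * a p)"
      using x by (auto simp: a_def b_def)
    have "affine_fun f" unfolding ab
      using ab by (intro affine_fun_lincomb Sig_aff_affine pos_subset) (auto simp: neg_at_def)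
    moreover have "f \<noteq> (\<lambda>_. 0)"
    proof
      assume "f = (\<lambda>_. 0)"
      then have "a v * b p = b v * a p" for v using ab(4) by (metis eq_iff_diff_eq_0)
      then have "a = b" using ab by (intro pos_proportional[of a b "a p" "b p"]) (auto simp: neg_at_def)
      then show False using ab by simp
    qed
    ultimately show ?thesis by simp
  qed
  ultimately obtain c where c: "c \<in> alcove" "\<forall>f\<in>F. f c \<noteq> 0"
    using alcove_generic_point[of F] by blast
  \<comment> \<open>The parameter at which the segment from c to p meets the wall of a.\<close>
  define T where "T a = a c / (a c - a p)" for a :: "'v \<Rightarrow> real"
  have pos: "a c > 0" if "a \<in> Sig_aff_pos D" for a using c that by (auto simp: alcove_def)
  obtain a where a: "a \<in> ?N" "\<forall>b\<in>?N. T a \<le> T b"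
    using ex_min_if_finite[of "T ` ?N"] assms(2) finite_neg_at by fastforce
  define v where "v = c + T a *\<^sub>R (p - c)"
  have T: "0 < T a" "T a < 1" using a pos[of a] by (auto simp: neg_at_def T_def divide_simps)
  have v: "b v = b c + T a * (b p - b c)" if "b \<in> Sig_aff_pos D" for b
    using affine_fun_line[OF Sig_aff_affine[OF pos_subset[OF that]]] by (simp add: v_def)
  have "a c - a p > 0" using a pos[of a] by (auto simp: neg_at_def)
  then have "a v = 0" using v[of a] a by (auto simp: neg_at_def T_def field_simps)
  moreover have "b v > 0" if b: "b \<in> Sig_aff_pos D" "b \<noteq> a" for b
  proof (cases "b p < 0")
    case True
    then have bN: "b \<in> ?N" using b by (simp add: neg_at_def)
    have p: "b c - b p > 0" "a c - a p > 0" using a bN pos by (auto simp: neg_at_def intro: less_trans)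
    have "a c * b p - b c * a p \<noteq> 0"
      using c(2) a bN b unfolding F_def by (force simp: mem_Times_iff)
    then have "T a \<noteq> T b" using p by (auto simp: T_def field_simps)
    then have "T a < T b" using a bN by force
    then have "T a * (b c - b p) < b c" using p by (simp add: T_def pos_less_divide_eq)
    then show ?thesis using v[OF b(1)] by (simp add: algebra_simps)
  next
    case False
    then have "b p > 0" using assms(1) b pos_subset by (force simp: regular_def)
    then have "(1 - T a) * b c + T a * b p > 0"
      using T pos[OF b(1)] by (intro add_pos_pos mult_pos_pos) auto
    then show ?thesis using v[OF b(1)] by (simp add: algebra_simps)
  qed
  ultimately have "a \<in> simple_aff D" using a by (auto simp: simple_aff_def neg_at_def)
  then show ?thesis using a by (auto simp: neg_at_def)
qed

end

section \<open>Uniqueness of reflections\<close>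

lemma matrix_mult_diag_right:
  fixes Q S :: "'a::field^'n^'n"
  assumes "\<And>i j. i \<noteq> j \<Longrightarrow> S $ i $ j = 0"
  shows "(Q ** S) $ i $ j = Q $ i $ j * S $ j $ j"
proof -
  have "(Q ** S) $ i $ j = (\<Sum>k\<in>UNIV. Q $ i $ k * S $ k $ j)" by (simp add: matrix_matrix_mult_def)
  also have "\<dots> = (\<Sum>k\<in>UNIV. if k = j then Q $ i $ j * S $ j $ j else 0)"
    by (rule sum.cong) (use assms in auto)
  finally show ?thesis by simp
qed

lemma matrix_mult_diag_left:
  fixes Q S :: "'a::field^'n^'n"
  assumes "\<And>i j. i \<noteq> j \<Longrightarrow> S $ i $ j = 0"
  shows "(S ** Q) $ i $ j = S $ i $ i * Q $ i $ j"
proof -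
  have "(S ** Q) $ i $ j = (\<Sum>k\<in>UNIV. S $ i $ k * Q $ k $ j)" by (simp add: matrix_matrix_mult_def)
  also have "\<dots> = (\<Sum>k\<in>UNIV. if k = i then S $ i $ i * Q $ i $ j else 0)"
    by (rule sum.cong) (use assms in auto)
  finally show ?thesis by simp
qed

lemma invertible_row_nonzero:
  fixes Q :: "'a::field^'n^'n"
  assumes "invertible Q"
  shows "\<exists>j. Q $ i $ j \<noteq> 0"
proof (rule ccontr)
  assume "\<not> ?thesis"
  then have "(Q ** matrix_inv Q) $ i $ i = 0" by (simp add: matrix_matrix_mult_def)
  then show False using matrix_inv_right_left(1)[OF assms] by (simp add: mat_def)
qed

lemma conj_by_invertible_inj:
  fixes P :: "'a::field^'n^'n"
  assumes "invertible P" "P ** x ** matrix_inv P = P ** y ** matrix_inv P"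
  shows "x = y"
proof -
  have "matrix_inv P ** (P ** z ** matrix_inv P) ** P = (matrix_inv P ** P) ** z ** (matrix_inv P ** P)" for z
    by (simp only: matrix_mul_assoc)
  then have "matrix_inv P ** (P ** z ** matrix_inv P) ** P = z" for z
    by (simp add: matrix_inv_right_left assms(1))
  then show ?thesis using assms(2) by metis
qed

lemma is_subfield_sum: "is_subfield F \<Longrightarrow> (\<And>i. i \<in> A \<Longrightarrow> f i \<in> F) \<Longrightarrow> sum f A \<in> F"
  by (induction A rule: infinite_finite_induct) (auto simp: is_subfield_def)

lemma is_subfield_power: "is_subfield F \<Longrightarrow> x \<in> F \<Longrightarrow> x ^ n \<in> F"
  by (induction n) (auto simp: is_subfield_def)

lemma is_subfield_poly: "is_subfield F \<Longrightarrow> (\<And>i. coeff p i \<in> F) \<Longrightarrow> x \<in> F \<Longrightarrow> poly p x \<in> F"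
  unfolding poly_altdef
  by (intro is_subfield_sum) (auto simp: is_subfield_power is_subfield_def)

context grp_data
begin

lemma apartment_conds:
  "span (cov D ` cocharacters (loc_field D) (tor D)) = UNIV"
  "\<forall>a\<in>characters (loc_field D) (tor D). \<forall>\<mu>\<in>cocharacters (loc_field D) (tor D).
     \<exists>m::int. chr D a (cov D \<mu>) = of_int m \<and> (\<forall>t. t \<noteq> 0 \<longrightarrow> a (\<mu> t) = t powi m)"
  "\<forall>n\<in>N_F D. \<forall>\<mu>\<in>cocharacters (loc_field D) (tor D).
     cov D (restrict (\<lambda>t. n ** \<mu> t ** matrix_inv n) (- {0})) = apt_act D n (cov D \<mu>) - apt_act D n 0"
  "\<forall>z\<in>S_F D. \<forall>a\<in>characters (loc_field D) (tor D). chr D a (apt_act D z 0) = - of_int (valn D (a z))"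
  using oks(3) unfolding apartment_ok_def Let_def by - (elim conjE, assumption)+

lemma field_conds:
  "is_subfield (loc_field D)" "valn D ` (loc_field D - {0}) = UNIV"
  "\<forall>x\<in>loc_field D - {0}. \<forall>y\<in>loc_field D - {0}. valn D (x * y) = valn D x + valn D y"
  using oks(1) unfolding field_ok_def nonarch_local_field_def by - (elim conjE, assumption)+

lemma reductive_conds:
  "max_split_torus (loc_field D) (grp D) (tor D)"
  "unipotent_radical (uni D) (par D)" "par D = cen D <#>\<^bsub>GL\<^esub> uni D"
  "unipotent_radical (uni_op D) (par_op D)" "par_op D = cen D <#>\<^bsub>GL\<^esub> uni_op D"
  using oks(2) unfolding reductive_ok_def by - (elim conjE, assumption)+

lemma tor_diagonalizable:
  obtains P :: "'k^'n^'n" where "invertible P"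
    "\<And>s i j. s \<in> tor D \<Longrightarrow> i \<noteq> j \<Longrightarrow> (P ** s ** matrix_inv P) $ i $ j = 0"
proof -
  have "split_torus (loc_field D) (tor D)" using reductive_conds(1) by (simp add: max_split_torus_def)
  then obtain P :: "'k^'n^'n" where P: "P \<in> rat_points (loc_field D) (carrier GL)"
    "\<forall>s\<in>tor D. \<forall>i j. i \<noteq> j \<longrightarrow> (P ** s ** matrix_inv P) $ i $ j = 0"
    unfolding split_torus_def by blast
  then show ?thesis using that[of P] by (simp add: rat_points_def)
qed

lemma S_F_tor: "s \<in> S_F D \<Longrightarrow> s \<in> tor D"
  by (simp add: S_F_def rat_points_def)

lemma cochar_S_F:
  assumes "\<mu> \<in> cocharacters (loc_field D) (tor D)" "t \<in> loc_field D" "t \<noteq> 0"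
  shows "\<mu> t \<in> S_F D"
proof -
  obtain P :: "'n \<Rightarrow> 'n \<Rightarrow> 'k poly" and m where P: "\<forall>i j l. coeff (P i j) l \<in> loc_field D"
    "\<forall>t. t \<noteq> 0 \<longrightarrow> (\<forall>i j. t ^ m * \<mu> t $ i $ j = poly (P i j) t)"
    using assms(1) by (auto simp: cocharacters_def)
  have "\<mu> t $ i $ j \<in> loc_field D" for i j
  proof -
    have "\<mu> t $ i $ j = inverse (t ^ m) * poly (P i j) t"
      using P(2) assms(3) by (simp add: field_simps)
    moreover have "poly (P i j) t \<in> loc_field D"
      using P(1) assms(2) is_subfield_poly[OF field_conds(1)] by blast
    moreover have "inverse (t ^ m) \<in> loc_field D"
      using is_subfield_power[OF field_conds(1) assms(2)] field_conds(1) unfolding is_subfield_def by blast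
    ultimately show ?thesis using field_conds(1) by (simp add: is_subfield_def)
  qed
  moreover have "\<mu> t \<in> tor D" using assms by (simp add: cocharacters_def)
  ultimately show ?thesis by (simp add: S_F_def rat_points_def)
qed

text \<open>After multiplication by t^m the entries of both sides are polynomials in t. They agree
  on F - {0}, which is infinite because the valuation is onto the integers, hence they agree for all
  t in the algebraic closure.\<close>

lemma cochar_conj_eq:
  fixes x x' y y' :: "'k^'n^'n"
  assumes mu: "\<mu> \<in> cocharacters (loc_field D) (tor D)"
    and eq: "\<And>s. s \<in> S_F D \<Longrightarrow> x ** s ** x' = y ** s ** y'" and "t \<noteq> 0"
  shows "x ** \<mu> t ** x' = y ** \<mu> t ** y'"
proof -
  obtain P :: "'n \<Rightarrow> 'n \<Rightarrow> 'k poly" and m where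
    P: "\<forall>t. t \<noteq> 0 \<longrightarrow> (\<forall>i j. t ^ m * \<mu> t $ i $ j = poly (P i j) t)"
    using mu by (auto simp: cocharacters_def)
  define R where "R z z' i j = (\<Sum>b\<in>UNIV. (\<Sum>a\<in>UNIV. smult (z $ i $ a) (P a b)) * [:z' $ b $ j:])"
    for z z' :: "'k^'n^'n" and i j
  have R: "poly (R z z' i j) u = u ^ m * (z ** \<mu> u ** z') $ i $ j" if "u \<noteq> 0" for z z' i j u
    using P[rule_format, OF that, symmetric]
    by (simp add: R_def poly_sum matrix_matrix_mult_def sum_distrib_left sum_distrib_right algebra_simps)
  have "R x x' i j = R y y' i j" for i j
  proof (rule ccontr)
    assume "R x x' i j \<noteq> R y y' i j"
    then have "finite {u. poly (R x x' i j - R y y' i j) u = 0}" by (intro poly_roots_finite) simp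
    moreover have "loc_field D - {0} \<subseteq> {u. poly (R x x' i j - R y y' i j) u = 0}"
      using eq cochar_S_F[OF mu] by (auto simp: R)
    ultimately have "finite (loc_field D - {0})" by (rule rev_finite_subset)
    then have "finite (UNIV :: int set)" using field_conds(2) by (metis finite_imageI)
    then show False by simp
  qed
  then have "t ^ m * (x ** \<mu> t ** x') $ i $ j = t ^ m * (y ** \<mu> t ** y') $ i $ j" for i j
    using R[OF assms(3)] by metis
  then show ?thesis using assms(3) by (simp add: vec_eq_iff)
qed

lemma linear_eq_on_cov:
  assumes "linear f" "linear g" "\<And>\<mu>. \<mu> \<in> cocharacters (loc_field D) (tor D) \<Longrightarrow> f (cov D \<mu>) = g (cov D \<mu>)"
  shows "f = g"
proof
  fix v
  have "v \<in> span (cov D ` cocharacters (loc_field D) (tor D))" using apartment_conds(1) by simp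
  then show "f v = g v" using linear_eq_on_span[OF assms(1,2), of "cov D ` cocharacters (loc_field D) (tor D)" v] assms(3) by blast
qed

lemma N_conj_S_F: "n \<in> N_F D \<Longrightarrow> s \<in> S_F D \<Longrightarrow> n ** s ** matrix_inv n \<in> S_F D"
  by (auto simp: N_F_def)

text \<open>An element of \<open>N\<close> permutes the weights of the torus on the standard representation; if two of
  its powers permute them in the same way, they act on the torus by the same automorphism.\<close>

lemma N_linear_part_pigeonhole:
  assumes "g \<in> apt_maps"
  shows "\<exists>k l::nat. k < l \<and> (\<forall>v. (g ^^ k) v - (g ^^ k) 0 = (g ^^ l) v - (g ^^ l) 0)"
proof -
  obtain n where n: "n \<in> N_F D" "g = apt_act D n" using assms by (auto simp: apt_maps_def)
  define x where "x m = (((**) n) ^^ m) (mat 1)" for m :: nat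
  have x: "x m \<in> N_F D \<and> apt_act D (x m) = g ^^ m" for m
    by (induction m) (use n in \<open>auto simp: x_def one_in_N apt_one mult_in_N apt_mult\<close>)
  obtain P :: "'k^'n^'n" where P: "invertible P"
    "\<And>s i j. s \<in> tor D \<Longrightarrow> i \<noteq> j \<Longrightarrow> (P ** s ** matrix_inv P) $ i $ j = 0"
    by (rule tor_diagonalizable) blast
  define d where "d s = P ** s ** matrix_inv P" for s :: "'k^'n^'n"
  have row: "\<forall>i. \<exists>j. d (x m) $ i $ j \<noteq> 0" for m
  proof
    have "invertible (d (x m))"
      by (simp add: d_def invertible_matrix_mult invertible_matrix_inv P(1) N_invertible x)
    then show "\<exists>j. d (x m) $ i $ j \<noteq> 0" for i by (rule invertible_row_nonzero)
  qed
  \<comment> \<open>In the basis given by P the torus is diagonal. J m i is a column where row i of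
    n^m is nonzero; comparing entries there shows that conjugation by n^m replaces the i-th diagonal
    entry by the one at J m i.\<close>
  define J where "J m = (SOME J. \<forall>i. d (x m) $ i $ J i \<noteq> 0)" for m
  have J: "d (x m) $ i $ J m i \<noteq> 0" for m i
    using someI_ex[OF choice[OF row[of m]]] by (simp add: J_def)
  have dconj: "d (x m ** s ** matrix_inv (x m)) $ i $ i = d s $ J m i $ J m i" if s: "s \<in> S_F D" for m s i
  proof -
    let ?s = "x m ** s ** matrix_inv (x m)"
    have "d ?s ** d (x m) = P ** ?s ** (matrix_inv P ** P) ** x m ** matrix_inv P"
      by (simp only: d_def matrix_mul_assoc)
    also have "\<dots> = P ** x m ** s ** (matrix_inv (x m) ** x m) ** matrix_inv P"
      by (simp add: matrix_inv_right_left P(1) matrix_mul_assoc)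
    also have "\<dots> = P ** x m ** (matrix_inv P ** P) ** s ** matrix_inv P"
      by (simp add: matrix_inv_right_left P(1) x N_invertible)
    also have "\<dots> = d (x m) ** d s" by (simp only: d_def matrix_mul_assoc)
    finally have e: "(d ?s ** d (x m)) $ i $ J m i = (d (x m) ** d s) $ i $ J m i" by simp
    have "?s \<in> tor D" "s \<in> tor D" using N_conj_S_F[of "x m" s] x s S_F_tor by auto
    then have "d ?s $ i $ i * d (x m) $ i $ J m i = d (x m) $ i $ J m i * d s $ J m i $ J m i"
      using e P(2) unfolding d_def by (simp add: matrix_mult_diag_left matrix_mult_diag_right)
    then show ?thesis using J[of m i] by simp
  qed
  \<comment> \<open>Each J m is a self-map of the finite index type, so two powers of n share it and
    then conjugate S(F) in the same way.\<close>
  have "finite (range J)" by (rule finite_subset[OF subset_UNIV]) simp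
  then have "\<not> inj J" using finite_imageD[of J UNIV] by auto
  then obtain k l where kl: "k < l" "J k = J l" unfolding inj_def by (metis nat_neq_iff)
  have conj: "x k ** s ** matrix_inv (x k) = x l ** s ** matrix_inv (x l)" if s: "s \<in> S_F D" for s
  proof (rule conj_by_invertible_inj[OF P(1)])
    have t: "x m ** s ** matrix_inv (x m) \<in> tor D" for m using N_conj_S_F x s S_F_tor by blast
    have "d (x k ** s ** matrix_inv (x k)) $ i $ j = d (x l ** s ** matrix_inv (x l)) $ i $ j" for i j
      using dconj[OF s] kl(2) P(2)[OF t] by (cases "i = j") (simp_all add: d_def)
    then show "P ** (x k ** s ** matrix_inv (x k)) ** matrix_inv P =
        P ** (x l ** s ** matrix_inv (x l)) ** matrix_inv P"
      by (simp add: d_def vec_eq_iff)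
  qed
  have eq: "restrict (\<lambda>t. x k ** \<mu> t ** matrix_inv (x k)) (- {0}) =
      restrict (\<lambda>t. x l ** \<mu> t ** matrix_inv (x l)) (- {0})"
    if mu: "\<mu> \<in> cocharacters (loc_field D) (tor D)" for \<mu>
    by (rule restrict_ext, rule cochar_conj_eq[OF mu conj]) auto
  have "(\<lambda>v. apt_act D (x k) v - apt_act D (x k) 0) = (\<lambda>v. apt_act D (x l) v - apt_act D (x l) 0)"
  proof (intro linear_eq_on_cov)
    show "linear (\<lambda>v. apt_act D (x k) v - apt_act D (x k) 0)" "linear (\<lambda>v. apt_act D (x l) v - apt_act D (x l) 0)"
      using x by (blast intro: apt_lin)+
  next
    fix \<mu> assume mu: "\<mu> \<in> cocharacters (loc_field D) (tor D)"
    show "apt_act D (x k) (cov D \<mu>) - apt_act D (x k) 0 = apt_act D (x l) (cov D \<mu>) - apt_act D (x l) 0"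
      using apartment_conds(3)[rule_format, OF conjunct1[OF x[of k]] mu]
        apartment_conds(3)[rule_format, OF conjunct1[OF x[of l]] mu] eq[OF mu] by simp
  qed
  then have "(g ^^ k) v - (g ^^ k) 0 = (g ^^ l) v - (g ^^ l) 0" for v
    using x[of k] x[of l] by (auto dest: fun_cong[of _ _ v])
  then show ?thesis using kl(1) by blast
qed

section \<open>Shears and reflections\<close>

lemma Sig_aff_line: assumes "a \<in> Sig_aff D" shows "a (v + s *\<^sub>R z) = a v + s * grad a z"
proof -
  have l: "linear (grad a)" using assms Sig_linear by (simp add: Sig_aff_iff)
  show ?thesis using linear_add[OF l, of v "s *\<^sub>R z"] linear_scale[OF l, of s z] by (simp add: grad_def)
qed

lemma Sig_aff_line_minus: "a \<in> Sig_aff D \<Longrightarrow> a (v - s *\<^sub>R z) = a v - s * grad a z"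
  using Sig_aff_line[of a v "-s" z] by simp

lemma grad_coroot: "a \<in> Sig_aff D \<Longrightarrow> grad a (coroot D (grad a)) = 2"
  by (simp add: Sig_aff_iff coroot_two)

text \<open>The m-th power of the shear is the shear along m z. Two powers of a map from N share
  their linear part, so two different multiples of z coincide.\<close>

lemma shear_trivial:
  assumes g: "g \<in> apt_maps" and a: "a \<in> Sig_aff D" and gv: "\<And>v. g v = v + a v *\<^sub>R z" and z: "grad a z = 0"
  shows "z = 0"
proof -
  have p: "(g ^^ m) v = v + (real m * a v) *\<^sub>R z" for m v
    by (induction m) (auto simp: gv Sig_aff_line[OF a] z algebra_simps)
  obtain k l :: nat where kl: "k < l" "\<forall>v. (g ^^ k) v - (g ^^ k) 0 = (g ^^ l) v - (g ^^ l) 0"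
    using N_linear_part_pigeonhole[OF g] by blast
  let ?v = "coroot D (grad a)"
  have "(real k * grad a ?v) *\<^sub>R z = (real l * grad a ?v) *\<^sub>R z"
    using kl(2)[rule_format, of ?v] unfolding p by (simp add: grad_def algebra_simps)
  then show ?thesis using kl(1) grad_coroot[OF a] by simp
qed

text \<open>Two reflections in one hyperplane compose to a shear along the difference of their
  vectors. Values of roots alone would not show that this difference is zero, since roots need not
  separate the points of \<open>'v\<close>.\<close>

lemma refl_unique:
  assumes "r \<in> apt_maps" "r' \<in> apt_maps" "a \<in> Sig_aff D"
    "\<And>v. r v = v - a v *\<^sub>R c" "\<And>v. r' v = v - a v *\<^sub>R c'" "grad a c = 2" "grad a c' = 2"
  shows "r = r'"
proof -
  have "c - c' = 0"
  proof (rule shear_trivial[OF maps_comp[OF assms(1,2)] assms(3)])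
    show "(r \<circ> r') v = v + a v *\<^sub>R (c - c')" for v
    proof -
      have "a (r' v) = - a v" using assms(3,7) by (simp add: assms(5) Sig_aff_line_minus)
      then have "(r \<circ> r') v = r' v + a v *\<^sub>R c" by (simp add: assms(4))
      then show ?thesis by (simp add: assms(5) algebra_simps)
    qed
    have "linear (grad a)" using assms Sig_linear by (simp add: Sig_aff_iff)
    then show "grad a (c - c') = 0" using assms by (simp add: linear_diff)
  qed
  then show ?thesis using assms(4,5) by auto
qed

lemma refl_map_alt: "refl_map D a v = v - a v *\<^sub>R coroot D (grad a)"
  by (simp add: refl_map_def grad_def)

lemma root_refl: "a \<in> Sig_aff D \<Longrightarrow> a (refl_map D a v) = - a v"
  by (simp add: refl_map_alt Sig_aff_line_minus grad_coroot)

lemma root_comp_refl: "a \<in> Sig_aff D \<Longrightarrow> a \<circ> refl_map D a = (\<lambda>v. - a v)"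
  by (simp add: root_refl fun_eq_iff)

lemma refl_refl: assumes "a \<in> Sig_aff D" shows "refl_map D a (refl_map D a v) = v"
proof -
  have "refl_map D a (refl_map D a v) = refl_map D a v + a v *\<^sub>R coroot D (grad a)"
    by (simp only: refl_map_alt[of a "refl_map D a v"] root_refl[OF assms]) simp
  then show ?thesis by (simp add: refl_map_alt[of a v])
qed

lemma refl_comp_refl: "a \<in> Sig_aff D \<Longrightarrow> refl_map D a \<circ> refl_map D a = id"
  by (simp add: refl_refl fun_eq_iff)

lemma Waff_closed: "w \<in> Waff D \<Longrightarrow> w \<in> carrier (Wt D)"
  by (auto simp: Waff_def carrier_Wt)

lemma refl_in_Waff: assumes "a \<in> Sig_aff D" shows "\<exists>w\<in>Waff D. coset_act D w = refl_map D a"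
proof -
  have "foldr (\<circ>) [refl_map D a] id \<in> coset_act D ` Waff D"
    unfolding Waff_image using assms by (intro CollectI exI[of _ "[refl_map D a]"]) auto
  then show ?thesis by auto
qed

lemma refl_in_maps: "a \<in> Sig_aff D \<Longrightarrow> refl_map D a \<in> apt_maps"
  using refl_in_Waff[of a] act_in_maps Waff_closed by metis

text \<open>\<open>coroot D\<close> is not assumed to be equivariant. The conjugate is a reflection
  in the hyperplane of a \<circ> g along the transported coroot, and uniqueness identifies
  it.\<close>

lemma refl_conj:
  assumes "g \<in> apt_maps" "h \<in> apt_maps" "g \<circ> h = id" "h \<circ> g = id" "a \<in> Sig_aff D"
  shows "h \<circ> refl_map D a \<circ> g = refl_map D (a \<circ> g)"
proof -
  define c where "c = h (coroot D (grad a)) - h 0"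
  let ?r = "h \<circ> refl_map D a \<circ> g"
  have ag: "a \<circ> g \<in> Sig_aff D" by (rule maps_Sig_aff[OF assms(1,5)])
  have hg: "h (g v) = v" "g (h v) = v" for v using assms(3,4) by (auto simp: fun_eq_iff)
  have r: "?r v = v - (a \<circ> g) v *\<^sub>R c" for v
  proof -
    have l: "linear (\<lambda>v. h v - h 0)" by (rule maps_lin[OF assms(2)])
    show ?thesis
      using linear_diff[OF l, of "g v" "a (g v) *\<^sub>R coroot D (grad a)"]
        linear_scale[OF l, of "a (g v)" "coroot D (grad a)"]
      by (simp add: refl_map_alt c_def hg)
  qed
  have "(a \<circ> g) (?r v) = - (a \<circ> g) v" for v
    using root_refl[OF assms(5), of "g v"] by (simp add: hg)
  then have "(a \<circ> g) v * grad (a \<circ> g) c = 2 * (a \<circ> g) v" for v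
    using Sig_aff_line_minus[OF ag, of v "(a \<circ> g) v" c] unfolding r by simp
  \<comment> \<open>The relation just proved carries the factor (a \<circ> g) v, which must be
    nonzero somewhere to be cancelled.\<close>
  moreover have "\<exists>v. (a \<circ> g) v \<noteq> 0"
  proof (rule ccontr)
    assume "\<not> ?thesis"
    then have "grad (a \<circ> g) (coroot D (grad (a \<circ> g))) = 0" by (simp add: grad_def)
    then show False using grad_coroot[OF ag] by simp
  qed
  ultimately have "grad (a \<circ> g) c = 2" by auto
  then show ?thesis
    using refl_unique[of ?r "refl_map D (a \<circ> g)" "a \<circ> g", OF _ _ ag r refl_map_alt]
      assms grad_coroot[OF ag] ag by (simp add: maps_comp refl_in_maps)
qed

lemma refl_minus: assumes "a \<in> Sig_aff D" shows "refl_map D (\<lambda>v. - a v) = refl_map D a"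
  using refl_conj[OF refl_in_maps[OF assms] refl_in_maps[OF assms] refl_comp_refl[OF assms]
      refl_comp_refl[OF assms] assms]
  by (simp add: root_comp_refl[OF assms] refl_comp_refl[OF assms])

section \<open>Simple affine reflections\<close>

lemma simple_pos: "a \<in> simple_aff D \<Longrightarrow> a \<in> Sig_aff_pos D"
  by (simp add: simple_aff_def)

lemma simple_Sig_aff: "a \<in> simple_aff D \<Longrightarrow> a \<in> Sig_aff D"
  by (simp add: simple_pos pos_subset)

text \<open>The point v from the definition of \<open>simple_aff\<close> lies on the wall of a, so
  the reflection fixes it, and every positive root except a is strictly positive there. Hence b
  composed with the reflection is positive at v and cannot be a negative root.\<close>

lemma simple_refl_pos:
  assumes "a \<in> simple_aff D" "b \<in> Sig_aff_pos D" "b \<noteq> a"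
  shows "b \<circ> refl_map D a \<in> Sig_aff_pos D"
proof (rule ccontr)
  assume n: "b \<circ> refl_map D a \<notin> Sig_aff_pos D"
  obtain v where v: "a v = 0" "\<forall>b\<in>Sig_aff_pos D. b \<noteq> a \<longrightarrow> b v > 0"
    using assms(1) by (auto simp: simple_aff_def)
  have "b \<circ> refl_map D a \<in> Sig_aff D"
    using assms by (intro maps_Sig_aff refl_in_maps simple_Sig_aff pos_subset)
  then have m: "(\<lambda>v. - (b \<circ> refl_map D a) v) \<in> Sig_aff_pos D"
    using n pos_or_neg Sig_aff_neg_iff by blast
  have "- (b \<circ> refl_map D a) v = - b v" using v(1) by (simp add: refl_map_alt)
  then have "- (b \<circ> refl_map D a) v < 0" using v(2) assms by auto
  moreover have "- (b \<circ> refl_map D a) v \<ge> 0"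
    using bspec[OF v(2) m] v(1) by (cases "(\<lambda>v. - (b \<circ> refl_map D a) v) = a") (auto dest: fun_cong[of _ _ v])
  ultimately show False by simp
qed

text \<open>The simple reflection permutes the positive roots other than a, so reflecting p
  transports the separating hyperplanes and only the wall of a is lost.\<close>

lemma neg_at_refl:
  assumes "a \<in> simple_aff D" "a p < 0"
  shows "neg_at p = insert a ((\<lambda>b. b \<circ> refl_map D a) ` neg_at (refl_map D a p))"
    and "a \<notin> (\<lambda>b. b \<circ> refl_map D a) ` neg_at (refl_map D a p)"
proof -
  let ?r = "refl_map D a"
  have aS: "a \<in> Sig_aff D" "a \<in> Sig_aff_pos D" using assms(1) simple_pos pos_subset by auto
  have na: "a \<notin> neg_at (?r p)" using assms(2) by (simp add: neg_at_def root_refl[OF aS(1)])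
  have rr: "b \<circ> ?r \<circ> ?r = b" for b :: "'v \<Rightarrow> real"
    by (simp add: comp_assoc refl_comp_refl[OF aS(1)])
  have im: "b \<circ> ?r \<in> neg_at p" if "b \<in> neg_at (?r p)" for b
    using that na simple_refl_pos[OF assms(1), of b] by (auto simp: neg_at_def)
  show "neg_at p = insert a ((\<lambda>b. b \<circ> ?r) ` neg_at (?r p))"
  proof (intro equalityI subsetI)
    fix b assume b: "b \<in> neg_at p"
    show "b \<in> insert a ((\<lambda>b. b \<circ> ?r) ` neg_at (?r p))"
    proof (cases "b = a")
      case False
      then have "b \<circ> ?r \<in> neg_at (?r p)"
        using b simple_refl_pos[OF assms(1), of b] by (auto simp: neg_at_def refl_refl[OF aS(1)])
      then show ?thesis using rr by (metis imageI insertI2)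
    qed simp
  qed (use im assms(2) aS in \<open>auto simp: neg_at_def\<close>)
  show "a \<notin> (\<lambda>b. b \<circ> ?r) ` neg_at (?r p)"
  proof
    assume "a \<in> (\<lambda>b. b \<circ> ?r) ` neg_at (?r p)"
    then obtain b where b: "b \<in> neg_at (?r p)" "a = b \<circ> ?r" by auto
    then have "b = (\<lambda>v. - a v)" using rr[of b] root_comp_refl[OF aS(1)] by metis
    then have "b \<in> Sig_aff_neg D" using aS by (simp add: neg_minus)
    then show False using b not_pos_neg by (auto simp: neg_at_def)
  qed
qed

lemma comp_refl_inj: "a \<in> Sig_aff D \<Longrightarrow> inj_on (\<lambda>b. b \<circ> refl_map D a) A"
  by (rule inj_on_inverseI[of _ "\<lambda>b. b \<circ> refl_map D a"]) (simp add: comp_assoc refl_comp_refl)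

lemma card_neg_at_refl:
  assumes "a \<in> simple_aff D" "a p < 0"
  shows "card (neg_at p) = Suc (card (neg_at (refl_map D a p)))"
  using neg_at_refl[OF assms] finite_neg_at
  by (simp add: card_image comp_refl_inj simple_Sig_aff assms(1))

section \<open>Generation of the affine Weyl group by simple reflections\<close>

inductive_set simple_gen :: "('v \<Rightarrow> 'v) set" where
  one: "id \<in> simple_gen"
| step: "a \<in> simple_aff D \<Longrightarrow> g \<in> simple_gen \<Longrightarrow> refl_map D a \<circ> g \<in> simple_gen"

lemma simple_gen_comp: "g \<in> simple_gen \<Longrightarrow> h \<in> simple_gen \<Longrightarrow> g \<circ> h \<in> simple_gen"
  by (induction rule: simple_gen.induct) (auto simp: comp_assoc intro: simple_gen.intros)

lemma simple_gen_maps: "g \<in> simple_gen \<Longrightarrow> g \<in> apt_maps"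
proof (induction rule: simple_gen.induct)
  case (step a g)
  show ?case by (rule maps_comp[OF refl_in_maps[OF simple_Sig_aff[OF step(1)]] step(3)])
qed (rule maps_id)

lemma simple_gen_refl: "a \<in> simple_aff D \<Longrightarrow> refl_map D a \<in> simple_gen"
  using simple_gen.step[OF _ simple_gen.one] by simp

lemma simple_gen_inv: "g \<in> simple_gen \<Longrightarrow> \<exists>h\<in>simple_gen. g \<circ> h = id \<and> h \<circ> g = id"
proof (induction rule: simple_gen.induct)
  case (step a g)
  from step.IH obtain h where h: "h \<in> simple_gen" "g \<circ> h = id" "h \<circ> g = id" by blast
  have r: "refl_map D a \<circ> refl_map D a = id" using step by (simp add: refl_comp_refl simple_Sig_aff)
  have "refl_map D a \<circ> g \<circ> (h \<circ> refl_map D a) = refl_map D a \<circ> (g \<circ> h) \<circ> refl_map D a"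
    "h \<circ> refl_map D a \<circ> (refl_map D a \<circ> g) = h \<circ> (refl_map D a \<circ> refl_map D a) \<circ> g"
    by (simp_all only: comp_assoc)
  moreover have "h \<circ> refl_map D a \<in> simple_gen"
    by (intro simple_gen_comp simple_gen_refl h(1) step(1))
  ultimately show ?case using h(2,3) r by (metis comp_id)
next
  case one
  show ?case by (rule bexI[OF _ simple_gen.one]) simp
qed

lemma regular_map: "regular p \<Longrightarrow> g \<in> apt_maps \<Longrightarrow> regular (g p)"
  using maps_Sig_aff[of g] unfolding regular_def by (metis comp_apply)

text \<open>Each reflection in a simple wall separating p from the alcove lowers the number of
  separating hyperplanes by one.\<close>

lemma simple_gen_move: "regular p \<Longrightarrow> \<exists>g\<in>simple_gen. g p \<in> alcove"
proof (induction "card (neg_at p)" arbitrary: p rule: less_induct)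
  case less
  show ?case
  proof (cases "neg_at p = {}")
    case True
    then have "p \<in> alcove" using less.prems pos_subset
      unfolding alcove_def neg_at_def regular_def by (force simp: not_less order.order_iff_strict)
    then show ?thesis by (intro bexI[OF _ simple_gen.one]) simp
  next
    case False
    then obtain a where a: "a \<in> simple_aff D" "a p < 0" using simple_neg_at less.prems by blast
    have "regular (refl_map D a p)"
      by (rule regular_map[OF less.prems refl_in_maps[OF simple_Sig_aff[OF a(1)]]])
    then obtain g where "g \<in> simple_gen" "g (refl_map D a p) \<in> alcove"
      using less.hyps[of "refl_map D a p"] card_neg_at_refl[OF a] by auto
    then show ?thesis using simple_gen_comp[OF _ simple_gen_refl[OF a(1)]]
      by (intro bexI[of _ "g \<circ> refl_map D a"]) simp_all
  qed
qed

lemma choices_conds: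
  "\<forall>a\<in>Sig_aff D. \<exists>v. a v = 0 \<and> (\<forall>b\<in>Sig_aff D. b v = 0 \<longrightarrow> b = a \<or> b = (\<lambda>u. - a u)) \<and> facet_of D a = facet D v"
  "\<forall>a\<in>simple_aff D. proj D (n_lift D (s_refl D a)) = s_refl D a \<and>
     n_lift D (s_refl D a) \<in> cls1 D ` (N_F D \<inter> UU_gen D (facet_of D a))"
  using oks(7) unfolding choices_ok_def by - (elim conjE, assumption)+

lemmas facet_of_point = choices_conds(1)[rule_format]

text \<open>The chosen point v lies on no hyperplane but that of a. A product w of simple
  reflections takes a regular point next to v into the alcove; then w v lies on a wall of the
  alcove, the reflection in it is simple, and conjugating back gives the reflection in a.\<close>

lemma refl_in_simple_gen: assumes a: "a \<in> Sig_aff D" shows "refl_map D a \<in> simple_gen"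
proof -
  obtain v where v: "a v = 0" "\<And>b. b \<in> Sig_aff D \<Longrightarrow> b v = 0 \<Longrightarrow> b = a \<or> b = (\<lambda>u. - a u)"
    using facet_of_point[OF a] by blast
  obtain c where c: "c \<in> alcove" using alcove_point by (auto simp: alcove_def)
  have "\<forall>\<^sub>F t in at_right (0::real). t > 0 \<and> (\<forall>b\<in>Sig_aff D. b v > 0 \<longrightarrow> b (v + t *\<^sub>R (c - v)) > 0)"
    by (intro eventually_conj Sig_aff_eventually_sgn eventually_at_right_less)
  then obtain t where t: "t > 0" "\<And>b. b \<in> Sig_aff D \<Longrightarrow> b v > 0 \<Longrightarrow> b (v + t *\<^sub>R (c - v)) > 0"
    using eventually_happens' trivial_limit_at_right_real by blast
  \<comment> \<open>A small move from v towards the alcove keeps the sign of every affine root that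
    is nonzero at v and leaves the wall of a.\<close>
  define p where "p = v + t *\<^sub>R (c - v)"
  have tp: "b p > 0" if "b \<in> Sig_aff D" "b v > 0" for b using t(2) that by (simp add: p_def)
  have tn: "b p < 0" if "b \<in> Sig_aff D" "b v < 0" for b
    using tp[OF Sig_aff_minus[OF that(1)]] that(2) by simp
  have "a c \<noteq> 0" using alcove_pos_iff[OF c a] alcove_neg_iff[OF c a] pos_or_neg[OF a] by auto
  then have ap: "a p \<noteq> 0"
    using affine_fun_line[OF Sig_aff_affine[OF a], of v t c] v(1) t(1) by (simp add: p_def)
  have "b p \<noteq> 0" if b: "b \<in> Sig_aff D" for b
    using v(2)[OF b] tp[OF b] tn[OF b] ap by (cases "b v" "0::real" rule: linorder_cases) auto
  then have "regular p" by (simp add: regular_def)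
  then obtain w where w: "w \<in> simple_gen" "w p \<in> alcove" using simple_gen_move by blast
  obtain h where h: "h \<in> simple_gen" "w \<circ> h = id" "h \<circ> w = id" using simple_gen_inv[OF w(1)] by blast
  have hw: "h (w u) = u" "w (h u) = u" for u using h by (auto simp: fun_eq_iff)
  have wm: "w \<in> apt_maps" "h \<in> apt_maps" using w h simple_gen_maps by auto
  have ah: "a \<circ> h \<in> Sig_aff D" by (rule maps_Sig_aff[OF wm(2) a])
  \<comment> \<open>Simple roots are positive by definition, so the sign of the transported root is
    adjusted; the reflection is the same for both signs.\<close>
  obtain b where b: "b \<in> Sig_aff_pos D" "b = a \<circ> h \<or> b = (\<lambda>u. - (a \<circ> h) u)"
    using pos_or_neg[OF ah] by (auto simp: Sig_aff_neg_iff)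
  have "b' (w v) > 0" if b': "b' \<in> Sig_aff_pos D" "b' \<noteq> b" for b'
  proof -
    have s: "b' \<circ> w \<in> Sig_aff D" using maps_Sig_aff wm pos_subset b' by blast
    have "(b' \<circ> w) v \<noteq> 0"
    proof
      assume "(b' \<circ> w) v = 0"
      then have "b' \<circ> w = a \<or> b' \<circ> w = (\<lambda>u. - a u)" using v(2)[OF s] by blast
      moreover have "b' = (b' \<circ> w) \<circ> h" by (simp add: comp_assoc h)
      ultimately have "b' = a \<circ> h \<or> b' = (\<lambda>u. - (a \<circ> h) u)" by auto
      then have "b' = (\<lambda>u. - b u)" using b(2) b'(2) by auto
      then show False using b b'(1) not_pos_neg[of b'] by (simp add: neg_minus)
    qed
    moreover have "(b' \<circ> w) p > 0" using w(2) b'(1) by (auto simp: alcove_def)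
    ultimately show ?thesis using tn[OF s] by (cases "(b' \<circ> w) v" "0::real" rule: linorder_cases) auto
  qed
  moreover have "b (w v) = 0" using b(2) v(1) by (auto simp: hw)
  ultimately have "b \<in> simple_aff D" using b(1) by (auto simp: simple_aff_def)
  then have "h \<circ> refl_map D b \<circ> w \<in> simple_gen" using h w by (intro simple_gen_comp simple_gen_refl)
  moreover have "h \<circ> refl_map D b \<circ> w = refl_map D (b \<circ> w)"
    using refl_conj[OF wm h(2,3)] b pos_subset by blast
  moreover have "b \<circ> w = a \<or> b \<circ> w = (\<lambda>u. - a u)" using b(2) by (auto simp: fun_eq_iff hw)
  ultimately show ?thesis using refl_minus[OF a] by auto
qed

lemma Waff_simple_gen: assumes "w \<in> Waff D" shows "coset_act D w \<in> simple_gen"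
proof -
  obtain rs where rs: "coset_act D w = foldr (\<circ>) rs id" "set rs \<subseteq> refl_map D ` Sig_aff D"
    using assms Waff_image by blast
  from rs(2) have "foldr (\<circ>) rs id \<in> simple_gen"
    by (induction rs) (auto intro: simple_gen.one simple_gen_comp refl_in_simple_gen)
  then show ?thesis using rs by simp
qed

definition refl_word :: "('v \<Rightarrow> real) list \<Rightarrow> 'v \<Rightarrow> 'v" where
  "refl_word as = foldr (\<lambda>a g. refl_map D a \<circ> g) as id"

lemma refl_word_simps [simp]: "refl_word [] = id" "refl_word (a # as) = refl_map D a \<circ> refl_word as"
  by (simp_all add: refl_word_def)

lemma simple_gen_word: "g \<in> simple_gen \<Longrightarrow> \<exists>as. set as \<subseteq> simple_aff D \<and> g = refl_word as"
proof (induction rule: simple_gen.induct)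
  case one show ?case by (intro exI[of _ "[]"]) simp
next
  case (step a g)
  then obtain as where "set as \<subseteq> simple_aff D" "g = refl_word as" by auto
  then show ?case using step by (intro exI[of _ "a # as"]) simp
qed

text \<open>The root is followed through the word. As it ends up negative, at some letter it equals
  that simple root, and deleting this letter has the effect of multiplying by the reflection in
  a.\<close>

lemma exchange:
  assumes "set as \<subseteq> simple_aff D" "a \<in> Sig_aff_pos D" "a \<circ> refl_word as \<in> Sig_aff_neg D"
  shows "\<exists>as'. set as' \<subseteq> simple_aff D \<and> length as' < length as \<and> refl_map D a \<circ> refl_word as = refl_word as'"
  using assms
proof (induction as arbitrary: a)
  case Nil then show ?case using not_pos_neg by auto
next
  case (Cons b as)
  have b: "b \<in> simple_aff D" "b \<in> Sig_aff D" using Cons.prems by (auto simp: simple_Sig_aff)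
  have bb: "refl_map D b \<circ> (refl_map D b \<circ> g) = g" for g
    by (simp add: comp_assoc[symmetric] refl_comp_refl b)
  show ?case
  proof (cases "a = b")
    case True
    then show ?thesis using Cons.prems(1) bb[of "refl_word as"] by (intro exI[of _ as]) (simp del: o_apply)
  next
    case False
    let ?a = "a \<circ> refl_map D b"
    have p: "?a \<in> Sig_aff_pos D" using simple_refl_pos b Cons.prems False by blast
    have n: "?a \<circ> refl_word as \<in> Sig_aff_neg D"
      using Cons.prems(3) by (simp only: refl_word_simps comp_assoc)
    have s: "set as \<subseteq> simple_aff D" using Cons.prems(1) by simp
    then obtain as' where as': "set as' \<subseteq> simple_aff D" "length as' < length as"
        "refl_map D ?a \<circ> refl_word as = refl_word as'"
      using Cons.IH[OF s p n] by blast
    have "refl_map D ?a = refl_map D b \<circ> refl_map D a \<circ> refl_map D b"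
      using refl_conj[of "refl_map D b" "refl_map D b" a] b Cons.prems
      by (simp add: refl_in_maps refl_comp_refl pos_subset)
    then have "refl_map D b \<circ> refl_word as' = refl_map D a \<circ> (refl_map D b \<circ> refl_word as)"
      using as'(3) bb[of "refl_map D a \<circ> (refl_map D b \<circ> refl_word as)"] by (simp only: comp_assoc)
    then show ?thesis using as'(1,2) b(1)
      by (intro exI[of _ "b # as'"] conjI) (simp_all only: refl_word_simps list.set insert_subset length_Cons Suc_less_eq simp_thms)
  qed
qed

text \<open>In a shortest word for g with first letter b, positivity of b \<circ> g makes b negative
  after the remaining letters, and the exchange property would shorten the word.\<close>

lemma simple_gen_pos_id:
  assumes "g \<in> simple_gen" "\<And>a. a \<in> Sig_aff_pos D \<Longrightarrow> a \<circ> g \<in> Sig_aff_pos D"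
  shows "g = id"
proof -
  define Q where "Q as \<longleftrightarrow> set as \<subseteq> simple_aff D \<and> g = refl_word as" for as
  have "\<exists>as. Q as" using simple_gen_word[OF assms(1)] by (simp add: Q_def)
  then obtain as where as: "Q as" "\<And>bs. Q bs \<Longrightarrow> length as \<le> length bs"
    using exists_least_iff[of "\<lambda>n. \<exists>as. Q as \<and> length as = n"] by (metis not_less)
  show ?thesis
  proof (cases as)
    case (Cons b bs)
    have b: "b \<in> simple_aff D" "set bs \<subseteq> simple_aff D" "g = refl_map D b \<circ> refl_word bs"
      using as(1) Cons by (auto simp: Q_def)
    have "b \<circ> g = (\<lambda>v. - (b \<circ> refl_word bs) v)"
      using b root_refl[OF simple_Sig_aff[OF b(1)]] by (simp add: fun_eq_iff)
    then have "b \<circ> refl_word bs \<in> Sig_aff_neg D"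
      using assms(2)[OF simple_pos[OF b(1)]] by (simp add: Sig_aff_neg_iff)
    then obtain cs where cs: "set cs \<subseteq> simple_aff D" "length cs < length bs" "g = refl_word cs"
      using exchange[OF b(2) simple_pos[OF b(1)]] b(3) by auto
    then show ?thesis using as(2)[of cs] Cons by (simp add: Q_def)
  qed (use as in \<open>simp add: Q_def\<close>)
qed

end

section \<open>Length and reduced expressions\<close>

lemma inv_GL_on:
  assumes "group (GL_on P)" "z \<in> P" "invertible (z :: 'a::field^'n^'n)"
  shows "inv\<^bsub>GL_on P\<^esub> z = matrix_inv z"
proof -
  have "inv\<^bsub>GL_on P\<^esub> z ** z = mat 1" using group.l_inv[OF assms(1), of z] assms(2) by simp
  then have "inv\<^bsub>GL_on P\<^esub> z ** (z ** matrix_inv z) = matrix_inv z"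
    by (simp add: matrix_mul_assoc)
  then show ?thesis by (simp add: matrix_inv_right_left assms(3))
qed

lemma prod_W_simps [simp]: "prod_W M [] = \<one>\<^bsub>M\<^esub>" "prod_W M (s # ss) = s \<otimes>\<^bsub>M\<^esub> prod_W M ss"
  by (simp_all add: prod_W_def)

lemma (in group) prod_W_closed: "set ss \<subseteq> carrier G \<Longrightarrow> prod_W G ss \<in> carrier G"
  by (induction ss) auto

context grp_data
begin

text \<open>Composition with g is the action of the inverse of g on affine roots;
  \<open>len_inv_roots\<close> identifies the size of this set with the length.\<close>

definition inv_roots :: "('v \<Rightarrow> 'v) \<Rightarrow> ('v \<Rightarrow> real) set" where
  "inv_roots g = {a \<in> Sig_aff_pos D. a \<circ> g \<in> Sig_aff_neg D}"

text \<open>Testing signs at a point c of the alcove turns inversions of g into hyperplanes between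
  the alcove and its image, so that the results on points apply to maps.\<close>

lemma inv_roots_neg_at: "g \<in> apt_maps \<Longrightarrow> c \<in> alcove \<Longrightarrow> inv_roots g = neg_at (g c)"
  unfolding inv_roots_def neg_at_def
  using alcove_neg_iff[of c] maps_Sig_aff[of g] pos_subset by (metis comp_apply)

lemma finite_inv_roots: assumes "g \<in> apt_maps" shows "finite (inv_roots g)"
proof -
  obtain c where "c \<in> alcove" using alcove_point by (auto simp: alcove_def)
  then show ?thesis by (simp add: inv_roots_neg_at[OF assms] finite_neg_at)
qed

lemma len_inv_roots: assumes "coset_act D w \<in> apt_maps" shows "len D w = card (inv_roots (coset_act D w))"
proof -
  let ?g = "coset_act D w"
  have b: "bij ?g" by (rule maps_bij[OF assms])
  have "a \<in> (\<lambda>a. a \<circ> inv_into UNIV ?g) ` Sig_aff_neg D \<longleftrightarrow> a \<circ> ?g \<in> Sig_aff_neg D" for a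
  proof
    assume "a \<in> (\<lambda>a. a \<circ> inv_into UNIV ?g) ` Sig_aff_neg D"
    then obtain b where b': "b \<in> Sig_aff_neg D" "a = b \<circ> inv_into UNIV ?g" by blast
    have "a \<circ> ?g = b" using b b' by (simp add: comp_assoc inj_iff[THEN iffD1] bij_is_inj)
    then show "a \<circ> ?g \<in> Sig_aff_neg D" using b' by simp
  next
    assume n: "a \<circ> ?g \<in> Sig_aff_neg D"
    have "a = (a \<circ> ?g) \<circ> inv_into UNIV ?g"
      using b by (simp add: comp_assoc surj_iff[THEN iffD1] bij_is_surj)
    then show "a \<in> (\<lambda>a. a \<circ> inv_into UNIV ?g) ` Sig_aff_neg D" using n by (rule image_eqI)
  qed
  then have "Sig_aff_pos D \<inter> (\<lambda>a. a \<circ> inv_into UNIV ?g) ` Sig_aff_neg D = inv_roots ?g"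
    unfolding inv_roots_def by blast
  then show ?thesis by (simp add: len_def)
qed

lemma alcove_regular: "c \<in> alcove \<Longrightarrow> regular c"
  unfolding regular_def using alcove_pos_iff alcove_neg_iff pos_or_neg by fastforce

lemma inv_roots_simple:
  assumes "g \<in> apt_maps" "inv_roots g \<noteq> {}"
  shows "\<exists>a\<in>simple_aff D. a \<circ> g \<in> Sig_aff_neg D"
proof -
  obtain c where c: "c \<in> alcove" using alcove_point by (auto simp: alcove_def)
  obtain a where a: "a \<in> simple_aff D" "a (g c) < 0"
    using simple_neg_at[OF regular_map[OF alcove_regular[OF c] assms(1)]] assms c inv_roots_neg_at by auto
  then have "a \<circ> g \<in> Sig_aff_neg D"
    using alcove_neg_iff[OF c maps_Sig_aff[OF assms(1) simple_Sig_aff[OF a(1)]]] by simp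
  then show ?thesis using a by blast
qed

lemma inv_roots_step:
  assumes "g \<in> apt_maps" "a \<in> simple_aff D" "a \<circ> g \<in> Sig_aff_neg D"
  shows "inv_roots g = insert a ((\<lambda>b. b \<circ> refl_map D a) ` inv_roots (refl_map D a \<circ> g))"
    and "a \<notin> (\<lambda>b. b \<circ> refl_map D a) ` inv_roots (refl_map D a \<circ> g)"
    and "card (inv_roots g) = Suc (card (inv_roots (refl_map D a \<circ> g)))"
proof -
  obtain c where c: "c \<in> alcove" using alcove_point by (auto simp: alcove_def)
  have n: "a (g c) < 0"
    using alcove_neg_iff[OF c maps_Sig_aff[OF assms(1) simple_Sig_aff[OF assms(2)]]] assms(3) by simp
  have e: "inv_roots g = neg_at (g c)" "inv_roots (refl_map D a \<circ> g) = neg_at (refl_map D a (g c))"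
    using inv_roots_neg_at[OF assms(1) c]
      inv_roots_neg_at[OF maps_comp[OF refl_in_maps[OF simple_Sig_aff[OF assms(2)]] assms(1)] c] by simp_all
  show "inv_roots g = insert a ((\<lambda>b. b \<circ> refl_map D a) ` inv_roots (refl_map D a \<circ> g))"
    "a \<notin> (\<lambda>b. b \<circ> refl_map D a) ` inv_roots (refl_map D a \<circ> g)"
    "card (inv_roots g) = Suc (card (inv_roots (refl_map D a \<circ> g)))"
    unfolding e using neg_at_refl[OF assms(2) n] card_neg_at_refl[OF assms(2) n] by auto
qed

lemma sum_inv_roots_step:
  fixes f :: "('v \<Rightarrow> real) \<Rightarrow> 'b::comm_monoid_add"
  assumes "g \<in> apt_maps" "a \<in> simple_aff D" "a \<circ> g \<in> Sig_aff_neg D"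
    and f: "\<And>b. b \<in> Sig_aff D \<Longrightarrow> f (b \<circ> refl_map D a) = f b"
  shows "sum f (inv_roots g) = f a + sum f (inv_roots (refl_map D a \<circ> g))"
proof -
  have m: "refl_map D a \<circ> g \<in> apt_maps" by (rule maps_comp[OF refl_in_maps[OF simple_Sig_aff[OF assms(2)]] assms(1)])
  have "sum f ((\<lambda>b. b \<circ> refl_map D a) ` inv_roots (refl_map D a \<circ> g)) = sum f (inv_roots (refl_map D a \<circ> g))"
    by (subst sum.reindex[OF comp_refl_inj[OF simple_Sig_aff[OF assms(2)]]])
      (rule sum.cong, auto simp: inv_roots_def f pos_subset)
  then show ?thesis
    using inv_roots_step(1,2)[OF assms(1-3)] finite_inv_roots[OF m] by simp
qed

text \<open>Minimal galleries from the alcove to its g-image and on to its gh-image cross the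
  hyperplanes of Q twice and those of \<open>inv_roots (g \<circ> h)\<close> once. The weight f will
  be 1, which gives lengths, or the class of a reflection, which gives exponents of q.\<close>

lemma inv_roots_cocycle:
  fixes f :: "('v \<Rightarrow> real) \<Rightarrow> 'b::comm_monoid_add"
  assumes g: "g \<in> apt_maps" and h: "h \<in> apt_maps"
    and fg: "\<And>a. a \<in> Sig_aff D \<Longrightarrow> f (a \<circ> g) = f a"
    and fm: "\<And>a. a \<in> Sig_aff D \<Longrightarrow> f (\<lambda>v. - a v) = f a"
    and Q: "Q = {b \<in> Sig_aff_pos D. b \<circ> g \<in> Sig_aff_neg D \<and> b \<circ> g \<circ> h \<in> Sig_aff_pos D}"
  shows "sum f (inv_roots g) + sum f (inv_roots h) = sum f (inv_roots (g \<circ> h)) + (sum f Q + sum f Q)"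
proof -
  \<comment> \<open>P is \<open>inv_roots h\<close> carried back by g. Its positive part P1 and the
    set R make up the inversions of g \<circ> h; its negative part P2 is Q up to sign.\<close>
  define P where "P = {b \<in> Sig_aff D. b \<circ> g \<in> Sig_aff_pos D \<and> b \<circ> g \<circ> h \<in> Sig_aff_neg D}"
  define R where "R = {b \<in> Sig_aff_pos D. b \<circ> g \<in> Sig_aff_neg D \<and> b \<circ> g \<circ> h \<in> Sig_aff_neg D}"
  define P1 where "P1 = {b \<in> Sig_aff_pos D. b \<circ> g \<in> Sig_aff_pos D \<and> b \<circ> g \<circ> h \<in> Sig_aff_neg D}"
  define P2 where "P2 = {b \<in> Sig_aff_neg D. b \<circ> g \<in> Sig_aff_pos D \<and> b \<circ> g \<circ> h \<in> Sig_aff_neg D}"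
  obtain g' where g': "g' \<in> apt_maps" "g \<circ> g' = id" "g' \<circ> g = id" using maps_inv[OF g] by blast
  have gh: "g \<circ> h \<in> apt_maps" by (rule maps_comp[OF g h])
  have cg: "b \<circ> g \<in> Sig_aff D" "b \<circ> g \<circ> h \<in> Sig_aff D" if "b \<in> Sig_aff D" for b
    using that g h maps_Sig_aff by blast+
  have can: "b \<circ> g \<circ> g' = b" "b \<circ> g' \<circ> g = b" for b :: "'v \<Rightarrow> real"
    by (simp_all only: comp_assoc g' comp_id)
  have bij: "bij_betw (\<lambda>b. b \<circ> g) P (inv_roots h)"
  proof (rule bij_betw_byWitness[where f' = "\<lambda>b. b \<circ> g'"])
    show "(\<lambda>b. b \<circ> g') ` inv_roots h \<subseteq> P"
      unfolding P_def inv_roots_def using can maps_Sig_aff[OF g'(1)] pos_subset by auto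
  qed (use can in \<open>auto simp: P_def inv_roots_def\<close>)
  have "sum f (inv_roots h) = sum (\<lambda>b. f (b \<circ> g)) P"
    using sum.reindex_bij_betw[OF bij, of f] by simp
  also have "\<dots> = sum f P" by (rule sum.cong) (auto simp: P_def fg)
  finally have h1: "sum f (inv_roots h) = sum f P" .
  have "finite P" using bij_betw_finite[OF bij] finite_inv_roots[OF h] by simp
  moreover have "P = P1 \<union> P2" "P1 \<inter> P2 = {}"
    unfolding P_def P1_def P2_def using pos_or_neg pos_subset neg_subset not_pos_neg by blast+
  ultimately have fin: "finite P1" "finite P2" and h2: "sum f P = sum f P1 + sum f P2"
    by (simp_all add: sum.union_disjoint)
  have mm: "(\<lambda>v. - (\<lambda>v. - b v) v) = b" for b :: "'v \<Rightarrow> real" by simp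
  have comp_m: "(\<lambda>v. - b v) \<circ> k = (\<lambda>v. - (b \<circ> k) v)" for b :: "'v \<Rightarrow> real" and k by auto
  have "(\<lambda>v. - b v) \<in> P2" if "b \<in> Q" for b
    using that by (simp only: Q P2_def mem_Collect_eq comp_m neg_minus Sig_aff_neg_iff[symmetric])
  moreover have "(\<lambda>v. - b v) \<in> Q" if "b \<in> P2" for b
    using that by (simp only: Q P2_def mem_Collect_eq comp_m neg_minus Sig_aff_neg_iff[symmetric])
  ultimately have "bij_betw (\<lambda>b v. - b v) Q P2"
    by (intro bij_betw_byWitness[where f' = "\<lambda>b v. - b v"]) auto
  from sum.reindex_bij_betw[OF this, of f] have "sum f P2 = sum (\<lambda>b. f (\<lambda>v. - b v)) Q" by simp
  also have "\<dots> = sum f Q" by (rule sum.cong) (auto simp: Q fm pos_subset)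
  finally have h3: "sum f P2 = sum f Q" .
  have "inv_roots g = R \<union> Q" "R \<inter> Q = {}"
    unfolding inv_roots_def R_def Q using pos_or_neg pos_subset not_pos_neg cg by blast+
  moreover have "inv_roots (g \<circ> h) = R \<union> P1" "R \<inter> P1 = {}"
    unfolding inv_roots_def R_def P1_def comp_assoc[symmetric]
    using pos_or_neg pos_subset not_pos_neg cg by blast+
  moreover have "finite (inv_roots g)" "finite (inv_roots (g \<circ> h))"
    using finite_inv_roots g gh by auto
  ultimately have "sum f (inv_roots g) = sum f R + sum f Q" "sum f (inv_roots (g \<circ> h)) = sum f R + sum f P1"
    by (simp_all add: sum.union_disjoint)
  then show ?thesis using h1 h2 h3 by (simp add: ac_simps)
qed

lemma s_refl: assumes "a \<in> Sig_aff D"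
  shows "s_refl D a \<in> Waff D" "coset_act D (s_refl D a) = refl_map D a"
proof -
  have "\<exists>!w. w \<in> Waff D \<and> coset_act D w = refl_map D a"
    using refl_in_Waff[OF assms] inj_onD[OF Waff_inj] by metis
  from theI'[OF this] show "s_refl D a \<in> Waff D" "coset_act D (s_refl D a) = refl_map D a"
    by (simp_all add: s_refl_def)
qed

lemma s_refl_eq: "a \<in> Sig_aff D \<Longrightarrow> w \<in> Waff D \<Longrightarrow> coset_act D w = refl_map D a \<Longrightarrow> s_refl D a = w"
  using s_refl[of a] inj_onD[OF Waff_inj] by metis

lemma s_refl_Wt: "a \<in> Sig_aff D \<Longrightarrow> s_refl D a \<in> carrier (Wt D)"
  using s_refl Waff_closed by blast

section \<open>Normality of the affine Weyl group in W~\<close>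

lemma uni_alg: "alg_group (uni D)" "alg_group (uni_op D)"
    "normal (uni D) (GL_on (par D))" "normal (uni_op D) (GL_on (par_op D))"
  using reductive_conds(2,4) by (auto simp: unipotent_radical_def conn_normal_unipotent_def)

lemma U_gen_GL: "U_F D \<union> Uop_F D \<subseteq> carrier GL"
  using subgroup.subset[of "uni D" GL] subgroup.subset[of "uni_op D" GL] uni_alg(1,2)
  unfolding U_F_def Uop_F_def rat_points_def alg_group_def by blast

lemma gen_inv: "g \<in> generate GL (U_F D \<union> Uop_F D) \<Longrightarrow> matrix_inv g \<in> generate GL (U_F D \<union> Uop_F D)"
  using group.generate_m_inv_closed[OF group_GL U_gen_GL, of g]
    group.generate_incl[OF group_GL U_gen_GL] inv_GL[of g] by auto

lemma Waff_one: "\<one>\<^bsub>Wt D\<^esub> \<in> Waff D"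
  unfolding Waff_def cls_one
  using generate.one[of "GL :: ('k^'n^'n) monoid" "U_F D \<union> Uop_F D"] one_in_N by auto

lemma Waff_mult: "w \<in> Waff D \<Longrightarrow> w' \<in> Waff D \<Longrightarrow> w \<star> w' \<in> Waff D"
  unfolding Waff_def using generate.eng[of _ "GL :: ('k^'n^'n) monoid"] by (auto simp: cls_mult mult_in_N)

lemma Waff_inv: "w \<in> Waff D \<Longrightarrow> inv0 w \<in> Waff D"
  unfolding Waff_def using gen_inv by (auto simp: cls_inv inv_in_N)

lemma Z_F_cen: "z \<in> Z_F D \<Longrightarrow> z \<in> cen D" "z \<in> Z_F D \<Longrightarrow> z $ i $ j \<in> loc_field D"
  by (auto simp: Z_F_def rat_points_def)

lemma rat_mult:
  assumes "\<And>i j. (x :: 'k^'n^'n) $ i $ j \<in> loc_field D" "\<And>i j. (y :: 'k^'n^'n) $ i $ j \<in> loc_field D"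
  shows "(x ** y) $ i $ j \<in> loc_field D"
  using assms field_conds(1) by (auto simp: matrix_matrix_mult_def is_subfield_def intro!: is_subfield_sum)

lemma Z_F_inv: "z \<in> Z_F D \<Longrightarrow> matrix_inv z \<in> Z_F D"
  using subgroup.m_inv_closed[OF normal_imp_subgroup[OF normal_Z], of z] by (simp add: inv_GN Z_in_N)

lemma conj_unipotent_rational:
  assumes "normal V (GL_on P)" "alg_group V" "P = cen D <#>\<^bsub>GL\<^esub> V" "z \<in> Z_F D"
    "u \<in> rat_points (loc_field D) V"
  shows "z ** u ** matrix_inv z \<in> rat_points (loc_field D) V"
proof -
  have "mat 1 \<in> V" using assms(2) subgroup.one_closed[of V GL] by (simp add: alg_group_def)
  then have zP: "z \<in> P" unfolding assms(3) set_mult_def using Z_F_cen(1)[OF assms(4)] by force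
  have u: "u \<in> V" "\<And>i j. u $ i $ j \<in> loc_field D" using assms(5) by (auto simp: rat_points_def)
  have "group (GL_on P)" using assms(1) by (simp add: normal_def)
  then have "z ** u ** matrix_inv z \<in> V"
    using normal.inv_op_closed2[OF assms(1), of z u] zP u N_invertible[OF Z_in_N[OF assms(4)]]
    by (simp add: inv_GL_on)
  then show ?thesis
    using u Z_F_cen(2)[OF assms(4)] Z_F_cen(2)[OF Z_F_inv[OF assms(4)]]
    by (auto simp: rat_points_def intro!: rat_mult)
qed

lemma Z_normalizes_gen:
  assumes "z \<in> Z_F D" "g \<in> generate GL (U_F D \<union> Uop_F D)"
  shows "z ** g ** matrix_inv z \<in> generate GL (U_F D \<union> Uop_F D)"
proof -
  have zi: "invertible z" by (rule N_invertible[OF Z_in_N[OF assms(1)]])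
  have inc: "z ** h ** matrix_inv z \<in> U_F D \<union> Uop_F D" if "h \<in> U_F D \<union> Uop_F D" for h
    using that conj_unipotent_rational[OF uni_alg(3,1) reductive_conds(3) assms(1), of h]
      conj_unipotent_rational[OF uni_alg(4,2) reductive_conds(5) assms(1), of h]
    by (auto simp: U_F_def Uop_F_def)
  have cm: "z ** (x ** y) ** matrix_inv z = (z ** x ** matrix_inv z) ** (z ** y ** matrix_inv z)" for x y
  proof -
    have "(z ** x ** matrix_inv z) ** (z ** y ** matrix_inv z) = z ** x ** (matrix_inv z ** z) ** y ** matrix_inv z"
      by (simp only: matrix_mul_assoc)
    then show ?thesis by (simp add: matrix_inv_right_left zi matrix_mul_assoc)
  qed
  from assms(2) show ?thesis
  proof (induction rule: generate.induct)
    case one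
    then show ?case using generate.one[of "GL :: ('k^'n^'n) monoid"] by (simp add: matrix_inv_right_left zi)
  next
    case (incl h) then show ?case by (intro generate.incl inc)
  next
    case (inv h)
    have hi: "invertible h" using inv U_gen_GL by auto
    have "z ** matrix_inv h ** matrix_inv z = inv\<^bsub>GL\<^esub> (z ** h ** matrix_inv z)"
    proof (rule group.inv_equality[OF group_GL, symmetric])
      show "z ** matrix_inv h ** matrix_inv z \<otimes>\<^bsub>GL\<^esub> (z ** h ** matrix_inv z) = \<one>\<^bsub>GL\<^esub>"
        using cm[of "matrix_inv h" h] by (simp add: matrix_inv_right_left zi hi)
    qed (use zi hi in \<open>simp_all add: invertible_matrix_mult invertible_matrix_inv\<close>)
    then show ?case using inv inc[of h] generate.inv by (metis hi inv_GL)
  next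
    case (eng h1 h2)
    then show ?case using cm[of h1 h2] generate.eng[of _ "GL :: ('k^'n^'n) monoid"] by simp
  qed
qed

lemma Wsp_Waff: "w \<in> Wsp D \<Longrightarrow> w \<in> Waff D"
  by (simp add: Wsp_def)

lemma weyl_conds:
  "Wsp D <#>\<^bsub>Wt D\<^esub> Lam D = carrier (Wt D)" "Wsp D \<inter> Lam D = {\<one>\<^bsub>Wt D\<^esub>}"
  using oks(6) unfolding weyl_ok_def by - (elim conjE, assumption)+

text \<open>Write t as an element of W, which lies in the affine Weyl group, times the class of some
  z in Z(F); such a z normalizes the subgroup generated by U(F) and its opposite. This lets
  \<open>s_refl\<close> follow conjugation by all of W~.\<close>

lemma Waff_normal:
  assumes "t \<in> carrier (Wt D)" "w \<in> Waff D"
  shows "t \<star> w \<star> inv0 t \<in> Waff D"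
proof -
  obtain x l where xl: "x \<in> Wsp D" "l \<in> Lam D" "t = x \<star> l"
    using assms(1) unfolding weyl_conds(1)[symmetric] set_mult_def by blast
  obtain z where z: "z \<in> Z_F D" "l = cls D z" using xl(2) by (auto simp: Lam_def)
  obtain n where n: "n \<in> N_F D" "n \<in> generate GL (U_F D \<union> Uop_F D)" "w = cls D n"
    using assms(2) by (auto simp: Waff_def)
  have "l \<star> w \<star> inv0 l = cls D (z ** n ** matrix_inv z)"
    using z n by (simp add: cls_mult cls_inv Z_in_N inv_in_N mult_in_N)
  moreover have "z ** n ** matrix_inv z \<in> N_F D" using z n by (simp add: Z_in_N inv_in_N mult_in_N)
  ultimately have l: "l \<star> w \<star> inv0 l \<in> Waff D"
    using Z_normalizes_gen[OF z(1) n(2)] by (auto simp: Waff_def)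
  have c: "x \<in> carrier (Wt D)" "l \<in> carrier (Wt D)" "w \<in> carrier (Wt D)"
    using xl z assms Wsp_Waff Waff_closed Z_in_N by (auto simp: carrier_Wt)
  have "t \<star> w \<star> inv0 t =
      x \<star> (l \<star> w \<star> inv0 l) \<star> inv0 x"
    using c by (simp add: xl(3) Wt.inv_mult_group Wt.m_assoc)
  then show ?thesis using l xl(1) Wsp_Waff by (simp add: Waff_mult Waff_inv)
qed

lemma s_refl_conj:
  assumes "a \<in> Sig_aff D" "t \<in> carrier (Wt D)"
  shows "s_refl D (a \<circ> coset_act D t) = inv0 t \<star> s_refl D a \<star> t"
proof (rule s_refl_eq)
  have t': "inv0 t \<in> carrier (Wt D)" using assms(2) by simp
  show "a \<circ> coset_act D t \<in> Sig_aff D" using maps_Sig_aff[OF act_in_maps] assms by blast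
  show "inv0 t \<star> s_refl D a \<star> t \<in> Waff D"
    using Waff_normal[OF t' s_refl(1)[OF assms(1)]] assms(2) by simp
  show "coset_act D (inv0 t \<star> s_refl D a \<star> t) = refl_map D (a \<circ> coset_act D t)"
    using refl_conj[OF act_in_maps[OF assms(2)] act_in_maps[OF t'] act_inv[OF assms(2)] assms(1)]
    by (simp only: act_mult assms(2) t' s_refl_Wt[OF assms(1)] s_refl(2)[OF assms(1)] Wt.m_closed)
qed

text \<open>Extends the index of q_s from simple affine reflections to all hyperplanes. It is
  constant on W~-orbits, so it can be summed over inversions.\<close>

definition root_class :: "('v \<Rightarrow> real) \<Rightarrow> ('k^'n^'n) set set" where
  "root_class a = q_index D (s_refl D a)"

lemma q_index_conj:
  assumes "t \<in> carrier (Wt D)" "s \<in> carrier (Wt D)"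
  shows "q_index D (inv0 t \<star> s \<star> t) = q_index D s"
proof -
  have sub: "q_index D (inv0 t \<star> s \<star> t) \<subseteq> q_index D s"
    if ts: "t \<in> carrier (Wt D)" "s \<in> carrier (Wt D)" for t s
  proof
    fix y assume "y \<in> q_index D (inv0 t \<star> s \<star> t)"
    then obtain x where x: "x \<in> carrier (Wt D)"
        "y = x \<star> (inv0 t \<star> s \<star> t) \<star> inv0 x"
      unfolding q_index_def by blast
    then have "y = (x \<star> inv0 t) \<star> s \<star> inv0 (x \<star> inv0 t)"
      using ts by (simp add: Wt.inv_mult_group Wt.m_assoc)
    then show "y \<in> q_index D s" using x ts unfolding q_index_def by blast
  qed
  define s' where "s' = inv0 t \<star> s \<star> t"
  have s': "s' \<in> carrier (Wt D)" using assms by (simp add: s'_def)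
  have "inv0 (inv0 t) \<star> s' \<star> inv0 t = t \<star> (inv0 t \<star> s) \<star> (t \<star> inv0 t)"
    using assms by (simp add: s'_def Wt.m_assoc)
  also have "\<dots> = t \<star> inv0 t \<star> s" using assms by (simp add: Wt.m_assoc[symmetric])
  also have "\<dots> = s" using assms by simp
  finally have "q_index D s \<subseteq> q_index D s'" using sub[of "inv0 t" s'] assms s' by simp
  then show ?thesis using sub[OF assms] by (simp add: s'_def)
qed

lemma root_class_comp: "a \<in> Sig_aff D \<Longrightarrow> t \<in> carrier (Wt D) \<Longrightarrow> root_class (a \<circ> coset_act D t) = root_class a"
  by (simp add: root_class_def s_refl_conj q_index_conj s_refl_Wt)

lemma root_class_minus: "a \<in> Sig_aff D \<Longrightarrow> root_class (\<lambda>v. - a v) = root_class a"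
  by (simp add: root_class_def s_refl_def refl_minus)

lemma root_class_refl: "b \<in> Sig_aff D \<Longrightarrow> a \<in> Sig_aff D \<Longrightarrow> root_class (b \<circ> refl_map D a) = root_class b"
  using root_class_comp[of b "s_refl D a"] by (simp add: s_refl s_refl_Wt)

section \<open>Reduced expressions and the exponent of q_w\<close>

lemma s_refl_act: "a \<in> Sig_aff D \<Longrightarrow> w \<in> carrier (Wt D) \<Longrightarrow>
    coset_act D (s_refl D a \<star> w) = refl_map D a \<circ> coset_act D w"
  by (simp add: act_mult s_refl s_refl_Wt)

lemma s_refl_square: "a \<in> Sig_aff D \<Longrightarrow> s_refl D a \<star> s_refl D a = \<one>\<^bsub>Wt D\<^esub>"
  using inj_onD[OF Waff_inj, of "s_refl D a \<star> s_refl D a" "\<one>\<^bsub>Wt D\<^esub>"]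
  by (simp add: act_mult s_refl s_refl_Wt Waff_mult Waff_one act_one refl_comp_refl)

lemma s_refl_cancel: "a \<in> Sig_aff D \<Longrightarrow> w \<in> carrier (Wt D) \<Longrightarrow>
    s_refl D a \<star> (s_refl D a \<star> w) = w"
  by (simp add: Wt.m_assoc[symmetric] s_refl_Wt s_refl_square)

lemma S_aff_Wt: "S_aff D \<subseteq> carrier (Wt D)"
  by (auto simp: S_aff_def s_refl_Wt simple_Sig_aff)

lemma len_Wt: "w \<in> carrier (Wt D) \<Longrightarrow> len D w = card (inv_roots (coset_act D w))"
  by (rule len_inv_roots[OF act_in_maps])

lemma len_Wt1: "w \<in> carrier (Wt1 D) \<Longrightarrow> len D w = card (inv_roots (coset_act D w))"
  by (rule len_inv_roots[OF act1_in_maps])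

lemma len_one: "len D \<one>\<^bsub>Wt D\<^esub> = 0"
  using len_Wt[of "\<one>\<^bsub>Wt D\<^esub>"] not_pos_neg by (simp add: act_one inv_roots_def) (metis (lifting) Collect_empty_eq card.empty)

lemma len_pos_step:
  assumes "w \<in> carrier (Wt D)" "len D w > 0"
  shows "\<exists>a\<in>simple_aff D. a \<circ> coset_act D w \<in> Sig_aff_neg D \<and>
    len D w = Suc (len D (s_refl D a \<star> w))"
proof -
  have "inv_roots (coset_act D w) \<noteq> {}" using assms by (auto simp: len_Wt)
  then obtain a where a: "a \<in> simple_aff D" "a \<circ> coset_act D w \<in> Sig_aff_neg D"
    using inv_roots_simple act_in_maps assms(1) by blast
  have "len D w = Suc (len D (s_refl D a \<star> w))"
    using inv_roots_step(3)[OF act_in_maps[OF assms(1)] a] a assms(1)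
    by (simp add: len_Wt s_refl_act s_refl_Wt simple_Sig_aff)
  then show ?thesis using a by blast
qed

lemma reduced_expr_exists: "w \<in> carrier (Wt D) \<Longrightarrow> \<exists>ss u. reduced_expr D w ss u"
proof (induction "len D w" arbitrary: w)
  case 0
  then show ?case unfolding reduced_expr_def
    by (intro exI[of _ "[]"] exI[of _ w]) auto
next
  case (Suc n)
  obtain a where a: "a \<in> simple_aff D" "len D w = Suc (len D (s_refl D a \<star> w))"
    using len_pos_step[OF Suc.prems] Suc.hyps(2) by auto
  let ?w = "s_refl D a \<star> w"
  have s: "s_refl D a \<in> carrier (Wt D)" using a by (simp add: s_refl_Wt simple_Sig_aff)
  have w': "?w \<in> carrier (Wt D)" using s Suc.prems by simp
  have "n = len D ?w" using Suc.hyps(2) a(2) by simp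
  from Suc.hyps(1)[OF this w'] obtain ss u where r: "reduced_expr D ?w ss u" by blast
  have p: "prod_W (Wt D) ss \<in> carrier (Wt D)"
    using r S_aff_Wt by (intro Wt.prod_W_closed) (auto simp: reduced_expr_def)
  have "w = s_refl D a \<star> ?w" using a Suc.prems by (simp add: s_refl_cancel simple_Sig_aff)
  also have "\<dots> = prod_W (Wt D) (s_refl D a # ss) \<star> u"
    using r s p by (simp add: reduced_expr_def Wt.m_assoc)
  finally have "reduced_expr D w (s_refl D a # ss) u"
    using r a unfolding reduced_expr_def S_aff_def by auto
  then show ?case by blast
qed

text \<open>The exponent of the square root of q_w, read off from the hyperplanes between the alcove
  and its image rather than from a reduced expression.\<close>

definition class_sum :: "('v \<Rightarrow> 'v) \<Rightarrow> ('k^'n^'n) set set \<Rightarrow>\<^sub>0 int" where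
  "class_sum g = (\<Sum>a\<in>inv_roots g. Poly_Mapping.single (root_class a) 1)"

text \<open>A letter either adds one inversion, of its own class, or removes one. Once a letter
  removes one, the length falls short of the number of letters; so in a reduced word the classes of
  the letters and of the inversions agree.\<close>

lemma class_sum_word:
  assumes "set ss \<subseteq> S_aff D" "u \<in> carrier (Wt D)" "len D u = 0"
  shows "len D (prod_W (Wt D) ss \<star> u) \<le> length ss \<and>
    (len D (prod_W (Wt D) ss \<star> u) = length ss \<longrightarrow>
      (\<Sum>s\<leftarrow>ss. Poly_Mapping.single (q_index D s) 1) = class_sum (coset_act D (prod_W (Wt D) ss \<star> u)))"
  using assms(1)
proof (induction ss)
  case Nil
  have "inv_roots (coset_act D u) = {}"
    using assms finite_inv_roots[OF act_in_maps[OF assms(2)]] by (simp add: len_Wt)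
  then show ?case using assms by (simp add: class_sum_def)
next
  case (Cons s ss)
  define w where "w = prod_W (Wt D) ss \<star> u"
  obtain a where a: "a \<in> simple_aff D" "s = s_refl D a" using Cons.prems by (auto simp: S_aff_def)
  have aS: "a \<in> Sig_aff D" by (rule simple_Sig_aff[OF a(1)])
  have p: "prod_W (Wt D) ss \<in> carrier (Wt D)" using Cons.prems S_aff_Wt by (intro Wt.prod_W_closed) auto
  have w: "w \<in> carrier (Wt D)" using p assms by (simp add: w_def)
  have s: "s \<in> carrier (Wt D)" using a aS s_refl_Wt by simp
  have e: "prod_W (Wt D) (s # ss) \<star> u = s \<star> w"
    using p s assms by (simp add: w_def Wt.m_assoc)
  have IH: "len D w \<le> length ss" "len D w = length ss \<longrightarrow>
      (\<Sum>s\<leftarrow>ss. Poly_Mapping.single (q_index D s) 1) = class_sum (coset_act D w)"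
    using Cons.IH Cons.prems by (auto simp: w_def)
  define g where "g = coset_act D w"
  have g: "g \<in> apt_maps" using act_in_maps[OF w] by (simp add: g_def)
  have act: "coset_act D (s \<star> w) = refl_map D a \<circ> g" using a aS w by (simp add: s_refl_act g_def)
  have rr: "refl_map D a \<circ> (refl_map D a \<circ> g) = g" by (simp add: comp_assoc[symmetric] refl_comp_refl aS)
  show ?case
  proof (cases "a \<circ> g \<in> Sig_aff_neg D")
    case True
    then have "len D w = Suc (len D (s \<star> w))"
      using inv_roots_step(3)[OF g a(1)] w s by (simp add: len_Wt act g_def)
    then show ?thesis using IH(1) e by simp
  next
    case False
    let ?g = "refl_map D a \<circ> g"
    have g': "?g \<in> apt_maps" by (rule maps_comp[OF refl_in_maps[OF aS] g])
    have "a \<circ> g \<in> Sig_aff_pos D" using False pos_or_neg maps_Sig_aff[OF g aS] by blast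
    moreover have "a \<circ> ?g = (\<lambda>v. - (a \<circ> g) v)" by (simp add: comp_assoc[symmetric] root_comp_refl[OF aS]) auto
    ultimately have n: "a \<circ> ?g \<in> Sig_aff_neg D" by (simp only: neg_minus)
    have "len D (s \<star> w) = Suc (len D w)"
      using inv_roots_step(3)[OF g' a(1) n] w s by (simp add: len_Wt act rr g_def[symmetric])
    moreover have "class_sum ?g = Poly_Mapping.single (q_index D s) 1 + class_sum g"
      using sum_inv_roots_step[OF g' a(1) n, of "\<lambda>a. Poly_Mapping.single (root_class a) (1::int)"]
      unfolding class_sum_def rr by (simp add: root_class_refl aS) (simp add: root_class_def a(2))
    moreover obtain h where h: "h = ?g" by simp
    ultimately show ?thesis using IH unfolding e act h[symmetric] by (simp add: g_def)
  qed
qed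

text \<open>The reduced word chosen inside \<open>half_exp\<close> thereby drops out. The second
  claim keeps exponents within the indeterminates that \<open>q_ring\<close> allows.\<close>

lemma half_exp_class_sum:
  assumes "w \<in> carrier (Wt1 D)"
  shows "half_exp D w = class_sum (coset_act D w)"
    and "Poly_Mapping.keys (half_exp D w) \<subseteq> q_index D ` S_aff D"
proof -
  define ss where "ss = (SOME ss. \<exists>u. reduced_expr D (proj D w) ss u)"
  have "\<exists>u. reduced_expr D (proj D w) ss u"
    unfolding ss_def by (rule someI_ex[OF reduced_expr_exists[OF proj_closed[OF assms]]])
  then obtain u where u: "reduced_expr D (proj D w) ss u" by blast
  have h: "half_exp D w = (\<Sum>s\<leftarrow>ss. Poly_Mapping.single (q_index D s) 1)"
    by (simp add: half_exp_def ss_def)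
  also have "\<dots> = class_sum (coset_act D (proj D w))"
    using u class_sum_word[of ss u] by (auto simp: reduced_expr_def)
  finally show "half_exp D w = class_sum (coset_act D w)" by (simp add: coset_act_proj assms)
  have "set ss \<subseteq> S_aff D" using u by (simp add: reduced_expr_def)
  then have "Poly_Mapping.keys (\<Sum>s\<leftarrow>ss. Poly_Mapping.single (q_index D s) (1::int)) \<subseteq> q_index D ` S_aff D"
  proof (induction ss)
    case (Cons s ss)
    then show ?case
      using Poly_Mapping.keys_add[of "Poly_Mapping.single (q_index D s) (1::int)"
          "\<Sum>s\<leftarrow>ss. Poly_Mapping.single (q_index D s) 1"] by auto
  qed simp
  then show "Poly_Mapping.keys (half_exp D w) \<subseteq> q_index D ` S_aff D" using h by simp
qed

section \<open>The finite Weyl group and the lifts n_w\<close>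

lemma Wsp_closed: "w \<in> Wsp D \<Longrightarrow> w \<in> carrier (Wt D)"
  using Wsp_Waff Waff_closed by blast

lemma Wsp_one: "\<one>\<^bsub>Wt D\<^esub> \<in> Wsp D"
  by (simp add: Wsp_def Waff_one act_one)

lemma Wsp_mult: "w \<in> Wsp D \<Longrightarrow> w' \<in> Wsp D \<Longrightarrow> w \<star> w' \<in> Wsp D"
  by (simp add: Wsp_def Waff_mult act_mult Waff_closed)

lemma Wsp_inv: assumes "w \<in> Wsp D" shows "inv0 w \<in> Wsp D"
  using fun_cong[OF act_inv(2)[OF Wsp_closed[OF assms]], of 0] assms by (simp add: Wsp_def Waff_inv)

text \<open>An element of the affine Weyl group without inversions is the identity because the
  action is faithful, so here no factor of length 0 is left over.\<close>

lemma Wsp_reduced: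
  "w \<in> Wsp D \<Longrightarrow> \<exists>ss. set ss \<subseteq> S_fin D \<and> length ss = len D w \<and> w = prod_W (Wt D) ss"
proof (induction "len D w" arbitrary: w)
  case 0
  have wW: "w \<in> carrier (Wt D)" "w \<in> Waff D" using 0 Wsp_closed Wsp_Waff by auto
  have "inv_roots (coset_act D w) = {}"
    using 0 wW finite_inv_roots[OF act_in_maps] by (simp add: len_Wt)
  then have "a \<circ> coset_act D w \<in> Sig_aff_pos D" if "a \<in> Sig_aff_pos D" for a
    using that pos_or_neg maps_Sig_aff[OF act_in_maps[OF wW(1)] pos_subset[OF that]]
    unfolding inv_roots_def by blast
  then have "coset_act D w = id" by (rule simple_gen_pos_id[OF Waff_simple_gen[OF wW(2)]])
  then have "w = \<one>\<^bsub>Wt D\<^esub>" using inj_onD[OF Waff_inj, of w] wW Waff_one by (simp add: act_one)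
  then show ?case using 0 by (intro exI[of _ "[]"]) simp
next
  case (Suc n)
  have wW: "w \<in> carrier (Wt D)" using Suc Wsp_closed by blast
  obtain a where a: "a \<in> simple_aff D" "a \<circ> coset_act D w \<in> Sig_aff_neg D"
      "len D w = Suc (len D (s_refl D a \<star> w))"
    using len_pos_step[OF wW] Suc.hyps(2) by auto
  have aS: "a \<in> Sig_aff D" by (rule simple_Sig_aff[OF a(1)])
  \<comment> \<open>As w fixes the origin, the positive root a and the negative root a \<circ> w
    have the same value there, which must be 0. Hence the reflection in a belongs to the stabilizer
    too.\<close>
  have "(a \<circ> coset_act D w) 0 = a 0" using Suc.prems by (simp add: Wsp_def)
  moreover have "a 0 \<ge> 0" using simple_pos[OF a(1)] by (auto simp: Sig_aff_pos_iff)
  moreover have "(a \<circ> coset_act D w) 0 \<le> 0" using a(2) by (auto simp: Sig_aff_neg_iff Sig_aff_pos_iff)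
  ultimately have "a 0 = 0" by simp
  then have s: "s_refl D a \<in> Wsp D" using s_refl[OF aS] by (simp add: Wsp_def refl_map_alt)
  let ?w = "s_refl D a \<star> w"
  have "n = len D ?w" using Suc.hyps(2) a(3) by simp
  from Suc.hyps(1)[OF this Wsp_mult[OF s Suc.prems]] obtain ss where
    ss: "set ss \<subseteq> S_fin D" "length ss = len D ?w" "?w = prod_W (Wt D) ss" by blast
  have "w = s_refl D a \<star> ?w" using aS wW by (simp add: s_refl_cancel)
  then show ?case using ss a s
    by (intro exI[of _ "s_refl D a # ss"]) (auto simp: S_fin_def S_aff_def)
qed

lemma n_lift_props: assumes "s \<in> S_aff D"
  shows "n_lift D s \<in> carrier (Wt1 D)" "proj D (n_lift D s) = s"
  using assms choices_conds(2) by (auto simp: S_aff_def carrier_Wt1)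

lemma prod_lift:
  assumes "set ss \<subseteq> S_aff D"
  shows "prod_W (Wt1 D) (map (n_lift D) ss) \<in> carrier (Wt1 D) \<and>
    proj D (prod_W (Wt1 D) (map (n_lift D) ss)) = prod_W (Wt D) ss"
  using assms by (induction ss) (auto simp: n_lift_props proj_one proj_mult)

lemma n_w_props:
  assumes "w \<in> Wsp D"
  shows "n_w D w \<in> carrier (Wt1 D)" "proj D (n_w D w) = w" "coset_act D (n_w D w) = coset_act D w"
proof -
  define ss where "ss = (SOME ss. set ss \<subseteq> S_fin D \<and> length ss = len D w \<and> w = prod_W (Wt D) ss)"
  have ss: "set ss \<subseteq> S_fin D \<and> length ss = len D w \<and> w = prod_W (Wt D) ss"
    unfolding ss_def by (rule someI_ex[OF Wsp_reduced[OF assms]])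
  have n: "n_w D w = prod_W (Wt1 D) (map (n_lift D) ss)" by (simp add: n_w_def ss_def)
  have "set ss \<subseteq> S_aff D" using ss by (auto simp: S_fin_def)
  from prod_lift[OF this] show "n_w D w \<in> carrier (Wt1 D)" "proj D (n_w D w) = w"
    using ss n by auto
  then show "coset_act D (n_w D w) = coset_act D w" using coset_act_proj by metis
qed

lemma n_w_one: "n_w D \<one>\<^bsub>Wt D\<^esub> = \<one>\<^bsub>Wt1 D\<^esub>"
proof -
  define ss where "ss = (SOME ss. set ss \<subseteq> S_fin D \<and> length ss = len D \<one>\<^bsub>Wt D\<^esub> \<and> \<one>\<^bsub>Wt D\<^esub> = prod_W (Wt D) ss)"
  have "length ss = len D \<one>\<^bsub>Wt D\<^esub>"
    unfolding ss_def using someI_ex[OF Wsp_reduced[OF Wsp_one]] by blast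
  then have "ss = []" by (simp add: len_one)
  then show ?thesis by (simp add: n_w_def flip: ss_def)
qed

end

section \<open>Translations\<close>

lemma finite_scale:
  assumes "finite S" "\<And>s. s \<in> S \<Longrightarrow> p s > (0::real)"
  shows "\<exists>N::nat. \<forall>s\<in>S. q s < real N * p s"
  using assms
proof (induction S rule: finite_induct)
  case (insert s S)
  then obtain N where N: "\<forall>s\<in>S. q s < real N * p s" by auto
  obtain M :: nat where M: "q s / p s < real M" using reals_Archimedean2 by blast
  have "q x < real (max M N) * p x" if x: "x \<in> insert s S" for x
  proof (cases "x = s")
    case True
    have "q s < real M * p s" using M insert.prems[of s] by (simp add: pos_divide_less_eq)
    also have "\<dots> \<le> real (max M N) * p s" using insert.prems[of s] by (intro mult_right_mono) auto
    finally show ?thesis using True by simp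
  next
    case False
    then have "q x < real N * p x" using N x by auto
    also have "\<dots> \<le> real (max M N) * p x" using insert.prems[of x] x by (intro mult_right_mono) auto
    finally show ?thesis .
  qed
  then show ?case by blast
qed auto

context grp_data
begin

lemma root_comp_Lam1:
  assumes "b \<in> Sig_aff D" "l \<in> Lam1 D"
  shows "b \<circ> coset_act D l = (\<lambda>v. b v + grad b (nu D l))" "grad (b \<circ> coset_act D l) = grad b"
    "(b \<circ> coset_act D l) 0 = b 0 + grad b (nu D l)" "b \<circ> coset_act D l \<in> Sig_aff D"
proof -
  have e: "b (v + nu D l) = b v + grad b (nu D l)" for v
    using Sig_aff_line[OF assms(1), of v 1 "nu D l"] by simp
  show "b \<circ> coset_act D l = (\<lambda>v. b v + grad b (nu D l))"
    using e by (simp add: fun_eq_iff act_Lam1[OF assms(2)])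
  then show "grad (b \<circ> coset_act D l) = grad b" "(b \<circ> coset_act D l) 0 = b 0 + grad b (nu D l)"
    by (simp_all add: grad_def)
  show "b \<circ> coset_act D l \<in> Sig_aff D"
    using maps_Sig_aff[OF act1_in_maps[OF Lam1_closed[OF assms(2)]] assms(1)] .
qed

lemma Sig_aff_pos_add:
  assumes "b \<in> Sig_aff_pos D" "l \<in> Lam1 D" "grad b (nu D l) \<ge> 0"
  shows "b \<circ> coset_act D l \<in> Sig_aff_pos D"
  using assms root_comp_Lam1[OF pos_subset[OF assms(1)] assms(2)]
  unfolding Sig_aff_pos_iff[of b] Sig_aff_pos_iff[of "b \<circ> coset_act D l"] by auto

text \<open>Says that \<open>nu D l\<close> and \<open>nu D m\<close> share a closed Weyl chamber,
  without choosing one. It is symmetric because \<Sigma> is stable under sign.\<close>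

definition compat :: "('k^'n^'n) set \<Rightarrow> ('k^'n^'n) set \<Rightarrow> bool" where
  "compat l m \<longleftrightarrow> (\<forall>\<beta>\<in>Sig D. \<not> (\<beta> (nu D l) < 0 \<and> \<beta> (nu D m) > 0))"

text \<open>The hyperplanes crossed twice on the way through the translate by l to the one by
  \<open>l \<cdot> m\<close>; this is the set Q of \<open>inv_roots_cocycle\<close>.\<close>

definition crossing :: "('k^'n^'n) set \<Rightarrow> ('k^'n^'n) set \<Rightarrow> ('v \<Rightarrow> real) set" where
  "crossing l m = {b \<in> Sig_aff_pos D. b \<circ> coset_act D l \<in> Sig_aff_neg D \<and>
     b \<circ> coset_act D l \<circ> coset_act D m \<in> Sig_aff_pos D}"

lemma Sig_nu_int: assumes "\<beta> \<in> Sig D" "l \<in> Lam1 D" shows "\<beta> (nu D l) \<in> \<int>"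
proof -
  have b: "\<beta> \<in> Sig_aff D" using assms(1) by (simp add: Sig_aff_iff Sig_zero grad_def)
  have "(\<beta> \<circ> coset_act D l) 0 \<in> \<int>" using root_comp_Lam1(4)[OF b assms(2)] by (simp only: Sig_aff_iff)
  then show ?thesis by (simp add: act_Lam1[OF assms(2)])
qed

text \<open>A translation changes an affine root b by the constant \<open>grad b (nu D l)\<close>.
  Turning negative and then positive again needs a decrease followed by an increase; conversely, as
  these constants are integers, a decrease and an increase cross the right level for a suitable
  b.\<close>

lemma crossing_empty_iff:
  assumes l: "l \<in> Lam1 D" and m: "m \<in> Lam1 D"
  shows "crossing l m = {} \<longleftrightarrow> compat l m"
proof
  assume c: "compat l m"
  show "crossing l m = {}"
  proof (rule ccontr)
    assume "crossing l m \<noteq> {}"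
    then obtain b where b: "b \<in> Sig_aff_pos D" "b \<circ> coset_act D l \<in> Sig_aff_neg D"
        "b \<circ> coset_act D l \<circ> coset_act D m \<in> Sig_aff_pos D"
      by (auto simp: crossing_def)
    let ?b = "b \<circ> coset_act D l"
    have bS: "b \<in> Sig_aff D" "?b \<in> Sig_aff D" using b pos_subset neg_subset by auto
    have "grad b (nu D l) < 0" using Sig_aff_pos_add[OF b(1) l] b(2) not_pos_neg by force
    moreover have "grad b (nu D m) > 0"
    proof (rule ccontr)
      assume "\<not> ?thesis"
      then have "grad (\<lambda>v. - ?b v) (nu D m) \<ge> 0"
        by (simp only: grad_minus root_comp_Lam1(2)[OF bS(1) l])
      then have "(\<lambda>v. - ?b v) \<circ> coset_act D m \<in> Sig_aff_pos D"
        using Sig_aff_pos_add[OF _ m] b(2) Sig_aff_neg_iff by blast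
      moreover have "(\<lambda>v. - ?b v) \<circ> coset_act D m = (\<lambda>v. - (?b \<circ> coset_act D m) v)" by auto
      ultimately have "?b \<circ> coset_act D m \<in> Sig_aff_neg D" by (simp only: Sig_aff_neg_iff)
      then show False using b(3) not_pos_neg by blast
    qed
    moreover have "grad b \<in> Sig D" using bS by (simp add: Sig_aff_iff)
    ultimately show False using c unfolding compat_def by blast
  qed
next
  assume e: "crossing l m = {}"
  show "compat l m"
    unfolding compat_def
  proof (intro ballI notI)
    fix \<beta> assume \<beta>: "\<beta> \<in> Sig D" and s: "\<beta> (nu D l) < 0 \<and> \<beta> (nu D m) > 0"
    obtain p q :: int where pq: "\<beta> (nu D l) = - of_int p" "\<beta> (nu D m) = of_int q"
      using Sig_nu_int[OF \<beta> l] Sig_nu_int[OF \<beta> m] by (metis Ints_cases minus_minus of_int_minus)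
    have p: "p \<ge> 1" "q \<ge> 1" using s pq by auto
    \<comment> \<open>The largest k for which \<beta> + k is a negative affine root: with constant 0
      a positive \<beta> is already positive, a negative one is not.\<close>
    define k :: int where "k = (if \<beta> \<in> Sig_pos D then -1 else 0)"
    have g: "grad (\<lambda>v. \<beta> v + of_int j) = \<beta>" for j :: int by (rule grad_add[OF \<beta>])
    have z: "(\<lambda>v. \<beta> v + of_int j) 0 = of_int j" for j :: int by (simp add: Sig_zero[OF \<beta>])
    have S: "(\<lambda>v. \<beta> v + of_int j) \<in> Sig_aff D" for j :: int
      using g z \<beta> by (simp add: Sig_aff_iff)
    have P: "(\<lambda>v. \<beta> v + of_int (k + j)) \<in> Sig_aff_pos D" if "j \<ge> 1" for j
    proof (cases "k + j > 0")
      case True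
      then show ?thesis using S[of "k + j"] z[of "k + j"] unfolding Sig_aff_pos_iff by simp
    next
      case False
      then have "\<beta> \<in> Sig_pos D" "k + j = 0" using that by (auto simp: k_def split: if_splits)
      then show ?thesis using S[of "k + j"] z[of "k + j"] g[of "k + j"] unfolding Sig_aff_pos_iff by simp
    qed
    have "(\<lambda>v. \<beta> v + of_int k) \<notin> Sig_aff_pos D"
      using z[of k] g[of k] unfolding Sig_aff_pos_iff by (simp add: k_def split: if_splits)
    then have N: "(\<lambda>v. \<beta> v + of_int k) \<in> Sig_aff_neg D" using pos_or_neg[OF S] by blast
    define b where "b = (\<lambda>v. \<beta> v + of_int (k + p))"
    have "b \<circ> coset_act D l = (\<lambda>v. \<beta> v + of_int k)"
      unfolding b_def root_comp_Lam1(1)[OF S l] g pq by auto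
    moreover have "(\<lambda>v. \<beta> v + of_int k) \<circ> coset_act D m = (\<lambda>v. \<beta> v + of_int (k + q))"
      unfolding root_comp_Lam1(1)[OF S m] g pq by auto
    ultimately have "b \<in> crossing l m"
      unfolding crossing_def using P[OF p(1)] P[OF p(2)] N by (simp only: mem_Collect_eq b_def simp_thms)
    then show False using e by simp
  qed
qed

definition crossing_exp :: "('k^'n^'n) set \<Rightarrow> ('k^'n^'n) set \<Rightarrow> ('k^'n^'n) set set \<Rightarrow>\<^sub>0 int" where
  "crossing_exp l m = (\<Sum>b\<in>crossing l m. Poly_Mapping.single (root_class b) 1)"

lemma root_class_comp1: "a \<in> Sig_aff D \<Longrightarrow> t \<in> carrier (Wt1 D) \<Longrightarrow> root_class (a \<circ> coset_act D t) = root_class a"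
  using root_class_comp[of a "proj D t"] by (simp add: proj_closed coset_act_proj)

text \<open>The cocycle weighted by classes. Since \<open>half_exp\<close> counts half powers, the
  doubled term stands for one factor q_s per hyperplane crossed twice.\<close>

lemma half_exp_mult:
  assumes "l \<in> carrier (Wt1 D)" "m \<in> carrier (Wt1 D)"
  shows "half_exp D l + half_exp D m =
    half_exp D (l \<cdot> m) + (crossing_exp l m + crossing_exp l m)"
  using inv_roots_cocycle[OF act1_in_maps[OF assms(1)] act1_in_maps[OF assms(2)],
      of "\<lambda>b. Poly_Mapping.single (root_class b) (1::int)" "crossing l m"] assms
  by (simp add: half_exp_class_sum class_sum_def act1_mult crossing_def crossing_exp_def
      root_class_comp1 root_class_minus)

lemma len_mult:
  assumes "l \<in> carrier (Wt1 D)" "m \<in> carrier (Wt1 D)"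
  shows "len D l + len D m = len D (l \<cdot> m) + (card (crossing l m) + card (crossing l m))"
  using inv_roots_cocycle[OF act1_in_maps[OF assms(1)] act1_in_maps[OF assms(2)],
      of "\<lambda>b. 1 :: nat" "crossing l m"] assms
  by (simp add: len_Wt1 act1_mult crossing_def)

lemma finite_crossing: "l \<in> carrier (Wt1 D) \<Longrightarrow> finite (crossing l m)"
  by (rule finite_subset[OF _ finite_inv_roots[OF act1_in_maps]]) (auto simp: crossing_def inv_roots_def)

lemma crossing_exp_nonneg: "Poly_Mapping.lookup (crossing_exp l m) i \<ge> 0"
  unfolding crossing_exp_def by (simp add: lookup_sum lookup_single when_def sum_nonneg)

text \<open>Every hyperplane contributes the integer 1, so nothing cancels.\<close>

lemma crossing_exp_zero_iff:
  assumes "l \<in> carrier (Wt1 D)"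
  shows "crossing_exp l m = 0 \<longleftrightarrow> crossing l m = {}"
proof
  assume z: "crossing_exp l m = 0"
  show "crossing l m = {}"
  proof (rule ccontr)
    assume "crossing l m \<noteq> {}"
    then obtain b where b: "b \<in> crossing l m" by blast
    have "(1::int) \<le> (\<Sum>c\<in>crossing l m. if root_class c = root_class b then 1 else 0)"
      using member_le_sum[OF b, of "\<lambda>c. if root_class c = root_class b then 1 else 0 :: int"]
        finite_crossing[OF assms] by simp
    also have "\<dots> = Poly_Mapping.lookup (crossing_exp l m) (root_class b)"
      unfolding crossing_exp_def lookup_sum lookup_single when_def by (rule sum.cong) auto
    finally show False using z by simp
  qed
qed (simp add: crossing_exp_def)

text \<open>All coefficients in \<open>half_exp_mult\<close> are nonnegative, so an index in the
  crossing term already occurs in the exponent of l or of m.\<close>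

lemma crossing_exp_keys:
  assumes "l \<in> carrier (Wt1 D)" "m \<in> carrier (Wt1 D)"
  shows "Poly_Mapping.keys (crossing_exp l m) \<subseteq> q_index D ` S_aff D"
proof
  fix i assume "i \<in> Poly_Mapping.keys (crossing_exp l m)"
  then have "Poly_Mapping.lookup (crossing_exp l m) i \<noteq> 0" by (simp add: in_keys_iff)
  then have pos: "Poly_Mapping.lookup (crossing_exp l m) i > 0" using crossing_exp_nonneg[of l m i] by simp
  have "Poly_Mapping.lookup (class_sum g) i \<ge> 0" for g
    by (simp add: class_sum_def lookup_sum lookup_single when_def sum_nonneg)
  then have "Poly_Mapping.lookup (half_exp D (l \<cdot> m)) i \<ge> 0"
    using assms by (simp add: half_exp_class_sum)
  moreover have "Poly_Mapping.lookup (half_exp D l) i + Poly_Mapping.lookup (half_exp D m) i =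
      Poly_Mapping.lookup (half_exp D (l \<cdot> m)) i + 2 * Poly_Mapping.lookup (crossing_exp l m) i"
    using arg_cong[OF half_exp_mult[OF assms], of "\<lambda>f. Poly_Mapping.lookup f i"] by (simp add: lookup_add)
  ultimately have "i \<in> Poly_Mapping.keys (half_exp D l) \<or> i \<in> Poly_Mapping.keys (half_exp D m)"
    using pos by (auto simp: in_keys_iff)
  then show "i \<in> q_index D ` S_aff D" using half_exp_class_sum(2) assms by blast
qed

lemma antidominant_compat:
  assumes "antidominant D l" "antidominant D m"
  shows "compat l m"
  unfolding compat_def
proof (intro ballI notI)
  fix \<beta> assume b: "\<beta> \<in> Sig D" "\<beta> (nu D l) < 0 \<and> \<beta> (nu D m) > 0"
  then have "\<beta> \<notin> Sig_pos D" using assms(2) unfolding antidominant_def by force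
  then have "(\<lambda>v. - \<beta> v) \<in> Sig_pos D" using Sig_split b by blast
  from bspec[OF assms(1)[unfolded antidominant_def] this] have "- \<beta> (nu D l) \<le> 0" .
  then show False using b by simp
qed

lemma half_exp_antidominant:
  assumes "l \<in> Lam1 D" "m \<in> Lam1 D" "antidominant D l" "antidominant D m"
  shows "half_exp D (l \<cdot> m) = half_exp D l + half_exp D m"
    and "len D (l \<cdot> m) = len D l + len D m"
proof -
  have c: "crossing l m = {}"
    using antidominant_compat[OF assms(3,4)] crossing_empty_iff[OF assms(1,2)] by simp
  then show "half_exp D (l \<cdot> m) = half_exp D l + half_exp D m"
    using half_exp_mult[of l m] assms Lam1_closed by (simp add: crossing_exp_def)
  show "len D (l \<cdot> m) = len D l + len D m"
    using len_mult[of l m] assms Lam1_closed c by simp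
qed

lemma half_exp_cong:
  "l \<in> Lam1 D \<Longrightarrow> m \<in> Lam1 D \<Longrightarrow> nu D l = nu D m \<Longrightarrow> half_exp D l = half_exp D m"
  using half_exp_class_sum(1) Lam1_closed act_Lam1 by (metis ext)

lemma half_exp_one: "half_exp D \<one>\<^bsub>Wt1 D\<^esub> = 0"
  using half_exp_class_sum(1)[of "\<one>\<^bsub>Wt1 D\<^esub>"] not_pos_neg
  by (simp add: class_sum_def inv_roots_def act1_one sum.neutral)

section \<open>Strictly antidominant translations\<close>

lemma tor_commute: assumes "s \<in> tor D" "t \<in> tor D" shows "s ** t = t ** s"
proof -
  obtain P :: "'k^'n^'n" where P: "invertible P"
    "\<And>s i j. s \<in> tor D \<Longrightarrow> i \<noteq> j \<Longrightarrow> (P ** s ** matrix_inv P) $ i $ j = 0"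
    by (rule tor_diagonalizable) blast
  define d where "d s = P ** s ** matrix_inv P" for s :: "'k^'n^'n"
  have m: "d (x ** y) = d x ** d y" for x y
  proof -
    have "d x ** d y = P ** x ** (matrix_inv P ** P) ** y ** matrix_inv P" by (simp only: d_def matrix_mul_assoc)
    then show ?thesis by (simp add: d_def matrix_inv_right_left P(1) matrix_mul_assoc)
  qed
  have "(d s ** d t) $ i $ j = (d t ** d s) $ i $ j" for i j
    using P(2)[OF assms(2), of i j] unfolding d_def
    by (cases "i = j") (simp_all add: matrix_mult_diag_left matrix_mult_diag_right P(2) assms)
  then have "d s ** d t = d t ** d s" by (simp add: vec_eq_iff)
  then show ?thesis using conj_by_invertible_inj[OF P(1)] m unfolding d_def by metis
qed

lemma S_F_Z_F: assumes "s \<in> S_F D" shows "s \<in> Z_F D"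
proof -
  have "tor D \<subseteq> grp D" using reductive_conds(1) by (simp add: max_split_torus_def)
  then show ?thesis using assms tor_commute
    by (auto simp: S_F_def Z_F_def cen_def rat_points_def)
qed

lemma val_one: "valn D 1 = 0"
proof -
  have "1 \<in> loc_field D - {0}" using field_conds(1) by (simp add: is_subfield_def)
  then have "valn D (1 * 1) = valn D 1 + valn D 1" using field_conds(3) by blast
  then show ?thesis by simp
qed

lemma val_powi:
  assumes "x \<in> loc_field D" "x \<noteq> 0"
  shows "valn D (x powi m) = m * valn D x"
proof -
  have p: "x ^ n \<in> loc_field D - {0}" for n :: nat
    using is_subfield_power[OF field_conds(1) assms(1)] assms(2) by simp
  have n: "valn D (x ^ n) = int n * valn D x" for n :: nat
  proof (induction n)
    case (Suc n)
    have "valn D (x * x ^ n) = valn D x + valn D (x ^ n)" using field_conds(3) p assms by blast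
    then show ?case using Suc by (simp add: algebra_simps)
  qed (simp add: val_one)
  have i: "valn D (inverse y) = - valn D y" if "y \<in> loc_field D - {0}" for y
  proof -
    have "inverse y \<in> loc_field D" using that field_conds(1) unfolding is_subfield_def by blast
    then have "inverse y \<in> loc_field D - {0}" using that by simp
    then have "valn D (y * inverse y) = valn D y + valn D (inverse y)" using field_conds(3) that by blast
    then show ?thesis using that by (simp add: val_one)
  qed
  show ?thesis
  proof (cases "m \<ge> 0")
    case True
    then show ?thesis by (simp add: power_int_def n)
  next
    case False
    then have "x powi m = inverse (x ^ nat (- m))" by (simp add: power_int_def power_inverse)
    then show ?thesis using i[OF p[of "nat (- m)"]] n[of "nat (- m)"] False by simp
  qed
qed

text \<open>The cocharacter is evaluated at a uniformizer w. Roots are multiples of characters, and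
  a character sends this value to the power of w whose exponent is the pairing; the sign is that in
  the definition of \<nu>.\<close>

lemma cochar_translation:
  assumes mu: "\<mu> \<in> cocharacters (loc_field D) (tor D)"
  shows "\<exists>l\<in>Lam1 D. \<forall>\<alpha>\<in>Sig D. \<alpha> (nu D l) = - \<alpha> (cov D \<mu>)"
proof -
  have "1 \<in> valn D ` (loc_field D - {0})" using field_conds(2) by simp
  then obtain w where w: "w \<in> loc_field D" "w \<noteq> 0" "valn D w = 1" by (elim imageE) auto
  have s: "\<mu> w \<in> S_F D" by (rule cochar_S_F[OF mu w(1,2)])
  have "\<alpha> (nu D (cls1 D (\<mu> w))) = - \<alpha> (cov D \<mu>)" if \<alpha>: "\<alpha> \<in> Sig D" for \<alpha>
  proof -
    obtain a c where a: "a \<in> roots (loc_field D) (grp D) (tor D)" "\<alpha> = (\<lambda>v. c * chr D a v)"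
      using Sig_char[OF \<alpha>] by blast
    have aX: "a \<in> characters (loc_field D) (tor D)" using a(1) by (simp add: roots_def)
    obtain m where m: "chr D a (cov D \<mu>) = of_int m" "a (\<mu> w) = w powi m"
      using apartment_conds(2) aX mu w(2) by blast
    have "chr D a (apt_act D (\<mu> w) 0) = - of_int m"
      using apartment_conds(4) s aX m(2) val_powi[OF w(1,2), of m] w(3) by simp
    then show ?thesis
      using s by (simp add: a(2) m(1) nu_def coset_act_cls1 S_F_Z_F Z_in_N)
  qed
  moreover have "cls1 D (\<mu> w) \<in> Lam1 D" using S_F_Z_F[OF s] by (simp add: Lam1_def)
  ultimately show ?thesis by blast
qed

lemma Lam1_int_multiple:
  assumes "l \<in> Lam1 D" shows "\<exists>m\<in>Lam1 D. nu D m = of_int k *\<^sub>R nu D l"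
proof (cases "k \<ge> 0")
  case True
  then show ?thesis using nu_pow[OF assms, of "nat k"] by (intro bexI[of _ "l [^]\<^bsub>Wt1 D\<^esub> nat k"]) auto
next
  case False
  then have "nu D (inv1 (l [^]\<^bsub>Wt1 D\<^esub> nat (- k))) = of_int k *\<^sub>R nu D l"
    using nu_pow[OF assms, of "nat (- k)"] by (simp add: nu_inv)
  then show ?thesis using nu_pow[OF assms, of "nat (- k)"] subgroup.m_inv_closed[OF subgroup_Lam1] by blast
qed

text \<open>Write v as a real combination of cocharacters and round the coefficients of N v down to
  integers. The error at each cocharacter is bounded independently of N.\<close>

lemma Lam1_approx:
  "\<exists>C. \<forall>N::nat. \<exists>l\<in>Lam1 D. \<forall>\<alpha>\<in>Sig D. \<bar>\<alpha> (nu D l) + real N * \<alpha> v\<bar> \<le> C"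
proof -
  have "v \<in> span (cov D ` cocharacters (loc_field D) (tor D))" using apartment_conds(1) by simp
  then show ?thesis
  proof (induction rule: span_induct_alt)
    case base
    show ?case
    proof (intro exI[of _ 0] allI bexI[of _ "\<one>\<^bsub>Wt1 D\<^esub>"] ballI)
      show "\<bar>\<alpha> (nu D \<one>\<^bsub>Wt1 D\<^esub>) + real N * \<alpha> 0\<bar> \<le> 0" if "\<alpha> \<in> Sig D" for \<alpha> N
        using that by (simp add: nu_one Sig_zero)
    qed (rule subgroup.one_closed[OF subgroup_Lam1])
  next
    case (step c x y)
    obtain C where C: "\<forall>N::nat. \<exists>l\<in>Lam1 D. \<forall>\<alpha>\<in>Sig D. \<bar>\<alpha> (nu D l) + real N * \<alpha> y\<bar> \<le> C" using step.IH by blast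
    obtain \<mu> where mu: "\<mu> \<in> cocharacters (loc_field D) (tor D)" "x = cov D \<mu>" using step.hyps by blast
    obtain l where l: "l \<in> Lam1 D" "\<forall>\<alpha>\<in>Sig D. \<alpha> (nu D l) = - \<alpha> x" using cochar_translation[OF mu(1)] mu(2) by blast
    define M where "M = (\<Sum>\<alpha>\<in>Sig D. \<bar>\<alpha> x\<bar>)"
    have "\<exists>k\<in>Lam1 D. \<forall>\<alpha>\<in>Sig D. \<bar>\<alpha> (nu D k) + real N * \<alpha> (c *\<^sub>R x + y)\<bar> \<le> M + C" for N :: nat
    proof -
      obtain k where k: "k \<in> Lam1 D" "\<forall>\<alpha>\<in>Sig D. \<bar>\<alpha> (nu D k) + real N * \<alpha> y\<bar> \<le> C" using C by blast
      obtain l' where l': "l' \<in> Lam1 D" "nu D l' = of_int \<lfloor>real N * c\<rfloor> *\<^sub>R nu D l"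
        using Lam1_int_multiple[OF l(1)] by blast
      have "\<bar>\<alpha> (nu D (l' \<cdot> k)) + real N * \<alpha> (c *\<^sub>R x + y)\<bar> \<le> M + C" if a: "\<alpha> \<in> Sig D" for \<alpha>
      proof -
        have lin: "linear \<alpha>" by (rule Sig_linear[OF a])
        have "\<bar>real N * c - of_int \<lfloor>real N * c\<rfloor>\<bar> \<le> 1" by linarith
        then have "\<bar>(real N * c - of_int \<lfloor>real N * c\<rfloor>) * \<alpha> x\<bar> \<le> 1 * \<bar>\<alpha> x\<bar>"
          unfolding abs_mult by (rule mult_right_mono) simp
        also have "\<dots> \<le> M" using member_le_sum[OF a, of "\<lambda>\<alpha>. \<bar>\<alpha> x\<bar>"] finite_Sig by (simp add: M_def)
        finally have 1: "\<bar>(real N * c - of_int \<lfloor>real N * c\<rfloor>) * \<alpha> x\<bar> \<le> M" .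
        have "\<alpha> (nu D (l' \<cdot> k)) + real N * \<alpha> (c *\<^sub>R x + y) =
            (real N * c - of_int \<lfloor>real N * c\<rfloor>) * \<alpha> x + (\<alpha> (nu D k) + real N * \<alpha> y)"
          using bspec[OF l(2) a]
          by (simp add: nu_mult l'(1) k(1) linear_add[OF lin] linear_scale[OF lin] l'(2) algebra_simps)
        then show ?thesis using 1 k(2) a by (smt (verit))
      qed
      then show ?thesis using subgroup.m_closed[OF subgroup_Lam1 l'(1) k(1)] by blast
    qed
    then show ?case by blast
  qed
qed

text \<open>Approximate -N v for v in the open dominant chamber, with N so large that N \<alpha>(v)
  exceeds the error C for every positive root.\<close>

lemma strictly_antidominant: "\<exists>l\<in>Lam1 D. \<forall>\<alpha>\<in>Sig_pos D. \<alpha> (nu D l) < 0"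
proof -
  obtain v where v: "\<forall>\<alpha>\<in>Sig_pos D. \<alpha> v > 0" using Sig_chamber by blast
  obtain C where C: "\<forall>N::nat. \<exists>l\<in>Lam1 D. \<forall>\<alpha>\<in>Sig D. \<bar>\<alpha> (nu D l) + real N * \<alpha> v\<bar> \<le> C"
    using Lam1_approx by blast
  have "finite (Sig_pos D)" by (rule finite_subset[OF _ finite_Sig]) (auto simp: Sig_pos_subset)
  from finite_scale[OF this, of "\<lambda>\<alpha>. \<alpha> v" "\<lambda>_. C"] v
  obtain N :: nat where N: "\<forall>\<alpha>\<in>Sig_pos D. C < real N * \<alpha> v" by auto
  obtain l where "l \<in> Lam1 D" "\<forall>\<alpha>\<in>Sig D. \<bar>\<alpha> (nu D l) + real N * \<alpha> v\<bar> \<le> C" using C by blast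
  then show ?thesis using N Sig_pos_subset by (intro bexI[of _ l] ballI) (smt (verit), auto)
qed

text \<open>A high power of a strictly antidominant element absorbs finitely many translations at
  once. It yields the quotients defining E(\<lambda>) and clears denominators in linear
  relations.\<close>

lemma antidominant_multiplier:
  assumes "finite L" "L \<subseteq> Lam1 D"
  shows "\<exists>m\<in>Lam1 D. antidominant D m \<and> (\<forall>l\<in>L. antidominant D (l \<cdot> m))"
proof -
  obtain m where m: "m \<in> Lam1 D" "\<forall>\<alpha>\<in>Sig_pos D. \<alpha> (nu D m) < 0" using strictly_antidominant by blast
  have "finite (Sig_pos D)" by (rule finite_subset[OF _ finite_Sig]) (auto simp: Sig_pos_subset)
  then have "finite (Sig_pos D \<times> L)" using assms by simp
  from finite_scale[OF this, of "\<lambda>x. - fst x (nu D m)" "\<lambda>x. fst x (nu D (snd x))"] m(2)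
  obtain N :: nat where N: "\<forall>x\<in>Sig_pos D \<times> L. fst x (nu D (snd x)) < real N * - fst x (nu D m)" by auto
  let ?m = "m [^]\<^bsub>Wt1 D\<^esub> N"
  have mN: "?m \<in> Lam1 D" "nu D ?m = real N *\<^sub>R nu D m" using nu_pow[OF m(1)] by auto
  have "antidominant D ?m"
    unfolding antidominant_def
  proof
    fix \<alpha> assume a: "\<alpha> \<in> Sig_pos D"
    then show "\<alpha> (nu D ?m) \<le> 0"
      using m(2) by (simp add: mN linear_scale[OF Sig_linear[OF Sig_pos_subset]] mult_le_0_iff less_imp_le)
  qed
  moreover have "antidominant D (l \<cdot> ?m)" if l: "l \<in> L" for l
    unfolding antidominant_def
  proof
    fix \<alpha> assume a: "\<alpha> \<in> Sig_pos D"
    have lin: "linear \<alpha>" by (rule Sig_linear[OF Sig_pos_subset[OF a]])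
    have "\<alpha> (nu D l) < real N * - \<alpha> (nu D m)" using N a l by fastforce
    moreover have "l \<in> Lam1 D" using l assms by blast
    ultimately show "\<alpha> (nu D (l \<cdot> ?m)) \<le> 0"
      by (simp add: nu_mult mN linear_add[OF lin] linear_scale[OF lin])
  qed
  ultimately show ?thesis using mN by blast
qed

end

section \<open>Invertibility of the Iwahori-Matsumoto basis\<close>

lemma is_subfield_prod: "is_subfield F \<Longrightarrow> (\<And>i. i \<in> A \<Longrightarrow> f i \<in> F) \<Longrightarrow> prod f A \<in> F"
  by (induction A rule: infinite_finite_induct) (auto simp: is_subfield_def)

lemma is_subfield_det:
  assumes "is_subfield F" "\<And>i j. (A :: 'a::field^'n^'n) $ i $ j \<in> F"
  shows "det A \<in> F"
  unfolding det_def
proof (intro is_subfield_sum[OF assms(1)])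
  fix p
  have "prod (\<lambda>i. A $ i $ p i) UNIV \<in> F" using assms by (intro is_subfield_prod) auto
  then show "of_int (sign p) * prod (\<lambda>i. A $ i $ p i) UNIV \<in> F"
    using assms(1) by (cases p rule: sign_cases) (auto simp: is_subfield_def)
qed

lemma matrix_inv_rational:
  assumes F: "is_subfield F" and A: "\<And>i j. (A :: 'a::field^'n^'n) $ i $ j \<in> F" and inv: "invertible A"
  shows "matrix_inv A $ i $ j \<in> F"
proof -
  have d0: "det A \<noteq> 0" using inv by (simp add: invertible_det_nz)
  have "A *v (matrix_inv A *v axis j 1) = axis j 1"
    by (simp add: matrix_vector_mul_assoc matrix_inv_right_left inv)
  then have "matrix_inv A *v axis j 1 = (\<chi> k. det (\<chi> i l. if l = k then axis j 1 $ i else A $ i $ l) / det A)"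
    using cramer[OF d0] by blast
  moreover have "(matrix_inv A *v axis j 1) $ i = matrix_inv A $ i $ j"
    by (simp add: matrix_vector_mult_def axis_def if_distrib[where f = "\<lambda>x. _ * x"] cong: if_cong)
  ultimately have "matrix_inv A $ i $ j = det (\<chi> k l. if l = i then axis j 1 $ k else A $ k $ l) / det A"
    by simp
  moreover have "det (\<chi> k l. if l = i then axis j (1::'a) $ k else A $ k $ l) \<in> F"
    using F A by (intro is_subfield_det) (auto simp: axis_def is_subfield_def)
  moreover have "inverse (det A) \<in> F" using F is_subfield_det[OF F A] unfolding is_subfield_def by blast
  ultimately show ?thesis using F by (simp only: divide_inverse is_subfield_def)
qed

definition two_sided_unit :: "'h::ring_1 \<Rightarrow> bool" where
  "two_sided_unit x \<longleftrightarrow> (\<exists>y. x * y = 1 \<and> y * x = 1)"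

lemma ring_inverse_eqI:
  assumes "x * y = 1" "y * x = 1" shows "ring_inverse x = y"
  unfolding ring_inverse_def
proof (rule the_equality)
  fix z assume "x * z = 1 \<and> z * x = 1"
  then have "z = z * (x * y)" "z * x = 1" using assms by auto
  then show "z = y" by (metis mult.assoc mult_1)
qed (use assms in simp)

lemma ring_inverse_props: assumes "two_sided_unit x" shows "x * ring_inverse x = 1" "ring_inverse x * x = 1"
  using assms ring_inverse_eqI unfolding two_sided_unit_def by blast+

lemma two_sided_unit_mult:
  assumes "two_sided_unit x" "two_sided_unit y"
  shows "two_sided_unit (x * y)" "ring_inverse (x * y) = ring_inverse y * ring_inverse x"
proof -
  have 1: "(x * y) * (ring_inverse y * ring_inverse x) = x * (y * ring_inverse y) * ring_inverse x"
    by (simp only: mult.assoc)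
  have 2: "(ring_inverse y * ring_inverse x) * (x * y) = ring_inverse y * (ring_inverse x * x) * y"
    by (simp only: mult.assoc)
  show "two_sided_unit (x * y)" unfolding two_sided_unit_def
    using 1 2 by (intro exI[of _ "ring_inverse y * ring_inverse x"]) (simp add: ring_inverse_props assms)
  show "ring_inverse (x * y) = ring_inverse y * ring_inverse x"
    using 1 2 by (intro ring_inverse_eqI) (simp_all add: ring_inverse_props assms)
qed

context grp_data
begin

section \<open>Parahoric subgroups and their reductions\<close>

lemma subgroup_G_F: "subgroup (G_F D) GL"
proof -
  have "connected_reductive (loc_field D) (grp D)"
    using oks(2) unfolding reductive_ok_def by - (elim conjE, assumption)
  then have g: "subgroup (grp D) GL" by (simp add: connected_reductive_def alg_group_def)
  have inv: "invertible x" if "x \<in> grp D" for x using subgroup.subset[OF g] that by auto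
  show ?thesis
  proof (rule group.subgroupI[OF group_GL])
    show "G_F D \<subseteq> carrier GL" using inv by (auto simp: G_F_def rat_points_def)
    have "mat 1 \<in> G_F D" using one_in_N by (simp add: N_F_def)
    then show "G_F D \<noteq> {}" by auto
  next
    fix x assume x: "x \<in> G_F D"
    then have "inv\<^bsub>GL\<^esub> x \<in> grp D" "invertible x"
      using subgroup.m_inv_closed[OF g] inv by (auto simp: G_F_def rat_points_def)
    then show "inv\<^bsub>GL\<^esub> x \<in> G_F D"
      using x matrix_inv_rational[OF field_conds(1)] by (auto simp: G_F_def rat_points_def inv_GL)
  next
    fix x y assume "x \<in> G_F D" "y \<in> G_F D"
    then show "x \<otimes>\<^bsub>GL\<^esub> y \<in> G_F D"
      using subgroup.m_closed[OF g, of x y] rat_mult by (auto simp: G_F_def rat_points_def)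
  qed
qed

lemma parahoric_conds:
  assumes "\<F> \<in> range (facet D)"
  shows "subgroup (parahoric D \<F>) (GL_on (G_F D))"
    "red D \<F> \<in> hom (GL_on (parahoric D \<F>)) GL"
    "Z_F D \<inter> parahoric D \<F> = H0"
  using bspec[OF oks(5)[unfolded parahoric_ok_def] assms] by - (elim conjE, assumption)+

lemma group_parahoric:
  assumes "\<F> \<in> range (facet D)" shows "group (GL_on (parahoric D \<F>))"
  using subgroup.subgroup_is_group[OF parahoric_conds(1)[OF assms]
      subgroup.subgroup_is_group[OF subgroup_G_F group_GL]] by simp

lemma parahoric_invertible:
  assumes "\<F> \<in> range (facet D)" "x \<in> parahoric D \<F>" shows "invertible x"
  using subgroup.subset[OF parahoric_conds(1)[OF assms(1)]] subgroup.subset[OF subgroup_G_F] assms(2) by auto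

lemma parahoric_red:
  assumes "\<F> \<in> range (facet D)" "x \<in> parahoric D \<F>"
  shows "matrix_inv x \<in> parahoric D \<F>" "red D \<F> (matrix_inv x) = inv\<^bsub>GL\<^esub> (red D \<F> x)"
    "invertible (red D \<F> x)" "y \<in> parahoric D \<F> \<Longrightarrow> red D \<F> (x ** y) = red D \<F> x ** red D \<F> y"
    "y \<in> parahoric D \<F> \<Longrightarrow> x ** y \<in> parahoric D \<F>"
proof -
  let ?P = "GL_on (parahoric D \<F>)"
  have gh: "group_hom ?P GL (red D \<F>)"
    unfolding group_hom_def group_hom_axioms_def
    using group_parahoric[OF assms(1)] group_GL parahoric_conds(2)[OF assms(1)] by blast
  have i: "inv\<^bsub>?P\<^esub> x = matrix_inv x"
    by (rule inv_GL_on[OF group_parahoric[OF assms(1)] assms(2) parahoric_invertible[OF assms]])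
  show "matrix_inv x \<in> parahoric D \<F>"
    using group.inv_closed[OF group_parahoric[OF assms(1)], of x] assms(2) i by simp
  show "red D \<F> (matrix_inv x) = inv\<^bsub>GL\<^esub> (red D \<F> x)"
    using group_hom.hom_inv[OF gh, of x] assms(2) i by simp
  show "invertible (red D \<F> x)" using group_hom.hom_closed[OF gh, of x] assms(2) by simp
  show "y \<in> parahoric D \<F> \<Longrightarrow> red D \<F> (x ** y) = red D \<F> x ** red D \<F> y"
    using group_hom.hom_mult[OF gh, of x y] assms(2) by simp
  show "y \<in> parahoric D \<F> \<Longrightarrow> x ** y \<in> parahoric D \<F>"
    using monoid.m_closed[OF group.is_monoid[OF group_parahoric[OF assms(1)]], of x y] assms(2) by simp
qed

abbreviation red_UU :: "'v set \<Rightarrow> ('r^'m^'m) set" where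
  "red_UU \<F> \<equiv> generate GL (red D \<F> ` (parahoric D \<F> \<inter> U_F D) \<union> red D \<F> ` (parahoric D \<F> \<inter> Uop_F D))"

lemma red_UU_inv:
  assumes "\<F> \<in> range (facet D)" "x \<in> red_UU \<F>" shows "inv\<^bsub>GL\<^esub> x \<in> red_UU \<F>"
  using parahoric_red(3)[OF assms(1)]
  by (intro group.generate_m_inv_closed[OF group_GL _ assms(2)]) auto

lemma UU_gen_red:
  assumes F: "\<F> \<in> range (facet D)" and m: "m \<in> UU_gen D \<F>"
  shows "m \<in> parahoric D \<F> \<and> red D \<F> m \<in> red_UU \<F>"
  using m unfolding UU_gen_def
proof (induction rule: generate.induct)
  case one
  have "\<one>\<^bsub>GL_on (parahoric D \<F>)\<^esub> \<in> carrier (GL_on (parahoric D \<F>))"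
    by (rule monoid.one_closed[OF group.is_monoid[OF group_parahoric[OF F]]])
  then have o: "mat 1 \<in> parahoric D \<F>" by simp
  have "red D \<F> (mat 1) = \<one>\<^bsub>GL\<^esub>"
    using hom_one[OF parahoric_conds(2)[OF F] group_parahoric[OF F] group_GL] by simp
  then show ?case using o generate.one[of "GL :: ('r^'m^'m) monoid"] by simp
next
  case (incl h)
  then show ?case by (auto intro: generate.incl)
next
  case (inv h)
  then have h: "h \<in> parahoric D \<F>" by auto
  have "red D \<F> h \<in> red D \<F> ` (parahoric D \<F> \<inter> U_F D) \<union> red D \<F> ` (parahoric D \<F> \<inter> Uop_F D)"
    using inv by auto
  then have "inv\<^bsub>GL\<^esub> (red D \<F> h) \<in> red_UU \<F>" by (rule generate.inv)
  then show ?case using parahoric_red(1,2)[OF F h] parahoric_invertible[OF F h] by (simp add: inv_GL)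
next
  case (eng h1 h2)
  then show ?case using parahoric_red(4,5)[OF F, of h1 h2] generate.eng[of _ "GL :: ('r^'m^'m) monoid"] by simp
qed

lemma UU_gen_inv:
  assumes F: "\<F> \<in> range (facet D)" and m: "m \<in> UU_gen D \<F>"
  shows "matrix_inv m \<in> UU_gen D \<F>"
proof -
  have "parahoric D \<F> \<inter> U_F D \<union> parahoric D \<F> \<inter> Uop_F D \<subseteq> carrier GL"
    using parahoric_invertible[OF F] by auto
  from group.generate_m_inv_closed[OF group_GL this, of m] m
  show ?thesis using UU_gen_red[OF F m] parahoric_invertible[OF F] by (simp add: UU_gen_def inv_GL)
qed

lemma facet_of_range: "a \<in> Sig_aff D \<Longrightarrow> facet_of D a \<in> range (facet D)"
  using facet_of_point by blast

text \<open>The element m lies in the parahoric subgroup, has reduction in \<open>red_UU\<close>,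
  and normalizes \<open>H0\<close>, so both conditions defining \<open>Z_aff\<close> survive
  conjugation. This will make c_s commute with T(n_s).\<close>

lemma Z_aff_conj:
  assumes a: "a \<in> Sig_aff D" and m: "m \<in> N_F D" "m \<in> UU_gen D (facet_of D a)" and t: "t \<in> Z_aff D a"
  shows "cls1 D m \<cdot> t \<cdot> inv1 (cls1 D m) \<in> Z_aff D a"
proof -
  let ?F = "facet_of D a"
  have F: "?F \<in> range (facet D)" by (rule facet_of_range[OF a])
  obtain z where z: "z \<in> H0" "t = cls1 D z" "red D ?F z \<in> red_UU ?F" using t unfolding Z_aff_def by blast
  have zp: "z \<in> parahoric D ?F" using z(1) parahoric_conds(3)[OF F] by blast
  have mp: "m \<in> parahoric D ?F" "red D ?F m \<in> red_UU ?F" using UU_gen_red[OF F m(2)] by auto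
  have mi: "matrix_inv m \<in> parahoric D ?F" by (rule parahoric_red(1)[OF F mp(1)])
  have "m ** z ** matrix_inv m \<in> H0"
    using normal.inv_op_closed2[OF normal_H0, of m z] m z by (simp add: inv_GN)
  moreover have "red D ?F (m ** z ** matrix_inv m) = red D ?F m ** red D ?F z ** inv\<^bsub>GL\<^esub> (red D ?F m)"
    using parahoric_red(2,4,5)[OF F] mp zp mi by simp
  moreover have "red D ?F m ** red D ?F z ** inv\<^bsub>GL\<^esub> (red D ?F m) \<in> red_UU ?F"
    using generate.eng[OF generate.eng[OF mp(2) z(3)] red_UU_inv[OF F mp(2)]] by simp
  moreover have "cls1 D m \<cdot> t \<cdot> inv1 (cls1 D m) = cls1 D (m ** z ** matrix_inv m)"
    using m z by (simp add: cls1_mult cls1_inv Z_in_N inv_in_N mult_in_N)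
  ultimately show ?thesis unfolding Z_aff_def by auto
qed

lemma Z_aff_props: assumes "t \<in> Z_aff D a" shows "t \<in> carrier (Wt1 D)" "coset_act D t = id"
proof -
  obtain z where "z \<in> H0" "t = cls1 D z" using assms unfolding Z_aff_def by blast
  then show "t \<in> carrier (Wt1 D)" "coset_act D t = id"
    by (auto simp: carrier_Wt1 Z_in_N coset_act_cls1 apt_H0)
qed

lemma inv_roots_id: "inv_roots id = {}"
  using not_pos_neg by (auto simp: inv_roots_def)

lemma len_trivial_act: "w \<in> carrier (Wt1 D) \<Longrightarrow> coset_act D w = id \<Longrightarrow> len D w = 0"
  by (simp add: len_Wt1 inv_roots_id)

text \<open>As u has no inversions, no hyperplane is crossed twice, so the lengths of u and of its
  inverse add up to that of the identity.\<close>

lemma len_zero_inv: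
  assumes "u \<in> carrier (Wt1 D)" "len D u = 0" shows "len D (inv1 u) = 0"
proof -
  have "inv_roots (coset_act D u) = {}"
    using assms finite_inv_roots[OF act1_in_maps[OF assms(1)]] by (simp add: len_Wt1)
  then have "crossing u (inv1 u) = {}" by (auto simp: crossing_def inv_roots_def)
  then show ?thesis
    using len_mult[OF assms(1), of "inv1 u"] assms by (simp add: len_trivial_act act1_one)
qed

lemma simple_lift:
  assumes "a \<in> simple_aff D"
  obtains m where "m \<in> N_F D" "m \<in> UU_gen D (facet_of D a)" "n_lift D (s_refl D a) = cls1 D m"
    "n_lift D (s_refl D a) \<in> carrier (Wt1 D)" "proj D (n_lift D (s_refl D a)) = s_refl D a"
    "coset_act D (n_lift D (s_refl D a)) = refl_map D a" "len D (n_lift D (s_refl D a)) = 1"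
proof -
  obtain m where m: "m \<in> N_F D" "m \<in> UU_gen D (facet_of D a)" "n_lift D (s_refl D a) = cls1 D m"
    using choices_conds(2) assms by blast
  have aS: "a \<in> Sig_aff D" by (rule simple_Sig_aff[OF assms])
  have s: "s_refl D a \<in> S_aff D" using assms by (simp add: S_aff_def)
  note n = n_lift_props[OF s]
  have act: "coset_act D (n_lift D (s_refl D a)) = refl_map D a"
    using coset_act_proj[OF n(1)] n(2) s_refl(2)[OF aS] by simp
  have "a \<circ> refl_map D a \<in> Sig_aff_neg D"
    using simple_pos[OF assms] by (simp only: root_comp_refl[OF aS] neg_minus)
  then have "len D (n_lift D (s_refl D a)) = 1"
    using inv_roots_step(3)[OF refl_in_maps[OF aS] assms] n(1)
    by (simp add: len_Wt1 act refl_comp_refl[OF aS] inv_roots_id)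
  then show thesis using that m n act by blast
qed

end

locale hecke_alg = grp_data D
  for D :: "('k::alg_closed_field, 'n::finite, 'r::alg_closed_field, 'm::finite, 'v::real_vector) group_data" +
  fixes sc :: "(('k^'n^'n) set, 'c::field) laurent \<Rightarrow> 'h::ring_1 \<Rightarrow> 'h"
    and T :: "('k^'n^'n) set \<Rightarrow> 'h"
  assumes hecke: "is_hecke_algebra D sc T"
begin

lemma hecke_conds:
  "module sc"
  "\<forall>r x y. sc r (x * y) = sc r x * y \<and> sc r (x * y) = x * sc r y"
  "inj_on T (carrier (Wt1 D))"
  "\<not> module.dependent sc (T ` carrier (Wt1 D))"
  "module.span sc (T ` carrier (Wt1 D)) = UNIV"
  "\<forall>w\<in>carrier (Wt1 D). \<forall>w'\<in>carrier (Wt1 D).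
     len D (w \<cdot> w') = len D w + len D w' \<longrightarrow> T w * T w' = T (w \<cdot> w')"
  "\<forall>a\<in>simple_aff D. let s = s_refl D a; n = n_lift D s in
     T n * T n = sc (q_s D s) (T (n \<cdot> n)) + c_s D sc T a * T n"
  using hecke unfolding is_hecke_algebra_def by - (elim conjE, assumption)+

sublocale H: module sc by (rule hecke_conds(1))

lemma sc_mult_left: "sc r x * y = sc r (x * y)" and sc_mult_right: "x * sc r y = sc r (x * y)"
  using hecke_conds(2) by metis+

lemmas T_mult = hecke_conds(6)[rule_format]

text \<open>The relations do not state T(1) = 1. As the identity has length 0, T(1) is a left unit
  on the basis, hence on its span, which contains the unit of the ring.\<close>

lemma T_one: "T \<one>\<^bsub>Wt1 D\<^esub> = 1"
proof -
  have "x \<in> module.span sc (T ` carrier (Wt1 D))" for x using hecke_conds(5) by simp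
  then have "T \<one>\<^bsub>Wt1 D\<^esub> * x = x" for x
  proof (rule H.span_induct)
    show "H.subspace {x. T \<one>\<^bsub>Wt1 D\<^esub> * x = x}"
      by (rule H.subspaceI) (auto simp: distrib_left sc_mult_right)
    fix y assume "y \<in> T ` carrier (Wt1 D)"
    then show "T \<one>\<^bsub>Wt1 D\<^esub> * y = y"
      using T_mult[of "\<one>\<^bsub>Wt1 D\<^esub>"] by (auto simp: len_trivial_act act1_one)
  qed
  from this[of 1] show ?thesis by simp
qed

lemma T_mult_len_zero:
  assumes "w \<in> carrier (Wt1 D)" "u \<in> carrier (Wt1 D)" "coset_act D u = id"
  shows "T w * T u = T (w \<cdot> u)" "T u * T w = T (u \<cdot> w)"
  using assms T_mult[of w u] T_mult[of u w] by (simp_all add: len_trivial_act len_Wt1 act1_mult)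

lemma T_unit_len_zero:
  assumes "u \<in> carrier (Wt1 D)" "len D u = 0" shows "two_sided_unit (T u)"
  unfolding two_sided_unit_def
  using assms T_mult[of u "inv1 u"] T_mult[of "inv1 u" u]
  by (intro exI[of _ "T (inv1 u)"]) (simp add: len_zero_inv T_one len_trivial_act act1_one)

text \<open>With y = T(n_s) the quadratic relation reads y (y - c) = q_s T(n_s^2). The right side is
  a unit: q_s is a monomial in the Laurent scalars, and n_s^2 acts trivially, so it has length
  0.\<close>

lemma T_simple_unit:
  assumes a: "a \<in> simple_aff D" shows "two_sided_unit (T (n_lift D (s_refl D a)))"
proof -
  let ?n = "n_lift D (s_refl D a)"
  obtain m where m: "m \<in> N_F D" "m \<in> UU_gen D (facet_of D a)" "?n = cls1 D m"
    and n: "?n \<in> carrier (Wt1 D)" "coset_act D ?n = refl_map D a"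
    using simple_lift[OF a] by metis
  have aS: "a \<in> Sig_aff D" by (rule simple_Sig_aff[OF a])
  define y where "y = T ?n"
  define c where "c = c_s D sc T a"
  define \<tau> where "\<tau> = T (?n \<cdot> ?n)"
  define r where "r = (q_s D (s_refl D a) :: (('k^'n^'n) set, 'c) laurent)"
  have quad: "y * y = sc r \<tau> + c * y"
    using hecke_conds(7) a unfolding Let_def y_def c_def \<tau>_def r_def by blast
  define \<kappa> where "\<kappa> = (Poly_Mapping.single 0 (- inverse (of_nat (card (Z_aff D a)))) :: (('k^'n^'n) set, 'c) laurent)"
  have c: "c = sc \<kappa> (\<Sum>t\<in>Z_aff D a. T t)" by (simp add: c_def c_s_def \<kappa>_def)
  \<comment> \<open>Moving y past T(t) conjugates t by n_s, which only permutes
    \<open>Z_aff\<close>; thus c commutes with y.\<close>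
  have "(\<Sum>t\<in>Z_aff D a. y * T t) = (\<Sum>t\<in>Z_aff D a. T t * y)"
  proof (rule sum.reindex_bij_witness[where
        i = "\<lambda>t. inv1 ?n \<cdot> t \<cdot> ?n" and
        j = "\<lambda>t. ?n \<cdot> t \<cdot> inv1 ?n"])
    fix t assume t: "t \<in> Z_aff D a"
    note tc = Z_aff_props[OF t]
    show "?n \<cdot> t \<cdot> inv1 ?n \<in> Z_aff D a"
      using Z_aff_conj[OF aS m(1,2) t] m(3) by simp
    have mi: "matrix_inv m \<in> UU_gen D (facet_of D a)"
      by (rule UU_gen_inv[OF facet_of_range[OF aS] m(2)])
    have "cls1 D (matrix_inv m) = inv1 ?n" using m by (simp add: cls1_inv)
    then show "inv1 ?n \<cdot> t \<cdot> ?n \<in> Z_aff D a"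
      using Z_aff_conj[OF aS inv_in_N[OF m(1)] mi t] n(1) by simp
    show "inv1 ?n \<cdot> (?n \<cdot> t \<cdot> inv1 ?n) \<cdot> ?n = t"
      using n(1) tc(1) by (simp add: W1.m_assoc) (simp add: W1.m_assoc[symmetric])
    show "?n \<cdot> (inv1 ?n \<cdot> t \<cdot> ?n) \<cdot> inv1 ?n = t"
      using n(1) tc(1) by (simp add: W1.m_assoc) (simp add: W1.m_assoc[symmetric])
    have j: "?n \<cdot> t \<cdot> inv1 ?n \<in> Z_aff D a" by fact
    have "T (?n \<cdot> t \<cdot> inv1 ?n) * y = T ((?n \<cdot> t \<cdot> inv1 ?n) \<cdot> ?n)"
      unfolding y_def by (rule T_mult_len_zero(2)[OF n(1) Z_aff_props[OF j]])
    also have "(?n \<cdot> t \<cdot> inv1 ?n) \<cdot> ?n = ?n \<cdot> t"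
      using n(1) tc(1) by (simp add: W1.m_assoc)
    finally show "T (?n \<cdot> t \<cdot> inv1 ?n) * y = y * T t"
      using T_mult_len_zero(1)[OF n(1) tc] by (simp add: y_def)
  qed
  then have yc: "y * c = c * y"
    by (simp add: c sc_mult_left sc_mult_right sum_distrib_left sum_distrib_right)
  have act: "coset_act D (?n \<cdot> ?n) = id" using n by (simp add: act1_mult refl_comp_refl[OF aS])
  have "two_sided_unit \<tau>"
    unfolding \<tau>_def using n act by (intro T_unit_len_zero) (simp_all add: len_trivial_act)
  then obtain \<tau>' where t: "\<tau> * \<tau>' = 1" "\<tau>' * \<tau> = 1" unfolding two_sided_unit_def by blast
  define k where "k = Poly_Mapping.single (q_index D (s_refl D a)) (1::int)"
  have "Poly_Mapping.single k (1::'c) * Poly_Mapping.single (- k) 1 = 1" by (simp add: mult_single)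
  then have "r * (Poly_Mapping.single (- k) 1)\<^sup>2 = 1"
    unfolding r_def q_s_def k_def[symmetric] by (metis power_mult_distrib power_one)
  then obtain r' where r: "r * r' = 1" "r' * r = 1" by (auto simp: mult.commute)
  have s: "(sc r \<tau>) * (sc r' \<tau>') = 1" "(sc r' \<tau>') * (sc r \<tau>) = 1"
    using r t by (simp_all add: sc_mult_left sc_mult_right)
  have e: "y * (y - c) = sc r \<tau>" "(y - c) * y = sc r \<tau>"
    using quad yc by (simp_all add: algebra_simps)
  have 1: "y * ((y - c) * sc r' \<tau>') = 1" using e(1) s(1) by (simp add: mult.assoc[symmetric])
  have 2: "(sc r' \<tau>' * (y - c)) * y = 1" using e(2) s(2) by (simp add: mult.assoc)
  have "sc r' \<tau>' * (y - c) = (sc r' \<tau>' * (y - c)) * (y * ((y - c) * sc r' \<tau>'))" using 1 by simp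
  also have "\<dots> = (y - c) * sc r' \<tau>'" using 2 by (simp add: mult.assoc[symmetric])
  finally show ?thesis using 1 2 unfolding two_sided_unit_def y_def by auto
qed

text \<open>Induction on the length: a simple lift is split off on the left so that lengths add, and
  T is multiplicative there.\<close>

lemma T_unit: "w \<in> carrier (Wt1 D) \<Longrightarrow> two_sided_unit (T w)"
proof (induction "len D w" arbitrary: w)
  case 0
  then show ?case by (simp add: T_unit_len_zero)
next
  case (Suc l)
  have pw: "proj D w \<in> carrier (Wt D)" "coset_act D (proj D w) = coset_act D w"
    using Suc.prems proj_closed coset_act_proj by auto
  have lw: "len D (proj D w) = len D w" using Suc.prems pw by (simp add: len_Wt len_Wt1)
  obtain a where a: "a \<in> simple_aff D" "len D (proj D w) = Suc (len D (s_refl D a \<star> proj D w))"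
    using len_pos_step[OF pw(1)] lw Suc.hyps(2) by auto
  let ?n = "n_lift D (s_refl D a)"
  have n: "?n \<in> carrier (Wt1 D)" "coset_act D ?n = refl_map D a" "len D ?n = 1"
    using simple_lift[OF a(1)] by metis+
  have aS: "a \<in> Sig_aff D" by (rule simple_Sig_aff[OF a(1)])
  define w' where "w' = inv1 ?n \<cdot> w"
  have w': "w' \<in> carrier (Wt1 D)" "w = ?n \<cdot> w'"
    using n(1) Suc.prems by (simp_all add: w'_def W1.m_assoc[symmetric])
  have "coset_act D (inv1 ?n) = refl_map D a \<circ> refl_map D a \<circ> coset_act D (inv1 ?n)"
    by (simp add: refl_comp_refl[OF aS])
  also have "\<dots> = refl_map D a" using act1_inv(1)[OF n(1)] n(2) by (simp only: comp_assoc comp_id)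
  finally have "coset_act D w' = coset_act D (s_refl D a \<star> proj D w)"
    using n(1) Suc.prems pw by (simp add: w'_def act1_mult s_refl_act[OF aS])
  then have "len D w' = len D (s_refl D a \<star> proj D w)"
    using w' pw by (simp add: len_Wt len_Wt1 s_refl_Wt[OF aS])
  then have len: "len D w = Suc (len D w')" using a(2) lw by simp
  then have "two_sided_unit (T w')" using Suc.hyps w' by simp
  moreover have "T ?n * T w' = T w" using T_mult[OF n(1) w'(1)] w'(2) len n(3) by simp
  ultimately show ?case using two_sided_unit_mult(1)[OF T_simple_unit[OF a(1)]] by metis
qed

end

section \<open>Bernstein elements\<close>

context grp_data
begin

lemma proj_Lam1: "l \<in> Lam1 D \<Longrightarrow> proj D l \<in> Lam D"
  by (auto simp: Lam1_def Lam_def proj_cls1 Z_in_N)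

lemma antidominant_one: "antidominant D \<one>\<^bsub>Wt1 D\<^esub>"
  unfolding antidominant_def nu_one
proof
  fix \<alpha> assume "\<alpha> \<in> Sig_pos D"
  from Sig_zero[OF Sig_pos_subset[OF this]] show "\<alpha> 0 \<le> 0" by simp
qed

lemma antidominant_mult:
  assumes "l \<in> Lam1 D" "m \<in> Lam1 D" "antidominant D l" "antidominant D m"
  shows "antidominant D (l \<cdot> m)"
  unfolding antidominant_def
proof
  fix \<alpha> assume a: "\<alpha> \<in> Sig_pos D"
  then have "\<alpha> (nu D l) \<le> 0" "\<alpha> (nu D m) \<le> 0" using assms(3,4) unfolding antidominant_def by blast+
  then show "\<alpha> (nu D (l \<cdot> m)) \<le> 0"
    by (simp add: nu_mult assms(1,2) linear_add[OF Sig_linear[OF Sig_pos_subset[OF a]]])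
qed

lemma Lam1_mult: "l \<in> Lam1 D \<Longrightarrow> m \<in> Lam1 D \<Longrightarrow> l \<cdot> m \<in> Lam1 D"
  and Lam1_inv: "l \<in> Lam1 D \<Longrightarrow> inv1 l \<in> Lam1 D"
  and Lam1_one: "\<one>\<^bsub>Wt1 D\<^esub> \<in> Lam1 D"
  using subgroup.m_closed[OF subgroup_Lam1] subgroup.m_inv_closed[OF subgroup_Lam1]
    subgroup.one_closed[OF subgroup_Lam1] by auto

lemma antidominant_quotient:
  assumes "l \<in> Lam1 D"
  obtains l1 l2 where "l1 \<in> Lam1 D" "l2 \<in> Lam1 D" "antidominant D l1" "antidominant D l2"
    "l = l1 \<cdot> inv1 l2"
proof -
  obtain m where m: "m \<in> Lam1 D" "antidominant D m" "antidominant D (l \<cdot> m)"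
    using antidominant_multiplier[of "{l}"] assms by auto
  have "l = (l \<cdot> m) \<cdot> inv1 m"
    using assms m(1) by (simp add: Lam1_closed W1.m_assoc)
  then show thesis using that[of "l \<cdot> m" m] assms m by (simp add: Lam1_mult)
qed

lemma nu_conj_Lam1':
  assumes "l \<in> Lam1 D" "m \<in> Lam1 D"
  shows "nu D (inv1 m \<cdot> l \<cdot> m) = nu D l"
  using nu_conj_Lam1[OF assms(1) Lam1_inv[OF assms(2)]] Lam1_closed[OF assms(2)] by simp

end

context hecke_alg
begin

abbreviation qm :: "(('k^'n^'n) set set \<Rightarrow>\<^sub>0 int) \<Rightarrow> (('k^'n^'n) set, 'c) laurent" where
  "qm k \<equiv> Poly_Mapping.single k 1"

abbreviation E where "E \<equiv> bernstein D sc T"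

lemma qm_inverse: "qm k * qm (- k) = 1"
  by (simp add: mult_single)

lemma T_antidominant_mult:
  assumes "l \<in> Lam1 D" "m \<in> Lam1 D" "antidominant D l" "antidominant D m"
  shows "T (l \<cdot> m) = T l * T m"
  using T_mult[of l m] half_exp_antidominant(2)[OF assms] assms Lam1_closed by simp

lemma T_Lam1_unit: "l \<in> Lam1 D \<Longrightarrow> two_sided_unit (T l)"
  by (rule T_unit[OF Lam1_closed])

lemmas T_Lam1_inverse = ring_inverse_props[OF T_Lam1_unit]

text \<open>\<open>\<Lambda>(1)\<close> need not be commutative, but conjugation by \<open>\<Lambda>(1)\<close> preserves \<open>\<nu>\<close>, so that antidominant
  elements can be moved past each other at the cost of a conjugation.\<close>

lemma T_conj:
  assumes "l \<in> Lam1 D" "m \<in> Lam1 D" "antidominant D l" "antidominant D m"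
    and c: "c = inv1 l \<cdot> m \<cdot> l"
  shows "c \<in> Lam1 D" "antidominant D c" "half_exp D c = half_exp D m" "l \<cdot> c = m \<cdot> l"
    "T l * T c = T m * T l" "ring_inverse (T l) * T m = T c * ring_inverse (T l)"
proof -
  show cL: "c \<in> Lam1 D" unfolding c by (rule Lam1_conj'[OF assms(2) Lam1_closed[OF assms(1)]])
  have nu: "nu D c = nu D m" unfolding c by (rule nu_conj_Lam1'[OF assms(2,1)])
  show ca: "antidominant D c" using assms(4) nu by (simp add: antidominant_def)
  show "half_exp D c = half_exp D m" by (rule half_exp_cong[OF cL assms(2) nu])
  show e: "l \<cdot> c = m \<cdot> l"
    using assms(1,2)[THEN Lam1_closed] by (simp add: c W1.m_assoc[symmetric])
  show t: "T l * T c = T m * T l"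
    using T_antidominant_mult[OF assms(1) cL assms(3) ca] T_antidominant_mult[OF assms(2,1,4,3)] e by simp
  have "ring_inverse (T l) * T m = ring_inverse (T l) * (T m * T l) * ring_inverse (T l)"
    using T_Lam1_inverse[OF assms(1)] by (simp add: mult.assoc)
  also have "\<dots> = (ring_inverse (T l) * T l) * T c * ring_inverse (T l)"
    by (simp only: t[symmetric] mult.assoc)
  finally show "ring_inverse (T l) * T m = T c * ring_inverse (T l)"
    using T_Lam1_inverse[OF assms(1)] by simp
qed

text \<open>With c the conjugate of m2 by l2, the identities l1 c = m1 l2 and l2 c = m2 l2 bring
  both quotients to a common denominator inside the antidominant cone, where T and
  \<open>half_exp\<close> turn products into products and sums.\<close>

lemma bernstein_indep:
  assumes l: "l1 \<in> Lam1 D" "l2 \<in> Lam1 D" "antidominant D l1" "antidominant D l2"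
    and m: "m1 \<in> Lam1 D" "m2 \<in> Lam1 D" "antidominant D m1" "antidominant D m2"
    and eq: "l1 \<cdot> inv1 l2 = m1 \<cdot> inv1 m2"
  shows "T l1 * ring_inverse (T l2) = T m1 * ring_inverse (T m2)"
    "half_exp D l2 - half_exp D l1 = half_exp D m2 - half_exp D m1"
proof -
  define c where "c = inv1 l2 \<cdot> m2 \<cdot> l2"
  note c = T_conj[OF l(2) m(2) l(4) m(4) c_def]
  note cl = l(1,2)[THEN Lam1_closed] m(1,2)[THEN Lam1_closed]
  have "l1 \<cdot> c = (l1 \<cdot> inv1 l2) \<cdot> (m2 \<cdot> l2)"
    using cl by (simp add: c_def W1.m_assoc)
  also have "\<dots> = m1 \<cdot> (inv1 m2 \<cdot> m2) \<cdot> l2"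
    unfolding eq using cl by (simp only: W1.m_assoc W1.m_closed W1.inv_closed)
  finally have e: "l1 \<cdot> c = m1 \<cdot> l2" using cl by simp
  have "half_exp D l1 + half_exp D m2 = half_exp D m1 + half_exp D l2"
    using half_exp_antidominant(1)[OF l(1) c(1) l(3) c(2)] half_exp_antidominant(1)[OF m(1) l(2) m(3) l(4)] e c(3)
    by simp
  then show "half_exp D l2 - half_exp D l1 = half_exp D m2 - half_exp D m1" by (simp add: algebra_simps)
  have t: "T l1 * T c = T m1 * T l2"
    using T_antidominant_mult[OF l(1) c(1) l(3) c(2)] T_antidominant_mult[OF m(1) l(2) m(3) l(4)] e by simp
  have "T l1 * ring_inverse (T l2) = T l1 * ring_inverse (T l2) * (T m2 * ring_inverse (T m2))"
    using T_Lam1_inverse[OF m(2)] by simp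
  also have "\<dots> = T l1 * (ring_inverse (T l2) * T m2) * ring_inverse (T m2)" by (simp only: mult.assoc)
  also have "\<dots> = (T l1 * T c) * ring_inverse (T l2) * ring_inverse (T m2)" by (simp only: c(6) mult.assoc)
  also have "\<dots> = T m1 * (T l2 * ring_inverse (T l2)) * ring_inverse (T m2)" by (simp only: t mult.assoc)
  finally show "T l1 * ring_inverse (T l2) = T m1 * ring_inverse (T m2)"
    using T_Lam1_inverse[OF l(2)] by simp
qed

text \<open>\<open>bernstein\<close> may choose any presentation of x. For x in \<Lambda>(1) its
  factor \<open>n_w D w\<close> lies in \<Lambda>(1) as well, so w lies in both W and \<Lambda> and
  is trivial; the antidominant quotient that remains is covered by
  \<open>bernstein_indep\<close>.\<close>

lemma bernstein_eq:
  assumes l: "l1 \<in> Lam1 D" "l2 \<in> Lam1 D" "antidominant D l1" "antidominant D l2"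
    and x: "x = l1 \<cdot> inv1 l2"
  shows "E x = sc (qm (half_exp D x + (half_exp D l2 - half_exp D l1))) (T l1 * ring_inverse (T l2))"
  unfolding bernstein_def
proof (rule some_equality)
  have v: "sc (q_half D x * q_half_inv D m1 * q_half D m2 * q_half_inv D (n_w D \<one>\<^bsub>Wt D\<^esub>))
        (T m1 * ring_inverse (T m2) * T (n_w D \<one>\<^bsub>Wt D\<^esub>)) =
      sc (qm (half_exp D x + (half_exp D m2 - half_exp D m1))) (T m1 * ring_inverse (T m2))" for m1 m2
    by (simp add: q_half_def q_half_inv_def n_w_one half_exp_one T_one mult_single)
      (simp add: algebra_simps)
  show "\<exists>m1\<in>Lam1 D. \<exists>m2\<in>Lam1 D. \<exists>w\<in>Wsp D. antidominant D m1 \<and> antidominant D m2 \<and>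
      x = m1 \<cdot> inv1 m2 \<cdot> n_w D w \<and>
      sc (qm (half_exp D x + (half_exp D l2 - half_exp D l1))) (T l1 * ring_inverse (T l2)) =
      sc (q_half D x * q_half_inv D m1 * q_half D m2 * q_half_inv D (n_w D w))
        (T m1 * ring_inverse (T m2) * T (n_w D w))"
    using l x Wsp_one v[of l1 l2]
    by (intro bexI[of _ l1] bexI[of _ l2] bexI[of _ "\<one>\<^bsub>Wt D\<^esub>"]) (simp_all add: n_w_one Lam1_closed)
  fix e
  assume "\<exists>m1\<in>Lam1 D. \<exists>m2\<in>Lam1 D. \<exists>w\<in>Wsp D. antidominant D m1 \<and> antidominant D m2 \<and>
      x = m1 \<cdot> inv1 m2 \<cdot> n_w D w \<and>
      e = sc (q_half D x * q_half_inv D m1 * q_half D m2 * q_half_inv D (n_w D w))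
        (T m1 * ring_inverse (T m2) * T (n_w D w))"
  then obtain m1 m2 w where m: "m1 \<in> Lam1 D" "m2 \<in> Lam1 D" "w \<in> Wsp D" "antidominant D m1" "antidominant D m2"
      "x = m1 \<cdot> inv1 m2 \<cdot> n_w D w"
      "e = sc (q_half D x * q_half_inv D m1 * q_half D m2 * q_half_inv D (n_w D w))
        (T m1 * ring_inverse (T m2) * T (n_w D w))" by blast
  have nc: "n_w D w \<in> carrier (Wt1 D)" by (rule n_w_props(1)[OF m(3)])
  have mL: "m1 \<cdot> inv1 m2 \<in> Lam1 D" by (rule Lam1_mult[OF m(1) Lam1_inv[OF m(2)]])
  have "n_w D w = inv1 (m1 \<cdot> inv1 m2) \<cdot> x"
    unfolding m(6) using nc Lam1_closed[OF mL] by (simp add: W1.m_assoc[symmetric])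
  moreover have "x \<in> Lam1 D" unfolding x by (rule Lam1_mult[OF l(1) Lam1_inv[OF l(2)]])
  ultimately have "n_w D w \<in> Lam1 D" using Lam1_mult[OF Lam1_inv[OF mL]] by simp
  then have "w \<in> Lam D" using proj_Lam1 n_w_props(2)[OF m(3)] by metis
  then have w: "w = \<one>\<^bsub>Wt D\<^esub>" using m(3) weyl_conds(2) by blast
  have xm: "l1 \<cdot> inv1 l2 = m1 \<cdot> inv1 m2"
    using m(6) x Lam1_closed[OF mL] by (simp add: w n_w_one)
  show "e = sc (qm (half_exp D x + (half_exp D l2 - half_exp D l1))) (T l1 * ring_inverse (T l2))"
    unfolding m(7) w v using bernstein_indep[OF l m(1,2,4,5) xm] by simp
qed

lemma bernstein_antidominant:
  assumes "l \<in> Lam1 D" "antidominant D l" shows "E l = T l"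
proof -
  have "ring_inverse 1 = (1 :: 'h)" by (rule ring_inverse_eqI) auto
  then show ?thesis
    using bernstein_eq[OF assms(1) Lam1_one assms(2) antidominant_one, of l] Lam1_closed[OF assms(1)]
    by (simp add: half_exp_one T_one)
qed

lemma bernstein_one: "E \<one>\<^bsub>Wt1 D\<^esub> = 1"
  by (simp add: bernstein_antidominant Lam1_one antidominant_one T_one)

text \<open>With c the conjugate of m1 by l2, the product of the two quotients is the quotient of l1
  c by m2 l2. On the T-parts this holds without any scalar, so the only scalar is the defect of the
  normalizing exponents, which is the crossing term.\<close>

lemma bernstein_mult:
  assumes "l \<in> Lam1 D" "m \<in> Lam1 D"
  shows "E l * E m = sc (qm (crossing_exp l m + crossing_exp l m)) (E (l \<cdot> m))"
proof -
  obtain l1 l2 where l: "l1 \<in> Lam1 D" "l2 \<in> Lam1 D" "antidominant D l1" "antidominant D l2"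
    "l = l1 \<cdot> inv1 l2" by (rule antidominant_quotient[OF assms(1)])
  obtain m1 m2 where m: "m1 \<in> Lam1 D" "m2 \<in> Lam1 D" "antidominant D m1" "antidominant D m2"
    "m = m1 \<cdot> inv1 m2" by (rule antidominant_quotient[OF assms(2)])
  define c where "c = inv1 l2 \<cdot> m1 \<cdot> l2"
  note c = T_conj[OF l(2) m(1) l(4) m(3) c_def]
  note cl = l(1,2)[THEN Lam1_closed] m(1,2)[THEN Lam1_closed] c(1)[THEN Lam1_closed]
  let ?a = "l1 \<cdot> c" and ?b = "m2 \<cdot> l2"
  have a: "?a \<in> Lam1 D" "antidominant D ?a" "T ?a = T l1 * T c" "half_exp D ?a = half_exp D l1 + half_exp D m1"
    using l(1,3) c(1-3) by (simp_all add: Lam1_mult antidominant_mult T_antidominant_mult half_exp_antidominant)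
  have b: "?b \<in> Lam1 D" "antidominant D ?b" "T ?b = T m2 * T l2" "half_exp D ?b = half_exp D m2 + half_exp D l2"
    using m(2,4) l(2,4) by (simp_all add: Lam1_mult antidominant_mult T_antidominant_mult half_exp_antidominant)
  have "?a \<cdot> inv1 ?b =
      l1 \<cdot> (c \<cdot> inv1 l2) \<cdot> inv1 m2"
    using cl by (simp add: W1.inv_mult_group W1.m_assoc)
  also have "c \<cdot> inv1 l2 = inv1 l2 \<cdot> m1"
    using cl by (simp add: c_def W1.m_assoc)
  finally have lm: "l \<cdot> m = ?a \<cdot> inv1 ?b"
    using cl by (simp add: l(5) m(5) W1.m_assoc)
  have "(T l1 * ring_inverse (T l2)) * (T m1 * ring_inverse (T m2)) =
      T l1 * (ring_inverse (T l2) * T m1) * ring_inverse (T m2)" by (simp only: mult.assoc)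
  also have "\<dots> = T ?a * (ring_inverse (T l2) * ring_inverse (T m2))" by (simp only: c(6) a(3) mult.assoc)
  also have "ring_inverse (T l2) * ring_inverse (T m2) = ring_inverse (T ?b)"
    unfolding b(3) using two_sided_unit_mult(2)[OF T_Lam1_unit[OF m(2)] T_Lam1_unit[OF l(2)]] by simp
  finally have t: "(T l1 * ring_inverse (T l2)) * (T m1 * ring_inverse (T m2)) = T ?a * ring_inverse (T ?b)" .
  let ?el = "half_exp D l + (half_exp D l2 - half_exp D l1)" and ?em = "half_exp D m + (half_exp D m2 - half_exp D m1)"
  have "?el + ?em = (crossing_exp l m + crossing_exp l m) +
      (half_exp D (l \<cdot> m) + (half_exp D ?b - half_exp D ?a))"
    using half_exp_mult[OF assms[THEN Lam1_closed]] unfolding a(4) b(4) by (simp add: algebra_simps)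
  then have q: "qm ?el * qm ?em = qm (crossing_exp l m + crossing_exp l m) *
      qm (half_exp D (l \<cdot> m) + (half_exp D ?b - half_exp D ?a))"
    by (simp add: mult_single)
  have "E l * E m = sc (qm ?el * qm ?em) ((T l1 * ring_inverse (T l2)) * (T m1 * ring_inverse (T m2)))"
    unfolding bernstein_eq[OF l] bernstein_eq[OF m] by (simp add: sc_mult_left sc_mult_right mult.commute)
  also have "\<dots> = sc (qm (crossing_exp l m + crossing_exp l m)) (E (l \<cdot> m))"
    unfolding q t bernstein_eq[OF a(1) b(1) a(2) b(2) lm] by simp
  finally show ?thesis .
qed

section \<open>Linear independence of the Bernstein elements\<close>

lemma T_independent:
  assumes A: "finite A" "A \<subseteq> carrier (Wt1 D)" and s: "(\<Sum>w\<in>A. sc (r w) (T w)) = 0" and w: "w \<in> A"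
  shows "r w = 0"
proof -
  have inj: "inj_on T A" using hecke_conds(3) A(2) by (rule inj_on_subset)
  define u where "u = r \<circ> inv_into A T"
  have "(\<Sum>v\<in>T ` A. sc (u v) v) = (\<Sum>w\<in>A. sc (u (T w)) (T w))"
    by (subst sum.reindex[OF inj]) simp
  also have "\<dots> = 0" using s by (simp add: u_def inv_into_f_f[OF inj] cong: sum.cong)
  finally have "u (T w) = 0"
    using H.independentD[OF hecke_conds(4), of "T ` A" u "T w"] A w by auto
  then show ?thesis by (simp add: u_def inv_into_f_f[OF inj w])
qed

lemma qm_cancel: assumes "r * qm k = 0" shows "r = 0"
proof -
  have "r * (qm k * qm (- k)) = (r * qm k) * qm (- k)" by (simp only: mult.assoc)
  then show ?thesis unfolding qm_inverse assms by simp
qed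

text \<open>The relation is multiplied by T(m) with m so antidominant that every l m is
  antidominant. Each E(l) T(m) is then a monomial times T(l m), and these are distinct basis
  elements.\<close>

lemma bernstein_lincomb_zero:
  assumes L: "finite L" "L \<subseteq> Lam1 D" and s: "(\<Sum>l\<in>L. sc (r l) (E l)) = 0" and l: "l \<in> L"
  shows "r l = 0"
proof -
  obtain m where m: "m \<in> Lam1 D" "antidominant D m" "\<forall>l\<in>L. antidominant D (l \<cdot> m)"
    using antidominant_multiplier[OF L] by blast
  define k where "k x = crossing_exp x m + crossing_exp x m" for x
  have e: "sc (r x) (E x) * T m = sc (r x * qm (k x)) (T (x \<cdot> m))" if "x \<in> L" for x
  proof -
    have x: "x \<in> Lam1 D" using L that by blast
    have "E x * T m = sc (qm (k x)) (T (x \<cdot> m))"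
      using bernstein_mult[OF x m(1)] bernstein_antidominant[OF m(1,2)]
        bernstein_antidominant[OF Lam1_mult[OF x m(1)]] m(3) that by (simp add: k_def)
    then show ?thesis by (simp add: sc_mult_left)
  qed
  have inj: "inj_on (\<lambda>x. x \<cdot> m) L"
    using L(2) m(1) by (intro inj_onI) (simp add: Lam1_closed subset_eq)
  define u where "u y = r (y \<cdot> inv1 m) * qm (k (y \<cdot> inv1 m))" for y
  have u: "u (x \<cdot> m) = r x * qm (k x)" if "x \<in> L" for x
  proof -
    have "x \<in> carrier (Wt1 D)" "m \<in> carrier (Wt1 D)" using that L m(1) Lam1_closed by auto
    then have "x \<cdot> m \<cdot> inv1 m = x" by (simp add: W1.m_assoc)
    then show ?thesis by (simp add: u_def)
  qed
  have "(\<Sum>y\<in>(\<lambda>x. x \<cdot> m) ` L. sc (u y) (T y)) = (\<Sum>x\<in>L. sc (r x) (E x) * T m)"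
    by (subst sum.reindex[OF inj]) (simp add: u e)
  also have "\<dots> = (\<Sum>x\<in>L. sc (r x) (E x)) * T m" by (rule sum_distrib_right[symmetric])
  finally have "(\<Sum>y\<in>(\<lambda>x. x \<cdot> m) ` L. sc (u y) (T y)) = 0" using s by simp
  moreover have "(\<lambda>x. x \<cdot> m) ` L \<subseteq> carrier (Wt1 D)"
    using L m(1) Lam1_closed Lam1_mult by blast
  ultimately have "u (l \<cdot> m) = 0" using T_independent L(1) l by blast
  then show ?thesis using u[OF l] qm_cancel by metis
qed

lemma bernstein_inj: "inj_on E (Lam1 D)"
proof (rule inj_onI, rule ccontr)
  fix l m assume lm: "l \<in> Lam1 D" "m \<in> Lam1 D" "E l = E m" "l \<noteq> m"
  define r where "r x = (if x = l then 1 else - 1 :: (('k^'n^'n) set, 'c) laurent)" for x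
  have "(\<Sum>x\<in>{l, m}. sc (r x) (E x)) = 0"
    using lm by (simp add: r_def H.scale_minus_left)
  from bernstein_lincomb_zero[OF _ _ this, of l] have "r l = 0" using lm by auto
  then show False by (simp add: r_def)
qed

lemma bernstein_independent: "H.independent (E ` Lam1 D)"
  unfolding H.independent_explicit_module
proof (intro allI impI)
  fix t u v assume t: "finite t" "t \<subseteq> E ` Lam1 D" "(\<Sum>v\<in>t. sc (u v) v) = 0" "v \<in> t"
  obtain L where L: "L \<subseteq> Lam1 D" "finite L" "t = E ` L" using finite_subset_image[OF t(1,2)] by blast
  have inj: "inj_on E L" using bernstein_inj L(1) by (rule inj_on_subset)
  have "(\<Sum>l\<in>L. sc (u (E l)) (E l)) = 0" using t(3) unfolding L(3) by (subst (asm) sum.reindex[OF inj]) simp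
  moreover obtain l where "l \<in> L" "v = E l" using t(4) L(3) by blast
  ultimately show "u v = 0" using bernstein_lincomb_zero[OF L(2,1), of "\<lambda>l. u (E l)" l] by simp
qed

text \<open>Independence and injectivity of E make the coordinates of E(l) an indicator, so the sum
  in \<open>extend_from_E\<close> has a single term, with coefficient 1.\<close>

lemma extend_from_E_bernstein:
  assumes "l \<in> Lam1 D" shows "extend_from_E D sc T \<phi> (E l) = \<phi> l"
proof -
  have rep: "module.representation sc (E ` Lam1 D) (E l) = (\<lambda>v. if v = E l then 1 else 0)"
    using H.representation_basis[OF bernstein_independent] assms by blast
  have "{m. m \<in> Lam1 D \<and> module.representation sc (E ` Lam1 D) (E l) (E m) \<noteq> 0} = {l}"
    using assms inj_onD[OF bernstein_inj] by (auto simp: rep)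
  moreover have "ga_scale 1 f = f" for f :: "('k^'n^'n) set \<Rightarrow>\<^sub>0 'c"
    by (rule poly_mapping_eqI) (simp add: ga_scale_def Poly_Mapping.map.rep_eq when_def)
  moreover have "q_zero (1 :: (('k^'n^'n) set, 'c) laurent) = 1" by (simp add: q_zero_def)
  ultimately show ?thesis by (simp add: extend_from_E_def Let_def rep)
qed

end

section \<open>Weyl chambers\<close>

context grp_data
begin

lemma Sig_is_aff: "\<alpha> \<in> Sig D \<Longrightarrow> \<alpha> \<in> Sig_aff D"
  and grad_Sig: "\<alpha> \<in> Sig D \<Longrightarrow> grad \<alpha> = \<alpha>"
  by (simp_all add: Sig_aff_iff grad_def Sig_zero)

lemma Sig_Wsp: assumes "\<alpha> \<in> Sig D" "w \<in> Wsp D" shows "\<alpha> \<circ> coset_act D w \<in> Sig D"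
proof -
  have "\<alpha> \<circ> coset_act D w \<in> Sig_aff D"
    using maps_Sig_aff[OF act_in_maps[OF Wsp_closed[OF assms(2)]] Sig_is_aff[OF assms(1)]] .
  moreover have "(\<alpha> \<circ> coset_act D w) 0 = 0" using assms by (simp add: Wsp_def Sig_zero)
  ultimately show ?thesis by (simp add: Sig_aff_iff grad_def comp_def)
qed

text \<open>A symmetric form invariant under reflections. It may be degenerate, since the roots need
  not span the dual space.\<close>

definition root_form :: "'v \<Rightarrow> 'v \<Rightarrow> real" where
  "root_form u y = (\<Sum>\<beta>\<in>Sig D. \<beta> u * \<beta> y)"

lemma root_form_line:
  "root_form (u - t *\<^sub>R z) y = root_form u y - t * root_form z y"
  "root_form y (u - t *\<^sub>R z) = root_form y u - t * root_form y z"
proof -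
  have l: "\<beta> (u - t *\<^sub>R z) = \<beta> u - t * \<beta> z" if "\<beta> \<in> Sig D" for \<beta>
    using linear_diff[OF Sig_linear[OF that]] linear_scale[OF Sig_linear[OF that]] by simp
  show "root_form (u - t *\<^sub>R z) y = root_form u y - t * root_form z y"
    "root_form y (u - t *\<^sub>R z) = root_form y u - t * root_form y z"
    by (simp_all add: root_form_def l sum_distrib_left algebra_simps flip: sum_subtractf)
qed

lemma root_form_refl:
  assumes a: "\<alpha> \<in> Sig D"
  shows "root_form (refl_map D \<alpha> u) (refl_map D \<alpha> y) = root_form u y"
proof -
  let ?r = "refl_map D \<alpha>"
  have rr: "?r \<circ> ?r = id" by (rule refl_comp_refl[OF Sig_is_aff[OF a]])
  have r0: "?r 0 = 0" using a by (simp add: refl_map_alt Sig_zero)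
  have S: "\<beta> \<circ> ?r \<in> Sig D" if "\<beta> \<in> Sig D" for \<beta>
  proof -
    have "\<beta> \<circ> ?r \<in> Sig_aff D"
      by (rule maps_Sig_aff[OF refl_in_maps[OF Sig_is_aff[OF a]] Sig_is_aff[OF that]])
    then show ?thesis using that by (simp add: Sig_aff_iff grad_def comp_def r0 Sig_zero)
  qed
  have c: "\<beta> \<circ> ?r \<circ> ?r = \<beta>" for \<beta> :: "'v \<Rightarrow> real" by (simp only: comp_assoc rr comp_id)
  show ?thesis unfolding root_form_def
    by (rule sum.reindex_bij_witness[where i = "\<lambda>\<beta>. \<beta> \<circ> ?r" and j = "\<lambda>\<beta>. \<beta> \<circ> ?r"])
      (use S c in \<open>auto simp only: comp_apply\<close>)
qed

text \<open>The reflection sends the coroot c to -c, so invariance gives (c, y) = (-c, y -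
  \<alpha>(y) c). Positivity comes from the summand \<alpha>(c)^2 = 4.\<close>

lemma root_form_coroot:
  assumes a: "\<alpha> \<in> Sig D"
  shows "2 * root_form (coroot D \<alpha>) y = \<alpha> y * root_form (coroot D \<alpha>) (coroot D \<alpha>)"
    and "root_form (coroot D \<alpha>) (coroot D \<alpha>) > 0"
proof -
  let ?c = "coroot D \<alpha>"
  have r: "refl_map D \<alpha> u = u - \<alpha> u *\<^sub>R ?c" for u using a by (simp add: refl_map_alt grad_Sig)
  have m: "refl_map D \<alpha> ?c = 0 - 1 *\<^sub>R ?c" using coroot_two[OF a] by (simp add: r scaleR_2)
  have z: "root_form 0 u = 0" for u by (simp add: root_form_def Sig_zero)
  have "root_form ?c y = root_form (0 - 1 *\<^sub>R ?c) (y - \<alpha> y *\<^sub>R ?c)"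
    using root_form_refl[OF a, of ?c y] m r[of y] by simp
  then show "2 * root_form ?c y = \<alpha> y * root_form ?c ?c"
    unfolding root_form_line z by simp
  have "0 < \<alpha> ?c * \<alpha> ?c" using coroot_two[OF a] by simp
  also have "\<dots> \<le> root_form ?c ?c"
    unfolding root_form_def using finite_Sig a by (intro member_le_sum) auto
  finally show "root_form ?c ?c > 0" .
qed

text \<open>A point of the \<open>W\<close>-orbit of \<open>v\<close> with maximal pairing against a point of the open dominant
  chamber is dominant.\<close>

lemma Wsp_dominant: "\<exists>w\<in>Wsp D. \<forall>\<alpha>\<in>Sig_pos D. \<alpha> (coset_act D w v) \<ge> 0"
proof -
  obtain c where c: "\<forall>\<alpha>\<in>Sig_pos D. \<alpha> c > 0" using Sig_chamber by blast
  define f where "f w = root_form (coset_act D w v) c" for w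
  \<comment> \<open>The value f w depends only on the map on the finite set of roots induced by w,
    so there are finitely many values and a maximum exists.\<close>
  have "f ` Wsp D \<subseteq> (\<lambda>g. \<Sum>\<alpha>\<in>Sig D. g \<alpha> v * \<alpha> c) ` (Sig D \<rightarrow>\<^sub>E Sig D)"
  proof
    fix y assume "y \<in> f ` Wsp D"
    then obtain w where w: "w \<in> Wsp D" "y = f w" by blast
    have "restrict (\<lambda>\<alpha>. \<alpha> \<circ> coset_act D w) (Sig D) \<in> Sig D \<rightarrow>\<^sub>E Sig D" using Sig_Wsp w by auto
    moreover have "y = (\<Sum>\<alpha>\<in>Sig D. restrict (\<lambda>\<alpha>. \<alpha> \<circ> coset_act D w) (Sig D) \<alpha> v * \<alpha> c)"
      unfolding w(2) f_def root_form_def by (rule sum.cong) auto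
    ultimately show "y \<in> (\<lambda>g. \<Sum>\<alpha>\<in>Sig D. g \<alpha> v * \<alpha> c) ` (Sig D \<rightarrow>\<^sub>E Sig D)" by blast
  qed
  then have fin: "finite (f ` Wsp D)" by (rule finite_subset) (simp add: finite_PiE finite_Sig)
  have "f ` Wsp D \<noteq> {}" using Wsp_one by blast
  from Max_in[OF fin this] obtain w where w: "w \<in> Wsp D" "f w = Max (f ` Wsp D)" by force
  have "\<alpha> (coset_act D w v) \<ge> 0" if a: "\<alpha> \<in> Sig_pos D" for \<alpha>
  proof (rule ccontr)
    let ?x = "coset_act D w v"
    assume neg: "\<not> \<alpha> ?x \<ge> 0"
    have aS: "\<alpha> \<in> Sig D" by (rule Sig_pos_subset[OF a])
    let ?s = "s_refl D \<alpha>"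
    have s: "?s \<in> Wsp D"
      using s_refl[OF Sig_is_aff[OF aS]] by (simp add: Wsp_def refl_map_alt Sig_zero[OF aS])
    have "f (?s \<star> w) = root_form (?x - \<alpha> ?x *\<^sub>R coroot D \<alpha>) c"
      using Wsp_closed[OF w(1)] by (simp add: f_def s_refl_act[OF Sig_is_aff[OF aS]] refl_map_alt grad_Sig[OF aS])
    \<comment> \<open>If \<alpha> is negative at the maximal point, the reflection adds a positive
      multiple of the coroot, which pairs positively with c, so the value would rise.\<close>
    also have "\<dots> = f w - \<alpha> ?x * root_form (coroot D \<alpha>) c" by (simp add: root_form_line f_def)
    finally have e: "f (?s \<star> w) = f w - \<alpha> ?x * root_form (coroot D \<alpha>) c" .
    have "\<alpha> c * root_form (coroot D \<alpha>) (coroot D \<alpha>) > 0" using c a root_form_coroot(2)[OF aS] by simp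
    then have "root_form (coroot D \<alpha>) c > 0" using root_form_coroot(1)[OF aS, of c] by linarith
    then have "\<alpha> ?x * root_form (coroot D \<alpha>) c < 0" using neg by (intro mult_neg_pos) auto
    then have "f (?s \<star> w) > Max (f ` Wsp D)" using e w(2) by simp
    moreover have "f (?s \<star> w) \<le> Max (f ` Wsp D)"
      using Max_ge[OF fin] Wsp_mult[OF s w(1)] by blast
    ultimately show False by simp
  qed
  then show ?thesis using w(1) by blast
qed

lemma finite_Sig_pos: "finite (Sig_pos D)"
  by (rule finite_subset[OF _ finite_Sig]) (auto simp: Sig_pos_subset)

text \<open>Induction on the number of positive roots with smaller value at a point of the open
  chamber: \<open>Delta\<close> consists of the indecomposable positive roots, and both summands of
  a decomposable one have smaller value.\<close>

lemma Sig_pos_Delta_induct [consumes 1, case_names base step]: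
  assumes "\<alpha> \<in> Sig_pos D" and base: "\<And>\<delta>. \<delta> \<in> Delta D \<Longrightarrow> P \<delta>"
    and step: "\<And>\<beta> \<gamma>. \<beta> \<in> Sig_pos D \<Longrightarrow> \<gamma> \<in> Sig_pos D \<Longrightarrow> P \<beta> \<Longrightarrow> P \<gamma> \<Longrightarrow> P (\<lambda>v. \<beta> v + \<gamma> v)"
  shows "P \<alpha>"
proof -
  obtain c where c: "\<forall>\<alpha>\<in>Sig_pos D. \<alpha> c > 0" using Sig_chamber by blast
  show ?thesis using assms(1)
  proof (induction "card {\<beta> \<in> Sig_pos D. \<beta> c < \<alpha> c}" arbitrary: \<alpha> rule: less_induct)
    case less
    show ?case
    proof (cases "\<alpha> \<in> Delta D")
      case False
      then obtain \<beta> \<gamma> where bg: "\<beta> \<in> Sig_pos D" "\<gamma> \<in> Sig_pos D" "\<alpha> = (\<lambda>v. \<beta> v + \<gamma> v)"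
        using less.prems unfolding Delta_def by blast
      have small: "P \<delta>" if d: "\<delta> \<in> Sig_pos D" "\<delta> c < \<alpha> c" for \<delta>
      proof (rule less.hyps[OF psubset_card_mono d(1)])
        show "finite {\<beta> \<in> Sig_pos D. \<beta> c < \<alpha> c}" using finite_Sig_pos by simp
        show "{\<beta> \<in> Sig_pos D. \<beta> c < \<delta> c} \<subset> {\<beta> \<in> Sig_pos D. \<beta> c < \<alpha> c}"
          using d by (auto simp: psubset_eq set_eq_iff)
      qed
      have "\<beta> c < \<alpha> c" "\<gamma> c < \<alpha> c" using bspec[OF c bg(1)] bspec[OF c bg(2)] by (simp_all add: bg(3))
      then show ?thesis unfolding bg(3) using step[OF bg(1,2)] small bg by blast
    qed (rule base)
  qed
qed

lemma compat_sym: "compat l m \<Longrightarrow> compat m l"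
  unfolding compat_def
proof (intro ballI notI)
  fix \<beta> assume c: "\<forall>\<beta>\<in>Sig D. \<not> (\<beta> (nu D l) < 0 \<and> 0 < \<beta> (nu D m))" and b: "\<beta> \<in> Sig D"
    and n: "\<beta> (nu D m) < 0 \<and> 0 < \<beta> (nu D l)"
  show False using bspec[OF c Sig_neg[OF b]] n by simp
qed

lemma compat_cong: "nu D l = nu D l' \<Longrightarrow> compat l m = compat l' m" "nu D m = nu D m' \<Longrightarrow> compat l m = compat l m'"
  by (simp_all add: compat_def)

end

section \<open>Extending an action from a submonoid\<close>

text \<open>Invariance under conjugation makes \<open>P\<close> an Ore monoid.\<close>

lemma (in group) extend_action:
  fixes R :: "'a \<Rightarrow> 'x \<Rightarrow> 'x"
  assumes P: "P \<subseteq> carrier G" "\<And>p q. p \<in> P \<Longrightarrow> q \<in> P \<Longrightarrow> p \<otimes> q \<in> P" "\<one> \<in> P"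
    "\<And>p q. p \<in> P \<Longrightarrow> q \<in> P \<Longrightarrow> inv q \<otimes> p \<otimes> q \<in> P"
    and H: "\<And>h. h \<in> H \<Longrightarrow> \<exists>p\<in>P. \<exists>q\<in>P. h = p \<otimes> inv q" "\<And>g h. g \<in> H \<Longrightarrow> h \<in> H \<Longrightarrow> g \<otimes> h \<in> H" "P \<subseteq> H"
    and R: "\<And>p. p \<in> P \<Longrightarrow> bij (R p)" "\<And>p q x. p \<in> P \<Longrightarrow> q \<in> P \<Longrightarrow> R (p \<otimes> q) x = R q (R p x)"
  shows "\<exists>R'. (\<forall>p\<in>P. R' p = R p) \<and> (\<forall>g\<in>H. \<forall>h\<in>H. \<forall>x. R' (g \<otimes> h) x = R' h (R' g x)) \<and>
    (\<forall>g\<in>H. \<exists>p\<in>P. \<exists>q\<in>P. \<forall>x. R q (R' g x) = R p x)"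
proof -
  have inj: "R p x = R p y \<Longrightarrow> x = y" if "p \<in> P" for p x y using R(1)[OF that] by (auto dest: bij_is_inj injD)
  have surj: "R p (inv_into UNIV (R p) x) = x" if "p \<in> P" for p x
    using R(1)[OF that] by (simp add: bij_is_surj surj_f_inv_f)
  define frac where "frac g pq \<longleftrightarrow> fst pq \<in> P \<and> snd pq \<in> P \<and> g = fst pq \<otimes> inv (snd pq)" for g pq
  define pq where "pq g = (SOME pq. frac g pq)" for g
  define R' where "R' g x = inv_into UNIV (R (snd (pq g))) (R (fst (pq g)) x)" for g x
  have pq: "frac h (pq h)" if h: "h \<in> H" for h
  proof -
    obtain p q where "p \<in> P" "q \<in> P" "h = p \<otimes> inv q" using H(1)[OF h] by blast
    then have "frac h (p, q)" by (simp add: frac_def)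
    then show ?thesis unfolding pq_def by (rule someI)
  qed
  \<comment> \<open>Every fraction for g yields the same equation for R' g: the identities p' t = p
    q' and q' t = q q' bring the chosen fraction and the given one to a common denominator.\<close>
  have char: "R q (R' g x) = R p x" if p: "p \<in> P" and q: "q \<in> P" and g: "g \<in> H" "g = p \<otimes> inv q" for p q g x
  proof -
    obtain p' q' where p': "pq g = (p', q')" by fastforce
    have f: "p' \<in> P" "q' \<in> P" "g = p' \<otimes> inv q'" using pq[OF g(1)] by (simp_all add: frac_def p')
    have c: "p \<in> carrier G" "q \<in> carrier G" "p' \<in> carrier G" "q' \<in> carrier G" using p q f P(1) by auto
    define t where "t = inv q' \<otimes> q \<otimes> q'"
    have t: "t \<in> P" unfolding t_def by (rule P(4)[OF q f(2)])
    have "p' \<otimes> t = (p' \<otimes> inv q') \<otimes> (q \<otimes> q')" using c by (simp add: t_def m_assoc)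
    also have "\<dots> = p \<otimes> q'" using c by (simp add: f(3)[symmetric] g(2) m_assoc)
      (simp add: m_assoc[symmetric])
    finally have 1: "p' \<otimes> t = p \<otimes> q'" .
    have 2: "q' \<otimes> t = q \<otimes> q'" using c by (simp add: t_def m_assoc[symmetric])
    let ?y = "R' g x"
    have y: "R q' ?y = R p' x" unfolding R'_def p' by (simp add: surj f)
    have "R q' (R q ?y) = R t (R q' ?y)"
      using R(2)[OF q f(2), of ?y] R(2)[OF f(2) t, of ?y] 2 by simp
    also have "\<dots> = R q' (R p x)"
      using R(2)[OF f(1) t, of x] R(2)[OF p f(2), of x] 1 y by simp
    finally show ?thesis by (rule inj[OF f(2)])
  qed
  have ext: "R' p = R p" if p: "p \<in> P" for p
  proof
    fix x
    have "p \<in> H" "p = p \<otimes> inv \<one>" using p H(3) P(1) by auto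
    then have "R \<one> (R' p x) = R p x" by (rule char[OF p P(3)])
    also have "\<dots> = R \<one> (R p x)" using R(2)[OF p P(3), of x] p P(1) by auto
    finally show "R' p x = R p x" by (rule inj[OF P(3)])
  qed
  have hom: "R' (g \<otimes> h) x = R' h (R' g x)" if g: "g \<in> H" and h: "h \<in> H" for g h x
  proof -
    obtain p q where p: "p \<in> P" "q \<in> P" "g = p \<otimes> inv q" using H(1)[OF g] by blast
    obtain r s where r: "r \<in> P" "s \<in> P" "h = r \<otimes> inv s" using H(1)[OF h] by blast
    have c: "p \<in> carrier G" "q \<in> carrier G" "r \<in> carrier G" "s \<in> carrier G" using p r P(1) by auto
    \<comment> \<open>This moves r past the inverse of q, so that g h is again a fraction, with
      numerator p t and denominator s q.\<close>
    define t where "t = inv q \<otimes> r \<otimes> q"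
    have t: "t \<in> P" unfolding t_def by (rule P(4)[OF r(1) p(2)])
    have qt: "q \<otimes> t = r \<otimes> q" using c by (simp add: t_def m_assoc[symmetric])
    have "g \<otimes> h = (p \<otimes> t) \<otimes> inv (s \<otimes> q)" using c by (simp add: p r t_def inv_mult_group m_assoc) (simp add: m_assoc[symmetric])
    then have a: "R (s \<otimes> q) (R' (g \<otimes> h) x) = R (p \<otimes> t) x"
      using char[OF P(2)[OF p(1) t] P(2)[OF r(2) p(2)] H(2)[OF g h]] by blast
    let ?y = "R' g x" let ?u = "R' h ?y"
    have y: "R q ?y = R p x" by (rule char[OF p(1,2) g p(3)])
    have u: "R s ?u = R r ?y" by (rule char[OF r(1,2) h r(3)])
    have "R (s \<otimes> q) ?u = R q (R r ?y)" by (simp only: R(2)[OF r(2) p(2)] u)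
    also have "\<dots> = R t (R q ?y)" using R(2)[OF r(1) p(2), of ?y] R(2)[OF p(2) t, of ?y] qt by simp
    also have "\<dots> = R (p \<otimes> t) x" by (simp only: R(2)[OF p(1) t] y)
    finally show ?thesis using a inj[OF P(2)[OF r(2) p(2)]] by metis
  qed
  \<comment> \<open>The equation for fractions is part of the claim because it later carries
    additivity and scalars over from R to R'.\<close>
  show ?thesis
  proof (intro exI[of _ R'] conjI ballI allI)
    fix g assume g: "g \<in> H"
    obtain p q where "p \<in> P" "q \<in> P" "g = p \<otimes> inv q" using H(1)[OF g] by blast
    then show "\<exists>p\<in>P. \<exists>q\<in>P. \<forall>x. R q (R' g x) = R p x" using char g by blast
  qed (use ext hom in auto)
qed

section \<open>Irreducible modules\<close>

locale hecke_module = hecke_alg D sc T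
  for D :: "('k::alg_closed_field, 'n::finite, 'r::alg_closed_field, 'm::finite, 'v::real_vector) group_data"
    and sc :: "(('k^'n^'n) set, 'c::field) laurent \<Rightarrow> 'h::ring_1 \<Rightarrow> 'h"
    and T :: "('k^'n^'n) set \<Rightarrow> 'h" +
  fixes smul :: "'c \<Rightarrow> 'x::ab_group_add \<Rightarrow> 'x" and act :: "'x \<Rightarrow> 'h \<Rightarrow> 'x"
  assumes irr: "irreducible_A_module D sc T smul act"
begin

abbreviation A where "A \<equiv> bernstein_subalgebra D sc T"

lemma irr_conds:
  "\<exists>x::'x. x \<noteq> 0"
  "\<forall>Y. module.subspace smul Y \<and> (\<forall>y\<in>Y. \<forall>b\<in>A. act y b \<in> Y) \<longrightarrow> Y = {0} \<or> Y = UNIV"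
  "vector_space smul"
  "\<forall>x y. \<forall>b\<in>A. act (x + y) b = act x b + act y b"
  "\<forall>c x. \<forall>b\<in>A. act (smul c x) b = smul c (act x b)"
  "\<forall>x. \<forall>b\<in>A. \<forall>b'\<in>A. act x (b + b') = act x b + act x b'"
  "\<forall>x. \<forall>b\<in>A. \<forall>b'\<in>A. act x (b * b') = act (act x b) b'"
  "\<forall>x. act x 1 = x"
  "\<forall>x. \<forall>r\<in>q_ring D. \<forall>b\<in>A. act x (sc r b) = smul (q_zero r) (act x b)"
  using irr unfolding irreducible_A_module_def irreducible_right_module_def right_module_def
  by - (elim conjE, assumption)+

sublocale X: vector_space smul by (rule irr_conds(3))

lemma one_q_ring: "(1 :: (('k^'n^'n) set, 'c) laurent) \<in> q_ring D"
  by (auto simp: q_ring_def simp flip: single_one)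

lemma A_sum:
  "finite L \<Longrightarrow> L \<subseteq> Lam1 D \<Longrightarrow> r ` L \<subseteq> q_ring D \<Longrightarrow> (\<Sum>l\<in>L. sc (r l) (E l)) \<in> A"
  unfolding bernstein_subalgebra_def by blast

lemma A_sc_E: "l \<in> Lam1 D \<Longrightarrow> r \<in> q_ring D \<Longrightarrow> sc r (E l) \<in> A"
  using A_sum[of "{l}" "\<lambda>_. r"] by simp

lemma A_E: "l \<in> Lam1 D \<Longrightarrow> E l \<in> A"
  using A_sc_E[OF _ one_q_ring] by simp

lemma act_zero: "b \<in> A \<Longrightarrow> act 0 b = 0"
  using irr_conds(4) by (metis add_cancel_right_left)

text \<open>At q = 0 the monomial in the product of E(l) and E(m) becomes 1 or 0 according to
  whether its exponent vanishes, that is, whether no hyperplane is crossed twice. Nonnegative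
  exponents put the monomial into \<open>q_ring\<close>, whose action on the module is
  known.\<close>

lemma act_E_mult:
  assumes "l \<in> Lam1 D" "m \<in> Lam1 D"
  shows "act (act x (E l)) (E m) = (if compat l m then act x (E (l \<cdot> m)) else 0)"
proof -
  let ?k = "crossing_exp l m + crossing_exp l m"
  have lm: "l \<cdot> m \<in> Lam1 D" by (rule Lam1_mult[OF assms])
  note cl = assms[THEN Lam1_closed]
  have "Poly_Mapping.keys ?k \<subseteq> q_index D ` S_aff D"
    using crossing_exp_keys[OF cl] Poly_Mapping.keys_add[of "crossing_exp l m" "crossing_exp l m"] by blast
  moreover have "Poly_Mapping.lookup ?k i \<ge> 0" for i using crossing_exp_nonneg[of l m i] by (simp add: lookup_add)
  ultimately have q: "qm ?k \<in> q_ring D" by (simp add: q_ring_def)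
  have "?k = 0 \<longleftrightarrow> crossing_exp l m = 0"
  proof
    assume k: "?k = 0"
    show "crossing_exp l m = 0"
    proof (rule poly_mapping_eqI)
      fix i
      show "Poly_Mapping.lookup (crossing_exp l m) i = Poly_Mapping.lookup 0 i"
        using arg_cong[OF k, of "\<lambda>f. Poly_Mapping.lookup f i"] by (simp add: lookup_add)
    qed
  qed simp
  then have "q_zero (qm ?k) = (if compat l m then 1 else 0)"
    using crossing_exp_zero_iff[OF cl(1), of m] crossing_empty_iff[OF assms]
    by (simp add: q_zero_def lookup_single when_def)
  moreover have "act (act x (E l)) (E m) = act x (sc (qm ?k) (E (l \<cdot> m)))"
    using irr_conds(7) A_E assms bernstein_mult[OF assms] by metis
  moreover have "\<dots> = smul (q_zero (qm ?k)) (act x (E (l \<cdot> m)))"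
    using irr_conds(9) q A_E[OF lm] by blast
  ultimately show ?thesis by simp
qed

text \<open>Elements of A are combinations of the E(l) with coefficients in \<open>q_ring\<close>,
  which act as scalars from C; stability under the E(l) therefore suffices for irreducibility to
  apply.\<close>

lemma submodule:
  assumes sub: "X.subspace Y" and Y: "\<And>y l. y \<in> Y \<Longrightarrow> l \<in> Lam1 D \<Longrightarrow> act y (E l) \<in> Y"
  shows "Y = {0} \<or> Y = UNIV"
proof -
  have "act y b \<in> Y" if y: "y \<in> Y" and b: "b \<in> A" for y b
  proof -
    obtain L r where L: "b = (\<Sum>l\<in>L. sc (r l) (E l))" "finite L" "L \<subseteq> Lam1 D" "r ` L \<subseteq> q_ring D"
      using b unfolding bernstein_subalgebra_def by blast
    from L(2-4) have "act y (\<Sum>l\<in>L. sc (r l) (E l)) \<in> Y"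
    proof (induction L rule: finite_induct)
      case empty
      have z: "0 \<in> A" using A_sum[of "{}"] by simp
      then have "act y (0 + 0) = act y 0 + act y 0" using irr_conds(6) by blast
      then show ?case using X.subspace_0[OF sub] by simp
    next
      case (insert l L)
      have m: "sc (r l) (E l) \<in> A" "(\<Sum>l\<in>L. sc (r l) (E l)) \<in> A"
        using insert.prems insert.hyps by (auto intro: A_sc_E A_sum)
      have "act y (sc (r l) (E l) + (\<Sum>l\<in>L. sc (r l) (E l))) =
          smul (q_zero (r l)) (act y (E l)) + act y (\<Sum>l\<in>L. sc (r l) (E l))"
        using irr_conds(6) irr_conds(9) m A_E[of l] insert.prems by auto
      moreover have "act y (E l) \<in> Y" using Y y insert.prems by blast
      ultimately show ?case
        using insert sub by (simp add: X.subspace_add X.subspace_scale)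
    qed
    then show ?thesis by (simp add: L(1))
  qed
  then show ?thesis using irr_conds(2) sub by blast
qed

lemma act_E_zero_or_bij:
  assumes l: "l \<in> Lam1 D"
  shows "(\<forall>x. act x (E l) = 0) \<or> bij (\<lambda>x. act x (E l))"
proof -
  note lc = Lam1_closed[OF l]
  have add: "act (x + y) (E l) = act x (E l) + act y (E l)"
    and scale: "act (smul c x) (E l) = smul c (act x (E l))" for x y c
    using irr_conds(4,5) A_E[OF l] by blast+
  have zero: "act 0 (E m) = 0" if "m \<in> Lam1 D" for m using act_zero A_E[OF that] by blast
  have "X.subspace (range (\<lambda>x. act x (E l)))"
  proof (rule X.subspaceI)
    show "0 \<in> range (\<lambda>x. act x (E l))" using zero[OF l] by (metis rangeI)
  qed (use add scale in \<open>auto simp flip: add scale\<close>)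
  moreover have "act y (E m) \<in> range (\<lambda>x. act x (E l))"
    if y: "y \<in> range (\<lambda>x. act x (E l))" and m: "m \<in> Lam1 D" for y m
  proof -
    obtain x where x: "y = act x (E l)" using y by blast
    \<comment> \<open>Passing E(m) to the other side of E(l) conjugates m but keeps its \<nu>, so it
      does not affect whether the product vanishes.\<close>
    define m' where "m' = l \<cdot> m \<cdot> inv1 l"
    have m': "m' \<in> Lam1 D" unfolding m'_def by (rule Lam1_conj[OF m lc])
    have "nu D m' = nu D m" unfolding m'_def by (rule nu_conj_Lam1[OF m l])
    then have c: "compat m' l \<longleftrightarrow> compat l m" using compat_cong(1) compat_sym by metis
    have "m' \<cdot> l = l \<cdot> m" using lc Lam1_closed[OF m] by (simp add: m'_def W1.m_assoc)
    then have "act y (E m) = act (act x (E m')) (E l)"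
      by (simp add: x act_E_mult[OF l m] act_E_mult[OF m' l] c)
    then show ?thesis by blast
  qed
  ultimately have im: "range (\<lambda>x. act x (E l)) = {0} \<or> range (\<lambda>x. act x (E l)) = UNIV"
    by (rule submodule)
  have "X.subspace {x. act x (E l) = 0}"
    by (rule X.subspaceI) (simp_all add: zero[OF l] add scale)
  moreover have "act y (E m) \<in> {x. act x (E l) = 0}"
    if y: "y \<in> {x. act x (E l) = 0}" and m: "m \<in> Lam1 D" for y m
  proof -
    define m' where "m' = inv1 l \<cdot> m \<cdot> l"
    have m': "m' \<in> Lam1 D" unfolding m'_def by (rule Lam1_conj'[OF m lc])
    have "nu D m' = nu D m" unfolding m'_def by (rule nu_conj_Lam1'[OF m l])
    then have c: "compat l m' \<longleftrightarrow> compat m l" using compat_cong(2) compat_sym by metis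
    have "l \<cdot> m' = m \<cdot> l" using lc Lam1_closed[OF m] by (simp add: m'_def W1.m_assoc[symmetric])
    then have "act (act y (E m)) (E l) = act (act y (E l)) (E m')"
      by (simp add: act_E_mult[OF m l] act_E_mult[OF l m'] c)
    then show ?thesis using y zero[OF m'] by simp
  qed
  ultimately have ker: "{x. act x (E l) = 0} = {0} \<or> {x. act x (E l) = 0} = UNIV"
    by (rule submodule)
  show ?thesis
  proof (cases "\<forall>x. act x (E l) = 0")
    case False
    then have s: "range (\<lambda>x. act x (E l)) = UNIV" and k: "{x. act x (E l) = 0} = {0}"
      using im ker by blast+
    have "inj (\<lambda>x. act x (E l))"
    proof (rule injI)
      fix x y assume e: "act x (E l) = act y (E l)"
      have "act x (E l) = act (x - y) (E l) + act y (E l)" using add[of "x - y" y] by simp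
      then have "x - y \<in> {x. act x (E l) = 0}" using e by simp
      then show "x = y" using k by simp
    qed
    then show ?thesis using s by (simp add: bij_def)
  qed simp
qed

section \<open>The elements acting bijectively\<close>

definition M :: "('k^'n^'n) set set" where
  "M = {l \<in> Lam1 D. bij (\<lambda>x. act x (E l))}"

lemma zero_not_bij: "\<not> bij (\<lambda>x::'x. 0::'x)"
  using irr_conds(1) by (auto simp: bij_def inj_def)

lemma M_Lam1: "l \<in> M \<Longrightarrow> l \<in> Lam1 D"
  by (simp add: M_def)

lemma not_M_zero: "l \<in> Lam1 D \<Longrightarrow> l \<notin> M \<Longrightarrow> act x (E l) = 0"
  using act_E_zero_or_bij[of l] by (auto simp: M_def)

lemma M_one: "\<one>\<^bsub>Wt1 D\<^esub> \<in> M"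
  using irr_conds(8) by (simp add: M_def Lam1_one bernstein_one bij_def)

text \<open>The composite of two bijections of a nonzero module is not zero, which rules out the
  zero case of the product rule.\<close>

lemma M_mult:
  assumes "l \<in> M" "m \<in> M"
  shows "compat l m" "l \<cdot> m \<in> M"
proof -
  have lm: "l \<in> Lam1 D" "m \<in> Lam1 D" using assms by (auto simp: M_def)
  have "bij ((\<lambda>x. act x (E m)) \<circ> (\<lambda>x. act x (E l)))" using assms by (intro bij_comp) (auto simp: M_def)
  then have b: "bij (\<lambda>x. if compat l m then act x (E (l \<cdot> m)) else 0)"
    by (simp add: comp_def act_E_mult[OF lm])
  show c: "compat l m"
  proof (rule ccontr)
    assume "\<not> compat l m"
    then show False using b zero_not_bij by simp
  qed
  show "l \<cdot> m \<in> M" using b c lm by (simp add: M_def Lam1_mult)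
qed

text \<open>If E(l) acted by zero, then so would the product of E(l) and E(m), which by
  compatibility is E(l m).\<close>

lemma M_factor:
  assumes "l \<in> Lam1 D" "m \<in> Lam1 D" "compat l m" "l \<cdot> m \<in> M" shows "l \<in> M"
proof (rule ccontr)
  assume "l \<notin> M"
  then have "act x (E (l \<cdot> m)) = 0" for x
    using act_E_mult[OF assms(1,2), of x] assms(3) not_M_zero[OF assms(1)] act_zero[OF A_E[OF assms(2)]] by simp
  then show False using assms(4) zero_not_bij by (simp add: M_def)
qed

lemma M_pow: "l \<in> M \<Longrightarrow> l [^]\<^bsub>Wt1 D\<^esub> (N::nat) \<in> M"
  by (induction N) (auto simp: M_one M_mult)

text \<open>Take l0 with the largest number of roots that are nonzero on \<nu>(l0). Elements of M
  are pairwise compatible, so values of a root at l0 and l never cancel in their product; a root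
  nonzero only at l would enlarge the number.\<close>

lemma M_generic: "\<exists>l0\<in>M. \<forall>l\<in>M. \<forall>\<beta>\<in>Sig D. \<beta> (nu D l) \<noteq> 0 \<longrightarrow> \<beta> (nu D l0) \<noteq> 0"
proof -
  define f where "f l = card {\<beta> \<in> Sig D. \<beta> (nu D l) \<noteq> 0}" for l
  have bound: "f l \<le> card (Sig D)" for l unfolding f_def by (intro card_mono finite_Sig) auto
  have "finite (f ` M)" by (rule finite_subset[of _ "{..card (Sig D)}"]) (use bound in auto)
  moreover have "f ` M \<noteq> {}" using M_one by blast
  ultimately obtain l0 where l0: "l0 \<in> M" "\<And>l. l \<in> M \<Longrightarrow> f l \<le> f l0"
    using Max_in[of "f ` M"] Max_ge[of "f ` M"] by (metis (no_types, lifting) imageE imageI)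
  have "\<beta> (nu D l0) \<noteq> 0" if l: "l \<in> M" and b: "\<beta> \<in> Sig D" "\<beta> (nu D l) \<noteq> 0" for l \<beta>
  proof
    assume z: "\<beta> (nu D l0) = 0"
    let ?m = "l0 \<cdot> l"
    have nu: "\<gamma> (nu D ?m) = \<gamma> (nu D l0) + \<gamma> (nu D l)" if "\<gamma> \<in> Sig D" for \<gamma>
      using l l0(1) by (simp add: nu_mult M_Lam1 linear_add[OF Sig_linear[OF that]])
    have "{\<gamma> \<in> Sig D. \<gamma> (nu D l0) \<noteq> 0} \<subset> {\<gamma> \<in> Sig D. \<gamma> (nu D ?m) \<noteq> 0}"
    proof
      show "{\<gamma> \<in> Sig D. \<gamma> (nu D l0) \<noteq> 0} \<subseteq> {\<gamma> \<in> Sig D. \<gamma> (nu D ?m) \<noteq> 0}"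
      proof safe
        fix \<gamma> assume g: "\<gamma> \<in> Sig D" "\<gamma> (nu D l0) \<noteq> 0" "\<gamma> (nu D ?m) = 0"
        have "\<gamma> (nu D l0) < 0 \<and> \<gamma> (nu D l) > 0 \<or> \<gamma> (nu D l) < 0 \<and> \<gamma> (nu D l0) > 0"
          using nu[OF g(1)] g(2,3) by linarith
        then show False using M_mult(1)[OF l0(1) l] M_mult(1)[OF l l0(1)] g(1) unfolding compat_def by blast
      qed
      show "{\<gamma> \<in> Sig D. \<gamma> (nu D l0) \<noteq> 0} \<noteq> {\<gamma> \<in> Sig D. \<gamma> (nu D ?m) \<noteq> 0}"
      proof
        assume e: "{\<gamma> \<in> Sig D. \<gamma> (nu D l0) \<noteq> 0} = {\<gamma> \<in> Sig D. \<gamma> (nu D ?m) \<noteq> 0}"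
        have "\<beta> \<in> {\<gamma> \<in> Sig D. \<gamma> (nu D ?m) \<noteq> 0}" using b z nu[OF b(1)] by simp
        then have "\<beta> \<in> {\<gamma> \<in> Sig D. \<gamma> (nu D l0) \<noteq> 0}" using e by blast
        then show False using z by simp
      qed
    qed
    then have "f l0 < f ?m" unfolding f_def by (intro psubset_card_mono) (simp_all add: finite_Sig)
    then show False using l0(2)[OF M_mult(2)[OF l0(1) l]] by simp
  qed
  then show ?thesis using l0(1) by blast
qed

end

lemma lookup_ga_scale: "Poly_Mapping.lookup (ga_scale c f) k = c * Poly_Mapping.lookup f k"
  by (simp add: ga_scale_def Poly_Mapping.map.rep_eq when_def)

context hecke_module
begin

text \<open>The action R' is extended linearly to formal sums; its multiplicativity is that of a
  right action, in which g acts before h.\<close>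

lemma module_of_group_algebra:
  fixes R' :: "('k^'n^'n) set \<Rightarrow> 'x \<Rightarrow> 'x"
  assumes one: "\<And>x. R' \<one>\<^bsub>Wt1 D\<^esub> x = x"
    and mult: "\<And>g h x. g \<in> Lam_Theta D \<Theta> \<Longrightarrow> h \<in> Lam_Theta D \<Theta> \<Longrightarrow> R' (g \<cdot> h) x = R' h (R' g x)"
    and add: "\<And>g x y. g \<in> Lam_Theta D \<Theta> \<Longrightarrow> R' g (x + y) = R' g x + R' g y"
    and scale: "\<And>g c x. g \<in> Lam_Theta D \<Theta> \<Longrightarrow> R' g (smul c x) = smul c (R' g x)"
    and rho: "\<rho> = (\<lambda>x f. \<Sum>g\<in>Poly_Mapping.keys f. smul (Poly_Mapping.lookup f g) (R' g x))"
  shows "right_module smul id UNIV ga_scale (group_algebra D \<Theta>) (ga_mult D) (tau \<one>\<^bsub>Wt1 D\<^esub>) \<rho>"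
proof -
  \<comment> \<open>Letting sums run over any finite set containing the support makes elements with
    different supports comparable.\<close>
  have superset: "\<rho> x f = (\<Sum>g\<in>S. smul (Poly_Mapping.lookup f g) (R' g x))"
    if "finite S" "Poly_Mapping.keys f \<subseteq> S" for x f S
    unfolding rho using that by (intro sum.mono_neutral_left) (auto simp: in_keys_iff)
  have rho_add: "\<rho> x (f + f') = \<rho> x f + \<rho> x f'" for x f f'
  proof -
    let ?S = "Poly_Mapping.keys f \<union> Poly_Mapping.keys f'"
    have k: "Poly_Mapping.keys (f + f') \<subseteq> ?S" by (rule Poly_Mapping.keys_add)
    show ?thesis
      by (subst (1 2 3) superset[of ?S])
        (use k in \<open>auto simp: lookup_add X.scale_left_distrib sum.distrib\<close>)
  qed
  have rho_zero: "\<rho> x 0 = 0" for x by (simp add: rho)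
  have rho_sum: "\<rho> x (sum F I) = (\<Sum>i\<in>I. \<rho> x (F i))" for x I and F :: "_ \<Rightarrow> ('k^'n^'n) set \<Rightarrow>\<^sub>0 'c"
    by (induction I rule: infinite_finite_induct) (auto simp: rho_add rho_zero)
  have rho_single: "\<rho> x (Poly_Mapping.single g c) = smul c (R' g x)" for x g c
    by (subst superset[of "{g}"]) auto
  have R_zero: "R' g 0 = 0" if "g \<in> Lam_Theta D \<Theta>" for g
    using add[OF that, of 0 0] by simp
  have R_sum: "R' g (sum F I) = (\<Sum>i\<in>I. R' g (F i))" if "g \<in> Lam_Theta D \<Theta>"
    for g I and F :: "('k^'n^'n) set \<Rightarrow> 'x"
    by (induction I rule: infinite_finite_induct) (auto simp: add that R_zero)
  have keys: "g \<in> Lam_Theta D \<Theta>" if "b \<in> group_algebra D \<Theta>" "g \<in> Poly_Mapping.keys b"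
    for g and b :: "('k^'n^'n) set \<Rightarrow>\<^sub>0 'c"
    using that by (auto simp: group_algebra_def)
  have rho_mult: "\<rho> x (ga_mult D b b') = \<rho> (\<rho> x b) b'"
    if b: "b \<in> group_algebra D \<Theta>" "b' \<in> group_algebra D \<Theta>" for x b b'
  proof -
    have "\<rho> x (ga_mult D b b') = (\<Sum>l\<in>Poly_Mapping.keys b. \<Sum>m\<in>Poly_Mapping.keys b'.
        smul (Poly_Mapping.lookup b l * Poly_Mapping.lookup b' m) (R' (l \<cdot> m) x))"
      by (simp add: ga_mult_def rho_sum rho_single)
    also have "\<dots> = (\<Sum>m\<in>Poly_Mapping.keys b'. \<Sum>l\<in>Poly_Mapping.keys b.
        smul (Poly_Mapping.lookup b' m) (smul (Poly_Mapping.lookup b l) (R' m (R' l x))))"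
      using keys[OF b(1)] keys[OF b(2)]
      by (subst sum.swap) (intro sum.cong refl, simp add: mult mult.commute)
    also have "\<dots> = (\<Sum>m\<in>Poly_Mapping.keys b'. smul (Poly_Mapping.lookup b' m) (R' m (\<rho> x b)))"
      unfolding rho using keys[OF b(2)]
      by (intro sum.cong refl) (simp add: R_sum scale X.scale_sum_right)
    finally show ?thesis by (simp add: rho)
  qed
  have rho_scale: "\<rho> x (ga_scale r b) = smul r (\<rho> x b)" for x r b
  proof -
    have "Poly_Mapping.keys (ga_scale r b) \<subseteq> Poly_Mapping.keys b"
      by (auto simp: in_keys_iff lookup_ga_scale)
    then show ?thesis
      by (subst superset[of "Poly_Mapping.keys b"]) (auto simp: lookup_ga_scale rho X.scale_sum_right)
  qed
  show ?thesis
    unfolding right_module_def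
  proof (intro conjI allI ballI)
    show "vector_space smul" by (rule irr_conds(3))
    show "\<rho> (x + y) b = \<rho> x b + \<rho> y b" if "b \<in> group_algebra D \<Theta>" for x y b
      unfolding rho using keys[OF that] by (simp add: add X.scale_right_distrib sum.distrib)
    show "\<rho> (smul c x) b = smul c (\<rho> x b)" if "b \<in> group_algebra D \<Theta>" for c x b
      unfolding rho using keys[OF that] by (simp add: scale X.scale_sum_right mult.commute)
    show "\<rho> x (tau \<one>\<^bsub>Wt1 D\<^esub>) = x" for x by (simp add: tau_def rho_single one)
    show "\<rho> x (ga_scale r b) = smul (id r) (\<rho> x b)" for x r b by (simp add: rho_scale)
  qed (use rho_add rho_mult in auto)
qed

lemma factors_through_w_chi_Theta:
  "\<exists>w \<in> Wsp D. \<exists>\<Theta> \<subseteq> Delta D. \<exists>\<rho> :: 'x \<Rightarrow> (('k^'n^'n) set \<Rightarrow>\<^sub>0 'c) \<Rightarrow> 'x.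
    right_module smul id UNIV ga_scale (group_algebra D \<Theta>) (ga_mult D) (tau \<one>\<^bsub>Wt1 D\<^esub>) \<rho> \<and>
    (\<forall>x. \<forall>l \<in> Lam1 D. act x (E l) = \<rho> x (w_chi_Theta D sc T w \<Theta> (E l)))"
proof -
  obtain l0 where l0: "l0 \<in> M" "\<forall>l\<in>M. \<forall>\<beta>\<in>Sig D. \<beta> (nu D l) \<noteq> 0 \<longrightarrow> \<beta> (nu D l0) \<noteq> 0"
    using M_generic by blast
  \<comment> \<open>The element w0 moves the generic vector into the dominant chamber. The required
    w is its inverse, since \<open>w_chi_Theta\<close> evaluates at conjugates by the inverse of
    n_w.\<close>
  obtain w0 where w0: "w0 \<in> Wsp D" "\<forall>\<alpha>\<in>Sig_pos D. \<alpha> (coset_act D w0 (nu D l0)) \<ge> 0"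
    using Wsp_dominant by blast
  define w where "w = inv0 w0"
  have w: "w \<in> Wsp D" unfolding w_def by (rule Wsp_inv[OF w0(1)])
  define n where "n = n_w D w"
  have n: "n \<in> carrier (Wt1 D)" "proj D n = w" "coset_act D n = coset_act D w"
    using n_w_props[OF w] by (simp_all add: n_def)
  let ?G = "Wt1 D"
  define a where "a = coset_act D w0"
  have a0: "a 0 = 0" "coset_act D w 0 = 0" using w0 w by (simp_all add: a_def Wsp_def)
  have "proj D (inv1 n) = w0"
    using n Wsp_closed[OF w0(1)] by (simp add: proj_inv w_def)
  then have an: "coset_act D (inv1 n) = a" using coset_act_proj[of "inv1 n"] n(1) by (simp add: a_def)
  \<comment> \<open>On translation vectors \<sigma> acts as w0 and \<tau> as w, so \<sigma> carries
    the chamber of M to the dominant one.\<close>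
  define \<sigma> where "\<sigma> l = inv1 n \<cdot> l \<cdot> n" for l
  define \<tau> where "\<tau> l = n \<cdot> l \<cdot> inv1 n" for l
  have sL: "\<sigma> l \<in> Lam1 D" and tL: "\<tau> l \<in> Lam1 D" if "l \<in> Lam1 D" for l
    unfolding \<sigma>_def \<tau>_def using Lam1_conj Lam1_conj' that n(1) by auto
  have st: "\<sigma> (\<tau> l) = l" and ts: "\<tau> (\<sigma> l) = l" if "l \<in> Lam1 D" for l
    using n(1) Lam1_closed[OF that] unfolding \<sigma>_def \<tau>_def
    by (simp_all add: W1.m_assoc) (simp_all add: W1.m_assoc[symmetric])
  have tm: "\<tau> (l \<cdot> m) = \<tau> l \<cdot> \<tau> m" if "l \<in> Lam1 D" "m \<in> Lam1 D" for l m
    using n(1) Lam1_closed[OF that(1)] Lam1_closed[OF that(2)] unfolding \<tau>_def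
    by (simp add: W1.m_assoc) (simp add: W1.m_assoc[symmetric])
  have nus: "nu D (\<sigma> l) = a (nu D l)" if "l \<in> Lam1 D" for l
    using nu_conj[OF that, of "inv1 n"] n(1) by (simp add: \<sigma>_def an a0)
  have nut: "nu D (\<tau> l) = coset_act D w (nu D l)" if "l \<in> Lam1 D" for l
    using nu_conj[OF that n(1)] by (simp add: \<tau>_def n(3) a0)
  have t1: "\<tau> \<one>\<^bsub>?G\<^esub> = \<one>\<^bsub>?G\<^esub>" using n(1) by (simp add: \<tau>_def)
  \<comment> \<open>These simple roots cut out the face of the dominant chamber that has the moved
    generic vector in its relative interior.\<close>
  define \<Theta> where "\<Theta> = {\<delta> \<in> Delta D. \<delta> (a (nu D l0)) = 0}"
  define P where "P = Lam_Theta_plus D \<Theta>"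
  have P_iff: "l \<in> P \<longleftrightarrow> l \<in> Lam1 D \<and> (\<forall>\<delta>\<in>\<Theta>. \<delta> (nu D l) = 0) \<and> dominant D l" for l
    by (auto simp: P_def Lam_Theta_plus_def Lam_Theta_def)
  have Th: "\<delta> \<in> Sig D" if "\<delta> \<in> \<Theta>" for \<delta>
    using that by (auto simp: \<Theta>_def Delta_def intro: Sig_pos_subset)
  have Sa: "\<alpha> \<circ> a \<in> Sig D" if "\<alpha> \<in> Sig D" for \<alpha> unfolding a_def by (rule Sig_Wsp[OF that w0(1)])
  \<comment> \<open>A positive root is a sum of simple roots, each nonnegative at the moved generic
    vector. If the sum vanishes there, each summand does, so all of them lie in \<Theta>.\<close>
  have vanish: "\<alpha> v = 0" if "\<alpha> \<in> Sig_pos D" "\<forall>\<delta>\<in>\<Theta>. \<delta> v = 0" "\<alpha> (a (nu D l0)) = 0" for \<alpha> v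
  proof -
    have "\<alpha> (a (nu D l0)) = 0 \<longrightarrow> \<alpha> v = 0"
      using that(1)
    proof (induction rule: Sig_pos_Delta_induct)
      case (step \<beta> \<gamma>)
      have "\<beta> (a (nu D l0)) \<ge> 0" "\<gamma> (a (nu D l0)) \<ge> 0" using w0(2) step(1,2) by (auto simp: a_def)
      then show ?case using step(3,4) by (auto simp: add_nonneg_eq_0_iff)
    qed (use that(2) in \<open>auto simp: \<Theta>_def\<close>)
    then show ?thesis using that(3) by simp
  qed
  \<comment> \<open>Vanishing on \<Theta> is the genericity of l0. For dominance, a transported
    positive root that is negative at l is nonzero at l0, hence positive there, against
    compatibility of l and l0.\<close>
  have M_P: "\<sigma> l \<in> P" if l: "l \<in> M" for l
    unfolding P_iff
  proof (intro conjI ballI)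
    have lL: "l \<in> Lam1 D" by (rule M_Lam1[OF l])
    show "\<sigma> l \<in> Lam1 D" by (rule sL[OF lL])
    show "\<delta> (nu D (\<sigma> l)) = 0" if d: "\<delta> \<in> \<Theta>" for \<delta>
    proof (rule ccontr)
      assume "\<delta> (nu D (\<sigma> l)) \<noteq> 0"
      then have "(\<delta> \<circ> a) (nu D l) \<noteq> 0" by (simp add: nus[OF lL])
      then have "(\<delta> \<circ> a) (nu D l0) \<noteq> 0" using l0(2) l Sa[OF Th[OF d]] by blast
      then show False using d by (simp add: \<Theta>_def)
    qed
    show "dominant D (\<sigma> l)" unfolding dominant_def
    proof (rule ballI, rule ccontr)
      fix \<alpha> assume al: "\<alpha> \<in> Sig_pos D" and neg: "\<not> 0 \<le> \<alpha> (nu D (\<sigma> l))"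
      have S: "\<alpha> \<circ> a \<in> Sig D" by (rule Sa[OF Sig_pos_subset[OF al]])
      have ng: "(\<alpha> \<circ> a) (nu D l) < 0" using neg by (simp add: nus[OF lL])
      then have "(\<alpha> \<circ> a) (nu D l0) \<noteq> 0" using l0(2) l S by (metis less_irrefl)
      then have "(\<alpha> \<circ> a) (nu D l0) > 0" using w0(2) al by (force simp: a_def)
      then show False using M_mult(1)[OF l l0(1)] S ng unfolding compat_def by blast
    qed
  qed
  define s where "s = \<sigma> l0"
  have sP: "s \<in> P" unfolding s_def by (rule M_P[OF l0(1)])
  have s: "s \<in> Lam1 D" "nu D s = a (nu D l0)" using sP nus[OF M_Lam1[OF l0(1)]] by (auto simp: P_iff s_def)
  have tspow: "\<tau> (s [^]\<^bsub>?G\<^esub> N) = l0 [^]\<^bsub>?G\<^esub> N" for N :: nat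
  proof (induction N)
    case (Suc N)
    have "\<tau> (s [^]\<^bsub>?G\<^esub> N \<cdot> s) = \<tau> (s [^]\<^bsub>?G\<^esub> N) \<cdot> \<tau> s"
      using tm nu_pow[OF s(1)] s(1) by blast
    then show ?case using Suc ts[OF M_Lam1[OF l0(1)]] by (simp add: s_def)
  qed (simp add: t1)
  have spow: "s [^]\<^bsub>?G\<^esub> N \<in> P" for N :: nat
    unfolding P_iff dominant_def using nu_pow[OF s(1), of N] sP Th
    by (auto simp: P_iff dominant_def linear_scale[OF Sig_linear] Sig_pos_subset)
  \<comment> \<open>Positive roots that vanish on \<nu>(s) vanish on \<nu>(g) as well, and the
    others grow linearly in N.\<close>
  have large: "\<exists>N::nat. dominant D (g \<cdot> s [^]\<^bsub>?G\<^esub> N)"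
    if g: "g \<in> Lam1 D" "\<forall>\<delta>\<in>\<Theta>. \<delta> (nu D g) = 0" for g
  proof -
    have "finite {\<alpha> \<in> Sig_pos D. \<alpha> (a (nu D l0)) > 0}" using finite_Sig_pos by simp
    from finite_scale[OF this, of "\<lambda>\<alpha>. \<alpha> (a (nu D l0))" "\<lambda>\<alpha>. - \<alpha> (nu D g)"]
    obtain N :: nat where N: "\<forall>\<alpha>\<in>{\<alpha> \<in> Sig_pos D. \<alpha> (a (nu D l0)) > 0}. - \<alpha> (nu D g) < real N * \<alpha> (a (nu D l0))"
      by auto
    have "0 \<le> \<alpha> (nu D (g \<cdot> s [^]\<^bsub>?G\<^esub> N))" if al: "\<alpha> \<in> Sig_pos D" for \<alpha>
    proof -
      have lin: "linear \<alpha>" by (rule Sig_linear[OF Sig_pos_subset[OF al]])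
      have e: "\<alpha> (nu D (g \<cdot> s [^]\<^bsub>?G\<^esub> N)) = \<alpha> (nu D g) + real N * \<alpha> (a (nu D l0))"
        using nu_pow[OF s(1), of N] g(1) by (simp add: nu_mult linear_add[OF lin] linear_scale[OF lin] s(2))
      show ?thesis
      proof (cases "\<alpha> (a (nu D l0)) = 0")
        case True
        then show ?thesis using e vanish[OF al g(2)] by simp
      next
        case False
        then have "\<alpha> (a (nu D l0)) > 0" using w0(2) al by (force simp: a_def)
        then show ?thesis using N al e by fastforce
      qed
    qed
    then show ?thesis by (auto simp: dominant_def)
  qed
  have compat_dom: "compat (\<tau> g) (\<tau> h)"
    if g: "g \<in> Lam1 D" "dominant D g" and h: "h \<in> Lam1 D" "dominant D h" for g h
    unfolding compat_def
  proof (intro ballI notI)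
    fix \<beta> assume b: "\<beta> \<in> Sig D" "\<beta> (nu D (\<tau> g)) < 0 \<and> 0 < \<beta> (nu D (\<tau> h))"
    have S: "\<beta> \<circ> coset_act D w \<in> Sig D" by (rule Sig_Wsp[OF b(1) w])
    have v: "(\<beta> \<circ> coset_act D w) (nu D g) < 0" "(\<beta> \<circ> coset_act D w) (nu D h) > 0"
      using b(2) by (simp_all add: nut g(1) h(1))
    from Sig_split[OF S] show False
    proof
      assume "\<beta> \<circ> coset_act D w \<in> Sig_pos D"
      from bspec[OF g(2)[unfolded dominant_def] this] show False using v by simp
    next
      assume "(\<lambda>v. - (\<beta> \<circ> coset_act D w) v) \<in> Sig_pos D"
      from bspec[OF h(2)[unfolded dominant_def] this] show False using v by simp
    qed
  qed
  \<comment> \<open>The converse of \<open>M_P\<close>: for large N the quotient of s^N by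
    \<sigma>(l) is dominant, so l is a factor of a power of l0 with cofactor in the same chamber,
    and \<open>M_factor\<close> applies.\<close>
  have P_M: "l \<in> M" if l: "l \<in> Lam1 D" "\<sigma> l \<in> P" for l
  proof -
    let ?g = "inv1 (\<sigma> l)"
    have gL: "?g \<in> Lam1 D" by (rule Lam1_inv[OF sL[OF l(1)]])
    have "\<delta> (nu D ?g) = 0" if d: "\<delta> \<in> \<Theta>" for \<delta>
      using l(2) d by (simp add: nu_inv[OF sL[OF l(1)]] linear_neg[OF Sig_linear[OF Th[OF d]]] P_iff)
    then obtain N :: nat where N: "dominant D (?g \<cdot> s [^]\<^bsub>?G\<^esub> N)" using large[OF gL] by blast
    let ?h = "?g \<cdot> s [^]\<^bsub>?G\<^esub> N"
    have sN: "s [^]\<^bsub>?G\<^esub> N \<in> Lam1 D" using nu_pow[OF s(1)] by blast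
    have hL: "?h \<in> Lam1 D" by (rule Lam1_mult[OF gL sN])
    have "\<sigma> l \<cdot> ?h = s [^]\<^bsub>?G\<^esub> N"
      using Lam1_closed[OF sL[OF l(1)]] Lam1_closed[OF sN] by (simp add: W1.m_assoc[symmetric])
    then have e: "l \<cdot> \<tau> ?h = l0 [^]\<^bsub>?G\<^esub> N"
      using tm[OF sL[OF l(1)] hL] ts[OF l(1)] tspow[of N] by simp
    have "compat (\<tau> (\<sigma> l)) (\<tau> ?h)"
      using compat_dom[OF sL[OF l(1)] _ hL N] l(2) by (simp add: P_iff)
    then have c: "compat l (\<tau> ?h)" by (simp add: ts[OF l(1)])
    show ?thesis by (rule M_factor[OF l(1) tL[OF hL] c]) (simp add: e M_pow[OF l0(1)])
  qed
  have P_tau: "\<tau> p \<in> M" if "p \<in> P" for p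
    using P_M[OF tL, of p] st[of p] that by (simp add: P_iff)
  define R where "R p x = act x (E (\<tau> p))" for p x
  have Pl: "p \<in> Lam1 D" "p \<in> carrier ?G" if "p \<in> P" for p
    using that Lam1_closed by (auto simp: P_iff)
  have P_mult: "p \<cdot> q \<in> P" if p: "p \<in> P" and q: "q \<in> P" for p q
    unfolding P_iff dominant_def
  proof (intro conjI ballI)
    have e: "\<alpha> (nu D (p \<cdot> q)) = \<alpha> (nu D p) + \<alpha> (nu D q)" if "\<alpha> \<in> Sig D" for \<alpha>
      using Pl p q by (simp add: nu_mult linear_add[OF Sig_linear[OF that]])
    show "p \<cdot> q \<in> Lam1 D" using Pl p q by (simp add: Lam1_mult)
    show "\<delta> (nu D (p \<cdot> q)) = 0" if d: "\<delta> \<in> \<Theta>" for \<delta>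
    proof -
      have "\<delta> (nu D p) = 0" "\<delta> (nu D q) = 0" using p q d unfolding P_iff by blast+
      then show ?thesis by (simp add: e Th d)
    qed
    show "0 \<le> \<alpha> (nu D (p \<cdot> q))" if "\<alpha> \<in> Sig_pos D" for \<alpha>
      using p q that by (simp add: e Sig_pos_subset P_iff dominant_def)
  qed
  have P_one: "\<one>\<^bsub>?G\<^esub> \<in> P"
    using spow[of 0] by simp
  have P_conj: "inv1 q \<cdot> p \<cdot> q \<in> P" if p: "p \<in> P" and q: "q \<in> P" for p q
    using p Lam1_conj'[OF Pl(1)[OF p] Pl(2)[OF q]] nu_conj_Lam1'[OF Pl(1)[OF p] Pl(1)[OF q]]
    by (simp add: P_iff dominant_def)
  \<comment> \<open>Multiplication by a large power of s makes h dominant and keeps it orthogonal to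
    \<Theta>, which exhibits it as a fraction over P.\<close>
  have frac: "\<exists>p\<in>P. \<exists>q\<in>P. h = p \<cdot> inv1 q" if h: "h \<in> Lam_Theta D \<Theta>" for h
  proof -
    have hL: "h \<in> Lam1 D" "\<forall>\<delta>\<in>\<Theta>. \<delta> (nu D h) = 0" using h by (auto simp: Lam_Theta_def)
    obtain N :: nat where N: "dominant D (h \<cdot> s [^]\<^bsub>?G\<^esub> N)" using large[OF hL] by blast
    let ?q = "s [^]\<^bsub>?G\<^esub> N"
    have q: "?q \<in> P" by (rule spow)
    have "\<delta> (nu D (h \<cdot> ?q)) = 0" if d: "\<delta> \<in> \<Theta>" for \<delta>
    proof -
      have "\<delta> (nu D h) = 0" "\<delta> (nu D ?q) = 0" using hL(2) q d unfolding P_iff by blast+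
      then show ?thesis using hL(1) Pl(1)[OF q] by (simp add: nu_mult linear_add[OF Sig_linear[OF Th[OF d]]])
    qed
    then have "h \<cdot> ?q \<in> P" using N hL(1) Pl(1)[OF q] by (simp add: P_iff Lam1_mult)
    moreover have "h = (h \<cdot> ?q) \<cdot> inv1 ?q"
      using Lam1_closed[OF hL(1)] Pl(2)[OF q] by (simp add: W1.m_assoc)
    ultimately show ?thesis using q by blast
  qed
  have LT_mult: "g \<cdot> h \<in> Lam_Theta D \<Theta>" if g: "g \<in> Lam_Theta D \<Theta>" and h: "h \<in> Lam_Theta D \<Theta>" for g h
    using g h by (auto simp: Lam_Theta_def Lam1_mult nu_mult linear_add[OF Sig_linear[OF Th]])
  have R_bij: "bij (R p)" if "p \<in> P" for p
    using P_tau[OF that] by (simp add: M_def R_def[abs_def])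
  have R_mult: "R (p \<cdot> q) x = R q (R p x)" if p: "p \<in> P" and q: "q \<in> P" for p q x
    using act_E_mult[OF tL[OF Pl(1)[OF p]] tL[OF Pl(1)[OF q]]] M_mult(1)[OF P_tau[OF p] P_tau[OF q]]
    by (simp add: R_def tm Pl(1) p q)
  have P_LT: "P \<subseteq> Lam_Theta D \<Theta>" by (auto simp: P_def Lam_Theta_plus_def)
  obtain R' where R': "\<forall>p\<in>P. R' p = R p"
    "\<forall>g\<in>Lam_Theta D \<Theta>. \<forall>h\<in>Lam_Theta D \<Theta>. \<forall>x. R' (g \<cdot> h) x = R' h (R' g x)"
    "\<forall>g\<in>Lam_Theta D \<Theta>. \<exists>p\<in>P. \<exists>q\<in>P. \<forall>x. R q (R' g x) = R p x"
    using W1.extend_action[of P "Lam_Theta D \<Theta>" R, OF _ P_mult P_one P_conj frac LT_mult P_LT R_bij R_mult] Pl(2)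
    by blast
  have R_lin: "R p (x + y) = R p x + R p y" "R p (smul c x) = smul c (R p x)" if "p \<in> P" for p x y c
    using irr_conds(4,5) A_E[OF tL[OF Pl(1)[OF that]]] by (auto simp: R_def)
  have R_inj: "x = y" if "p \<in> P" "R p x = R p y" for p x y
    using R_bij[OF that(1)] that(2) by (auto dest: bij_is_inj injD)
  have R'_lin: "R' g (x + y) = R' g x + R' g y" "R' g (smul c x) = smul c (R' g x)"
    if g: "g \<in> Lam_Theta D \<Theta>" for g x y c
  proof -
    obtain p q where pq: "p \<in> P" "q \<in> P" "\<forall>x. R q (R' g x) = R p x" using R'(3) g by blast
    show "R' g (x + y) = R' g x + R' g y" by (rule R_inj[OF pq(2)]) (simp add: R_lin pq)
    show "R' g (smul c x) = smul c (R' g x)" by (rule R_inj[OF pq(2)]) (simp add: R_lin pq)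
  qed
  have R'_one: "R' \<one>\<^bsub>?G\<^esub> x = x" for x
    using R'(1) P_one irr_conds(8) by (simp add: R_def t1 bernstein_one)
  define \<rho> where "\<rho> = (\<lambda>x f. \<Sum>g\<in>Poly_Mapping.keys f. smul (Poly_Mapping.lookup f g) (R' g x))"
  have mod: "right_module smul id UNIV ga_scale (group_algebra D \<Theta>) (ga_mult D) (tau \<one>\<^bsub>?G\<^esub>) \<rho>"
    by (rule module_of_group_algebra[OF R'_one _ R'_lin \<rho>_def]) (use R'(2) in auto)
  have "act x (E l) = \<rho> x (w_chi_Theta D sc T w \<Theta> (E l))" if l: "l \<in> Lam1 D" for x l
  proof -
    have "w_chi_Theta D sc T w \<Theta> (E l) = (if \<sigma> l \<in> P then tau (\<sigma> l) else 0)"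
      unfolding w_chi_Theta_def chi_Theta_def P_def
      by (simp add: extend_from_E_bernstein l sL[OF l] \<sigma>_def[symmetric] n_def[symmetric])
    moreover have "act x (E l) = \<rho> x (tau (\<sigma> l))" if "\<sigma> l \<in> P"
      using R'(1) that by (simp add: \<rho>_def tau_def R_def ts[OF l])
    \<comment> \<open>By \<open>M_P\<close> such an l is not in M, so E(l) acts by zero, in
      agreement with the value 0 of the character.\<close>
    moreover have "act x (E l) = 0" if "\<sigma> l \<notin> P"
      using not_M_zero[OF l] M_P that by blast
    ultimately show ?thesis by (simp add: \<rho>_def)
  qed
  moreover have "\<Theta> \<subseteq> Delta D" by (auto simp: \<Theta>_def)
  ultimately show ?thesis using w mod by blast
qed

end

theorem proposition3p6:
  fixes D :: "('k::alg_closed_field, 'n::finite, 'r::alg_closed_field, 'm::finite, 'v::real_vector) group_data"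
    and sc :: "(('k^'n^'n) set, 'c::alg_closed_field) laurent \<Rightarrow> 'h::ring_1 \<Rightarrow> 'h"
    and T :: "('k^'n^'n) set \<Rightarrow> 'h"
    and smul :: "'c \<Rightarrow> 'x::ab_group_add \<Rightarrow> 'x"
    and act :: "'x \<Rightarrow> 'h \<Rightarrow> 'x"
  assumes "is_group_data D"
    and "CHAR('c) = res_char D"
    and "is_hecke_algebra D sc T"
    and "irreducible_A_module D sc T smul act"
  shows "\<exists>w \<in> Wsp D. \<exists>\<Theta> \<subseteq> Delta D. \<exists>\<rho> :: 'x \<Rightarrow> (('k^'n^'n) set \<Rightarrow>\<^sub>0 'c) \<Rightarrow> 'x.
    right_module smul id UNIV ga_scale (group_algebra D \<Theta>) (ga_mult D) (tau \<one>\<^bsub>Wt1 D\<^esub>) \<rho> \<and>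
    (\<forall>x. \<forall>l \<in> Lam1 D.
       act x (bernstein D sc T l) = \<rho> x (w_chi_Theta D sc T w \<Theta> (bernstein D sc T l)))"
proof -
  interpret hecke_module D sc T smul act
    using assms by unfold_locales
  show ?thesis by (rule factors_through_w_chi_Theta)
qed

end
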